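(* Let $1<p\le q<\infty$, $\omega\in\mathcal{D}$, $\upsilon$ a positive Borel measure on $\mathbb{D}$, $\varphi,\psi\in S(\mathbb{D})$ and $u_0,u_1\in H(\mathbb{D})$. If $u_0C_\varphi+u_1D^{(1)}_\psi:A^p_\omega\to L^q_\upsilon$ is bounded, then $$\|u_0C_\varphi+u_1D^{(1)}_\psi\|_{e,A^p_\omega\to L^q_\upsilon}\approx\|u_0C_\varphi\|_{e,A^p_\omega\to L^q_\upsilon}+\|u_1D^{(1)}_\psi\|_{e,A^p_\omega\to L^q_\upsilon}.$$
   Context: $\mathbb{D}$ is the open unit disc, $dA$ the normalized area measure, $H(\mathbb{D})$ the analytic functions on $\mathbb{D}$, $S(\mathbb{D})$ the analytic self-maps of $\mathbb{D}$. For $u\in H(\mathbb{D})$, $\varphi\in S(\mathbb{D})$: $uC_\varphi f=u\,(f\circ\varphi)$ and $uD^{(1)}_\varphi f=u\,(f'\circ\varphi)$. A radial weight is a nonnegative $\omega\in L^1([0,1])$ extended by $\omega(z)=\omega(|z|)$; set $\hat\omega(r)=\int_r^1\omega(t)\,dt$, and assume $\hat\omega(r)>0$ for all $r<1$. $\hat{\mathcal{D}}$ is the class of radial weights with $\hat\omega(r)\le C\hat\omega(\frac{1+r}{2})$ for all $0\le r<1$ and some $C\ge1$; $\mathcal{D}$ is the class of $\omega\in\hat{\mathcal{D}}$ for which additionally there are $K>1$, $C>1$ with $\hat\omega(r)\ge C\hat\omega(1-\frac{1-r}{K})$ for all $0\le r<1$. $A^p_\omega$ is the space of $f\in H(\mathbb{D})$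 with $\|f\|^p_{A^p_\omega}=\int_{\mathbb{D}}|f|^p\omega\,dA<\infty$. $L^q_\upsilon=L^q(\mathbb{D},\upsilon)$. The essential norm of a bounded operator $T:X\to Y$ is $\|T\|_{e,X\to Y}=\inf\{\|T-K\|_{X\to Y}:K:X\to Y\text{ compact}\}$. $A\approx B$ means two-sided inequality with constants independent of $u_0,u_1,\varphi,\psi,\upsilon$. *)

theory Defs
  imports "HOL-Analysis.Analysis"
begin

definition disc :: "complex set" where
  "disc = ball 0 1"

definition self_map :: "(complex \<Rightarrow> complex) \<Rightarrow> bool" where
  "self_map \<phi> \<longleftrightarrow> \<phi> holomorphic_on disc \<and> \<phi> ` disc \<subseteq> disc"

definition omega_hat :: "(real \<Rightarrow> real) \<Rightarrow> real \<Rightarrow> real" where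
  "omega_hat \<omega> r = (\<integral>t\<in>{r..1}. \<omega> t \<partial>lborel)"

definition radial_weight :: "(real \<Rightarrow> real) \<Rightarrow> bool" where
  "radial_weight \<omega> \<longleftrightarrow> set_integrable lborel {0..1} \<omega> \<and> (\<forall>t\<in>{0..1}. 0 \<le> \<omega> t)
     \<and> (\<forall>r\<in>{0..<1}. 0 < omega_hat \<omega> r)"

definition weight_Dhat :: "(real \<Rightarrow> real) \<Rightarrow> bool" where
  "weight_Dhat \<omega> \<longleftrightarrow> radial_weight \<omega> \<and>
     (\<exists>C\<ge>1. \<forall>r\<in>{0..<1}. omega_hat \<omega> r \<le> C * omega_hat \<omega> ((1 + r) / 2))"

definition weight_D :: "(real \<Rightarrow> real) \<Rightarrow> bool" where
  "weight_D \<omega> \<longleftrightarrow> weight_Dhat \<omega> \<and>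
     (\<exists>K>1. \<exists>C>1. \<forall>r\<in>{0..<1}. omega_hat \<omega> r \<ge> C * omega_hat \<omega> (1 - (1 - r) / K))"

definition root_enn :: "ennreal \<Rightarrow> real \<Rightarrow> ennreal" where
  "root_enn I p = (if I = \<infinity> then \<infinity> else ennreal (enn2real I powr (1 / p)))"

text \<open>Weighted Bergman space A^p_omega with normalized area measure dA = dx dy / pi.\<close>
definition Ap_int :: "(real \<Rightarrow> real) \<Rightarrow> real \<Rightarrow> (complex \<Rightarrow> complex) \<Rightarrow> ennreal" where
  "Ap_int \<omega> p f = (\<integral>\<^sup>+ z\<in>disc. ennreal (norm (f z) powr p * \<omega> (norm z) / pi) \<partial>(lborel :: complex measure))"

definition Ap_norm :: "(real \<Rightarrow> real) \<Rightarrow> real \<Rightarrow> (complex \<Rightarrow> complex) \<Rightarrow> ennreal" where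
  "Ap_norm \<omega> p f = root_enn (Ap_int \<omega> p f) p"

definition Ap_space :: "(real \<Rightarrow> real) \<Rightarrow> real \<Rightarrow> (complex \<Rightarrow> complex) set" where
  "Ap_space \<omega> p = {f. f holomorphic_on disc \<and> Ap_int \<omega> p f < \<infinity>}"

text \<open>L^q(D, upsilon), upsilon a positive Borel measure (on the Borel sets of C, only its
  restriction to the disc matters).\<close>
definition Lq_int :: "complex measure \<Rightarrow> real \<Rightarrow> (complex \<Rightarrow> complex) \<Rightarrow> ennreal" where
  "Lq_int \<upsilon> q g = (\<integral>\<^sup>+ z\<in>disc. ennreal (norm (g z) powr q) \<partial>\<upsilon>)"

definition Lq_norm :: "complex measure \<Rightarrow> real \<Rightarrow> (complex \<Rightarrow> complex) \<Rightarrow> ennreal" where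
  "Lq_norm \<upsilon> q g = root_enn (Lq_int \<upsilon> q g) q"

definition Lq_space :: "complex measure \<Rightarrow> real \<Rightarrow> (complex \<Rightarrow> complex) set" where
  "Lq_space \<upsilon> q = {g. g \<in> borel_measurable \<upsilon> \<and> Lq_int \<upsilon> q g < \<infinity>}"

type_synonym opr = "(complex \<Rightarrow> complex) \<Rightarrow> (complex \<Rightarrow> complex)"

definition op_norm :: "(real \<Rightarrow> real) \<Rightarrow> real \<Rightarrow> complex measure \<Rightarrow> real \<Rightarrow> opr \<Rightarrow> ennreal" where
  "op_norm \<omega> p \<upsilon> q T = (SUP f\<in>{f\<in>Ap_space \<omega> p. Ap_norm \<omega> p f \<le> 1}. Lq_norm \<upsilon> q (T f))"

definition bounded_op :: "(real \<Rightarrow> real) \<Rightarrow> real \<Rightarrow> complex measure \<Rightarrow> real \<Rightarrow> opr \<Rightarrow> bool" where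
  "bounded_op \<omega> p \<upsilon> q T \<longleftrightarrow>
     (\<exists>M\<ge>0. \<forall>f\<in>Ap_space \<omega> p. Lq_norm \<upsilon> q (T f) \<le> ennreal M * Ap_norm \<omega> p f)"

definition compact_op :: "(real \<Rightarrow> real) \<Rightarrow> real \<Rightarrow> complex measure \<Rightarrow> real \<Rightarrow> opr \<Rightarrow> bool" where
  "compact_op \<omega> p \<upsilon> q K \<longleftrightarrow>
     (\<forall>f\<in>Ap_space \<omega> p. K f \<in> Lq_space \<upsilon> q) \<and>
     (\<forall>f\<in>Ap_space \<omega> p. \<forall>g\<in>Ap_space \<omega> p. \<forall>a b :: complex.
        K (\<lambda>z. a * f z + b * g z) = (\<lambda>z. a * K f z + b * K g z)) \<and>
     (\<forall>F. (\<forall>n. F n \<in> Ap_space \<omega> p \<and> Ap_norm \<omega> p (F n) \<le> 1) \<longrightarrow>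
        (\<exists>(r::nat \<Rightarrow> nat) h. strict_mono r \<and> h \<in> Lq_space \<upsilon> q \<and>
           ((\<lambda>n. Lq_norm \<upsilon> q (\<lambda>z. K (F (r n)) z - h z)) \<longlongrightarrow> 0) sequentially))"

definition ess_norm :: "(real \<Rightarrow> real) \<Rightarrow> real \<Rightarrow> complex measure \<Rightarrow> real \<Rightarrow> opr \<Rightarrow> ennreal" where
  "ess_norm \<omega> p \<upsilon> q T =
     (INF K\<in>{K. compact_op \<omega> p \<upsilon> q K}. op_norm \<omega> p \<upsilon> q (\<lambda>f z. T f z - K f z))"

definition wC :: "(complex \<Rightarrow> complex) \<Rightarrow> (complex \<Rightarrow> complex) \<Rightarrow> opr" where
  "wC u \<phi> = (\<lambda>f z. u z * f (\<phi> z))"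

definition wD :: "(complex \<Rightarrow> complex) \<Rightarrow> (complex \<Rightarrow> complex) \<Rightarrow> opr" where
  "wD u \<psi> = (\<lambda>f z. u z * deriv f (\<psi> z))"

end

theory Submission
  imports Defs "HOL-Complex_Analysis.Complex_Analysis"
begin

text \<open>
  The upper estimate is subadditivity of the essential norm. For the lower one write
  \<open>T = u\<^sub>0 C\<^sub>\<phi> + u\<^sub>1 D\<^sub>\<psi>\<close>, let \<open>K\<close> be compact, and test \<open>T\<close> on normalised powers
  \<open>((1 - |a|\<^sup>2) / (1 - cnj a z))\<^sup>n\<close> for three consecutive exponents \<open>n\<close>. They tend to \<open>0\<close> pointwise
  as \<open>|a| \<rightarrow> 1\<close>, so \<open>K\<close> becomes negligible on them (here \<open>p > 1\<close> enters), and a linear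
  combination of the three values of \<open>T\<close> isolates \<open>u\<^sub>0\<close> where \<open>\<phi>\<close> is near \<open>a\<close>, respectively
  \<open>u\<^sub>1 / (1 - |a|)\<close> where \<open>\<psi>\<close> is near \<open>a\<close>. Thus each push-forward of \<open>|u\<^sub>k|\<^sup>q d\<upsilon>\<close> satisfies a Carleson
  condition near the unit circle with constant controlled by the norm of \<open>T - K\<close>. Truncating
  \<open>u\<^sub>k f\<^sup>(\<^sup>k\<^sup>) \<circ> \<tau>\<close> to the set \<open>|\<tau>| \<le> R\<close> is a compact operator by Montel's theorem, and a Carleson embedding
  (here \<open>p \<le> q\<close> and \<open>\<omega> \<in> D\<close> enter) bounds the remainder. The embedding follows from the
  submean value property over small discs, after \<open>\<omega>\<close> has been traded for the smoother weight
  \<open>r \<mapsto> \<omega>^(r) / (1 - r)\<close>, which defines an equivalent norm because \<open>\<omega> \<in> D\<close>.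
\<close>

section \<open>Polar coordinates in the complex plane\<close>

lemma measurable_Complex [measurable]:
  "(\<lambda>(x, y). Complex x y) \<in> borel_measurable (borel \<Otimes>\<^sub>M borel)"
  unfolding Complex_eq by measurable

lemma lborel_complex_eq_distr:
  "lborel = distr (lborel \<Otimes>\<^sub>M lborel) borel (\<lambda>(x, y). Complex x y)"
proof (rule lborel_eqI)
  fix l u :: complex
  assume le: "\<And>b. b \<in> Basis \<Longrightarrow> l \<bullet> b \<le> u \<bullet> b"
  have "(\<lambda>(x, y). Complex x y) -` box l u \<inter> space (lborel \<Otimes>\<^sub>M lborel)
      = {Re l<..<Re u} \<times> {Im l<..<Im u}"
    by (auto simp: box_def Basis_complex_def space_pair_measure)
  then show "emeasure (distr (lborel \<Otimes>\<^sub>M lborel) borel (\<lambda>(x, y). Complex x y)) (box l u)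
      = (\<Prod>b\<in>Basis. (u - l) \<bullet> b)"
    using le[of 1] le[of \<i>]
    by (subst emeasure_distr)
      (auto simp: lborel.emeasure_pair_measure_Times Basis_complex_def ennreal_mult complex_i_not_one)
qed simp

lemma nn_integral_complex_iterated:
  fixes F :: "complex \<Rightarrow> ennreal"
  assumes [measurable]: "F \<in> borel_measurable borel"
  shows "(\<integral>\<^sup>+z. F z \<partial>lborel) = (\<integral>\<^sup>+x. \<integral>\<^sup>+y. F (Complex x y) \<partial>lborel \<partial>lborel)"
    and "(\<integral>\<^sup>+z. F z \<partial>lborel) = (\<integral>\<^sup>+y. \<integral>\<^sup>+x. F (Complex x y) \<partial>lborel \<partial>lborel)"
proof -
  have "(\<integral>\<^sup>+z. F z \<partial>lborel) = (\<integral>\<^sup>+(x, y). F (Complex x y) \<partial>(lborel \<Otimes>\<^sub>M lborel))"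
    by (subst lborel_complex_eq_distr) (simp add: nn_integral_distr case_prod_unfold)
  then show "(\<integral>\<^sup>+z. F z \<partial>lborel) = (\<integral>\<^sup>+x. \<integral>\<^sup>+y. F (Complex x y) \<partial>lborel \<partial>lborel)"
    and "(\<integral>\<^sup>+z. F z \<partial>lborel) = (\<integral>\<^sup>+y. \<integral>\<^sup>+x. F (Complex x y) \<partial>lborel \<partial>lborel)"
    using lborel.nn_integral_fst[of "\<lambda>(x, y). F (Complex x y)" lborel]
      lborel_pair.nn_integral_snd[of "\<lambda>(x, y). F (Complex x y)"]
    by (simp_all add: case_prod_unfold)
qed

lemma nn_integral_complex_shear:
  fixes F :: "complex \<Rightarrow> ennreal" and t :: real
  assumes [measurable]: "F \<in> borel_measurable borel"
  shows "(\<integral>\<^sup>+z. F (z + of_real (t * Im z)) \<partial>lborel) = (\<integral>\<^sup>+z. F z \<partial>lborel)" (is ?Re)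
    and "(\<integral>\<^sup>+z. F (z + \<i> * of_real (t * Re z)) \<partial>lborel) = (\<integral>\<^sup>+z. F z \<partial>lborel)" (is ?Im)
proof -
  have "(\<integral>\<^sup>+x. F (Complex x y) \<partial>lborel) = (\<integral>\<^sup>+x. F (Complex (x + t * y) y) \<partial>lborel)" for y
    by (subst nn_integral_real_affine[where c=1 and t="t*y"]) (auto simp: add.commute)
  moreover have "Complex x y + of_real (t * Im (Complex x y)) = Complex (x + t * y) y" for x y
    by (simp add: complex_eq_iff)
  ultimately show ?Re
    by (simp add: nn_integral_complex_iterated(2))
  have "(\<integral>\<^sup>+y. F (Complex x y) \<partial>lborel) = (\<integral>\<^sup>+y. F (Complex x (y + t * x)) \<partial>lborel)" for x
    by (subst nn_integral_real_affine[where c=1 and t="t*x"]) (auto simp: add.commute)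
  moreover have "Complex x y + \<i> * of_real (t * Re (Complex x y)) = Complex x (y + t * x)" for x y
    by (simp add: complex_eq_iff)
  ultimately show ?Im
    by (simp add: nn_integral_complex_iterated(1))
qed

lemma rotation_eq_shears:
  assumes "norm w = 1" "w \<noteq> -1"
  obtains t where "\<And>z. w * z = (let z1 = z - of_real (t * Im z);
      z2 = z1 + \<i> * of_real (Im w * Re z1) in z2 - of_real (t * Im z2))"
proof -
  have unit: "(Re w)\<^sup>2 + (Im w)\<^sup>2 = 1"
    using assms(1) by (metis cmod_power2 one_power2)
  have nonzero: "1 + Re w \<noteq> 0"
  proof
    assume "1 + Re w = 0"
    then have "Re w = -1" by simp
    with unit assms(2) show False by (simp add: complex_eq_iff)
  qed
  define t where "t = Im w / (1 + Re w)"
  have tIm: "t * Im w = 1 - Re w"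
    using unit nonzero by (simp add: t_def field_simps power2_eq_square)
  have tRe: "t * (1 + Re w) = Im w"
    using nonzero by (simp add: t_def)
  show thesis
  proof (rule that[of t])
    fix z
    define z1 where "z1 = z - of_real (t * Im z)"
    define z2 where "z2 = z1 + \<i> * of_real (Im w * Re z1)"
    have Im: "Im z2 = Im (w * z)"
    proof -
      have "Im z2 = Im z * (1 - t * Im w) + Im w * Re z"
        by (simp add: z1_def z2_def algebra_simps)
      then show ?thesis by (simp add: tIm algebra_simps)
    qed
    have "Re z2 - t * Im z2 = Re z * (1 - t * Im w) - Im z * (t * (1 + Re w))"
      unfolding Im by (simp add: z1_def z2_def algebra_simps)
    also have "\<dots> = Re (w * z)"
      unfolding tIm tRe by (simp add: algebra_simps)
    finally have "w * z = z2 - of_real (t * Im z2)"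
      using Im by (simp add: complex_eq_iff)
    then show "w * z = (let z1 = z - of_real (t * Im z);
        z2 = z1 + \<i> * of_real (Im w * Re z1) in z2 - of_real (t * Im z2))"
      by (simp add: z1_def z2_def Let_def)
  qed
qed

lemma nn_integral_complex_rotate:
  fixes F :: "complex \<Rightarrow> ennreal"
  assumes [measurable]: "F \<in> borel_measurable borel" and w: "norm w = 1"
  shows "(\<integral>\<^sup>+z. F (w * z) \<partial>lborel) = (\<integral>\<^sup>+z. F z \<partial>lborel)"
proof -
  have shears: "(\<integral>\<^sup>+z. G (v * z) \<partial>lborel) = (\<integral>\<^sup>+z. G z \<partial>lborel)"
    if [measurable]: "G \<in> borel_measurable borel" and v: "norm v = 1" "v \<noteq> -1"
    for G :: "complex \<Rightarrow> ennreal" and v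
  proof -
    obtain t where t: "\<And>z. v * z = (let z1 = z - of_real (t * Im z);
        z2 = z1 + \<i> * of_real (Im v * Re z1) in z2 - of_real (t * Im z2))"
      using rotation_eq_shears[OF v] by blast
    define S where "S = (\<lambda>z. z + of_real (- t * Im z))"
    define U where "U = (\<lambda>z. z + \<i> * of_real (Im v * Re z))"
    have [measurable]: "S \<in> borel_measurable borel" "U \<in> borel_measurable borel"
      unfolding S_def U_def by measurable
    have "(\<integral>\<^sup>+z. G (v * z) \<partial>lborel) = (\<integral>\<^sup>+z. G (S (U (S z))) \<partial>lborel)"
      by (simp add: t S_def U_def Let_def)
    also have "\<dots> = (\<integral>\<^sup>+z. G (S (U z)) \<partial>lborel)"
      unfolding S_def by (rule nn_integral_complex_shear(1)) measurable
    also have "\<dots> = (\<integral>\<^sup>+z. G (S z) \<partial>lborel)"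
      unfolding U_def by (rule nn_integral_complex_shear(2)) measurable
    also have "\<dots> = (\<integral>\<^sup>+z. G z \<partial>lborel)"
      unfolding S_def by (rule nn_integral_complex_shear(1)) measurable
    finally show ?thesis .
  qed
  show ?thesis
  proof (cases "w = -1")
    case True
    have "(\<integral>\<^sup>+z. F (w * z) \<partial>lborel) = (\<integral>\<^sup>+z. F (\<i> * (\<i> * z)) \<partial>lborel)"
      using True by (simp flip: mult.assoc)
    also have "\<dots> = (\<integral>\<^sup>+z. F (\<i> * z) \<partial>lborel)"
      by (rule shears) (auto simp: complex_eq_iff)
    also have "\<dots> = (\<integral>\<^sup>+z. F z \<partial>lborel)"
      by (rule shears) (auto simp: complex_eq_iff)
    finally show ?thesis .
  qed (use shears w in auto)
qed

lemma distr_uminus_norm_complex: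
  "distr lborel borel (\<lambda>z::complex. - norm z)
     = density lborel (\<lambda>s. ennreal (2 * pi * (- s)) * indicator {..0} s)" (is "?M = ?N")
proof (rule measure_eqI_lessThan)
  have ball: "(\<lambda>z::complex. - norm z) -` {x<..} \<inter> space lborel = ball 0 (- x)" for x
    by auto
  have M: "emeasure ?M {x<..} = emeasure lborel (ball (0::complex) (- x))" for x
    by (subst emeasure_distr) (simp_all only: ball, auto)
  show "emeasure ?M {x<..} < \<infinity>" for x
    unfolding M by (cases "x \<le> 0") (simp_all add: emeasure_ball ball_empty)
  show "emeasure ?M {x<..} = emeasure ?N {x<..}" for x
  proof (cases "x \<le> 0")
    case True
    have "emeasure ?N {x<..} = (\<integral>\<^sup>+s. ennreal (2 * pi * (- s)) * indicator {x..0} s \<partial>lborel)"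
      using AE_lborel_singleton[of x]
      by (subst emeasure_density, simp_all, intro nn_integral_cong_AE, eventually_elim)
        (auto simp: indicator_def)
    also have "\<dots> = ennreal (- pi * 0\<^sup>2 - (- pi * x\<^sup>2))"
      by (rule nn_integral_FTC_Icc) (use True in \<open>auto intro!: derivative_eq_intros simp: mult_nonneg_nonpos\<close>)
    also have "\<dots> = emeasure ?M {x<..}"
      unfolding M using True by (simp add: emeasure_ball unit_ball_vol_2 power2_eq_square)
    finally show ?thesis ..
  next
    case False
    then have "(\<lambda>s. ennreal (2 * pi * (- s)) * indicator {..0} s * indicator {x<..} s) = (\<lambda>_. 0)"
      by (auto simp: indicator_def fun_eq_iff)
    then show ?thesis
      unfolding M using False by (subst emeasure_density) (auto simp: ball_empty)
  qed
qed auto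

lemma nn_integral_complex_radial:
  fixes g :: "real \<Rightarrow> ennreal"
  assumes [measurable]: "g \<in> borel_measurable borel"
  shows "(\<integral>\<^sup>+z. g (norm (z::complex)) \<partial>lborel) = (\<integral>\<^sup>+r\<in>{0..}. ennreal (2 * pi * r) * g r \<partial>lborel)"
proof -
  have "(\<integral>\<^sup>+z. g (norm (z::complex)) \<partial>lborel)
      = (\<integral>\<^sup>+s. g (- s) \<partial>(distr lborel borel (\<lambda>z::complex. - norm z)))"
    by (simp add: nn_integral_distr)
  also have "\<dots> = (\<integral>\<^sup>+s. ennreal (2 * pi * (- s)) * indicator {..0} s * g (- s) \<partial>lborel)"
    unfolding distr_uminus_norm_complex by (rule nn_integral_density) auto
  also have "\<dots> = (\<integral>\<^sup>+r. ennreal (2 * pi * r) * indicator {..0} (- r) * g r \<partial>lborel)"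
    by (subst nn_integral_real_affine[where c="-1" and t=0]) auto
  also have "\<dots> = (\<integral>\<^sup>+r\<in>{0..}. ennreal (2 * pi * r) * g r \<partial>lborel)"
    by (intro nn_integral_cong) (auto simp: indicator_def)
  finally show ?thesis .
qed

definition circle_measure :: "complex measure" where
  "circle_measure = distr (restrict_space lborel {0..<2*pi}) (restrict_space borel (sphere 0 1)) cis"

lemma sets_circle_measure [simp, measurable_cong]:
  "sets circle_measure = sets (restrict_space borel (sphere 0 1))"
  by (simp add: circle_measure_def)

lemma space_circle_measure [simp]: "space circle_measure = sphere 0 1"
  by (simp add: circle_measure_def)

lemma cis_measurable: "cis \<in> measurable borel (restrict_space borel (sphere 0 1))"
  by (intro measurable_restrict_space2 borel_measurable_continuous_onI continuous_intros) auto

lemma nn_integral_circle_measure: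
  assumes "F \<in> borel_measurable (restrict_space borel (sphere 0 1))"
  shows "(\<integral>\<^sup>+\<zeta>. F \<zeta> \<partial>circle_measure) = (\<integral>\<^sup>+\<theta>\<in>{0..<2*pi}. F (cis \<theta>) \<partial>lborel)"
proof -
  have "cis \<in> measurable (restrict_space lborel {0..<2*pi}) (restrict_space borel (sphere 0 1))"
    using cis_measurable by (intro measurable_restrict_space1) simp
  then show ?thesis
    using assms by (simp add: circle_measure_def nn_integral_distr nn_integral_restrict_space)
qed

lemma emeasure_circle_measure:
  "A \<in> sets circle_measure \<Longrightarrow> emeasure circle_measure A = (\<integral>\<^sup>+\<theta>\<in>{0..<2*pi}. indicator A (cis \<theta>) \<partial>lborel)"
  using nn_integral_circle_measure[of "indicator A"] by simp

lemma emeasure_circle_measure_space: "emeasure circle_measure (sphere 0 1) = ennreal (2 * pi)"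
proof -
  have "emeasure circle_measure (sphere 0 1) = (\<integral>\<^sup>+\<theta>\<in>{0..<2*pi}. 1 \<partial>lborel)"
    using sets.top[of circle_measure]
    by (subst emeasure_circle_measure) (auto simp del: nn_integral_indicator)
  then show ?thesis by simp
qed

interpretation circle_measure: finite_measure circle_measure
  by (rule finite_measureI) (simp add: emeasure_circle_measure_space)

lemma nn_integral_circle_rotate:
  assumes F: "F \<in> borel_measurable (restrict_space borel (sphere 0 1))" and w: "norm w = 1"
  shows "(\<integral>\<^sup>+\<zeta>. F (w * \<zeta>) \<partial>circle_measure) = (\<integral>\<^sup>+\<zeta>. F \<zeta> \<partial>circle_measure)"
proof -
  define G where "G = (\<lambda>\<theta>. F (cis \<theta>))"
  have [measurable]: "G \<in> borel_measurable borel"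
    unfolding G_def by (rule measurable_compose[OF cis_measurable F])
  have periodic: "G (2 * pi + \<theta>) = G \<theta>" for \<theta>
    by (simp add: G_def flip: cis_mult)
  define a where "a = Arg2pi w"
  have a: "0 \<le> a" "a < 2 * pi" and wa: "w = cis a"
    using Arg2pi_ge_0[of w] Arg2pi_lt_2pi[of w] Arg2pi_eq[of w] w
    by (auto simp: a_def cis_conv_exp)
  have "(\<lambda>\<zeta>. w * \<zeta>) \<in> measurable (restrict_space borel (sphere 0 1)) (restrict_space borel (sphere 0 1))"
    using w by (intro measurable_restrict_space3) (auto simp: norm_mult)
  then have "(\<integral>\<^sup>+\<zeta>. F (w * \<zeta>) \<partial>circle_measure)
      = (\<integral>\<^sup>+\<theta>. G (a + 1 * \<theta>) * indicator {a..<2*pi + a} (a + 1 * \<theta>) \<partial>lborel)"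
    using F by (subst nn_integral_circle_measure)
      (auto simp: G_def wa cis_mult indicator_def intro!: nn_integral_cong measurable_compose[of _ _ _ F])
  also have "\<dots> = (\<integral>\<^sup>+\<theta>\<in>{a..<2*pi + a}. G \<theta> \<partial>lborel)"
    using nn_integral_real_affine[of "\<lambda>\<theta>. G \<theta> * indicator {a..<2*pi+a} \<theta>" 1 a] by simp
  also have "\<dots> = (\<integral>\<^sup>+\<theta>\<in>{a..<2*pi}. G \<theta> \<partial>lborel) + (\<integral>\<^sup>+\<theta>\<in>{2*pi..<2*pi+a}. G \<theta> \<partial>lborel)"
    using a by (subst nn_integral_add[symmetric]) (auto intro!: nn_integral_cong simp: indicator_def)
  also have "(\<integral>\<^sup>+\<theta>\<in>{2*pi..<2*pi+a}. G \<theta> \<partial>lborel) = (\<integral>\<^sup>+\<theta>\<in>{0..<a}. G \<theta> \<partial>lborel)"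
    by (subst nn_integral_real_affine[where c=1 and t="2*pi"])
      (auto intro!: nn_integral_cong simp: periodic indicator_def)
  also have "(\<integral>\<^sup>+\<theta>\<in>{a..<2*pi}. G \<theta> \<partial>lborel) + (\<integral>\<^sup>+\<theta>\<in>{0..<a}. G \<theta> \<partial>lborel) = (\<integral>\<^sup>+\<theta>\<in>{0..<2*pi}. G \<theta> \<partial>lborel)"
    using a by (subst nn_integral_add[symmetric]) (auto intro!: nn_integral_cong simp: indicator_def)
  also have "\<dots> = (\<integral>\<^sup>+\<zeta>. F \<zeta> \<partial>circle_measure)"
    unfolding G_def by (rule nn_integral_circle_measure[OF F, symmetric])
  finally show ?thesis .
qed

lemma complex_polar_unit:
  fixes z :: complex
  obtains w where "norm w = 1" "z = of_real (norm z) * w"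
proof
  show "norm (if z = 0 then 1 else sgn z) = 1"
    by (simp add: norm_sgn)
  show "z = of_real (norm z) * (if z = 0 then 1 else sgn z)"
    by (simp add: sgn_div_norm scaleR_conv_of_real)
qed

lemma measurable_mult_circle [measurable (raw)]:
  assumes [measurable]: "f \<in> borel_measurable M" "g \<in> measurable M circle_measure"
  shows "(\<lambda>x. f x * g x) \<in> borel_measurable M"
proof -
  have "(\<lambda>\<zeta>. \<zeta>) \<in> borel_measurable circle_measure"
    by (simp add: measurable_cong_sets[OF sets_circle_measure refl] measurable_restrict_space1)
  then have [measurable]: "g \<in> borel_measurable M"
    by (rule measurable_compose[OF assms(2)])
  show ?thesis by measurable
qed

lemma nn_integral_complex_polar:
  fixes F :: "complex \<Rightarrow> ennreal"
  assumes [measurable]: "F \<in> borel_measurable borel"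
  shows "(\<integral>\<^sup>+z. F z \<partial>lborel)
    = (\<integral>\<^sup>+r\<in>{0..}. ennreal r * (\<integral>\<^sup>+\<zeta>. F (of_real r * \<zeta>) \<partial>circle_measure) \<partial>lborel)"
proof -
  interpret pair_sigma_finite circle_measure "lborel :: complex measure" ..
  define J where "J = (\<lambda>z. \<integral>\<^sup>+\<zeta>. F (z * \<zeta>) \<partial>circle_measure)"
  have [measurable]: "J \<in> borel_measurable borel"
    unfolding J_def by measurable
  have J_norm: "J z = J (of_real (norm z))" for z
  proof -
    obtain w where w: "norm w = 1" "z = of_real (norm z) * w"
      by (rule complex_polar_unit)
    have "J (of_real (norm z) * w) = J (of_real (norm z))"
      unfolding J_def mult.assoc by (rule nn_integral_circle_rotate[OF _ w(1)]) measurable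
    then show ?thesis using w(2) by simp
  qed
  have rotate: "(\<integral>\<^sup>+z. F (z * \<zeta>) \<partial>lborel) = (\<integral>\<^sup>+z. F z \<partial>lborel)" if "\<zeta> \<in> space circle_measure" for \<zeta>
    using nn_integral_complex_rotate[of F \<zeta>] that by (simp add: mult.commute)
  have "ennreal (2 * pi) * (\<integral>\<^sup>+z. F z \<partial>lborel) = (\<integral>\<^sup>+\<zeta>. (\<integral>\<^sup>+z. F (z * \<zeta>) \<partial>lborel) \<partial>circle_measure)"
    by (subst nn_integral_cong[OF rotate]) (simp_all add: emeasure_circle_measure_space mult.commute)
  also have "\<dots> = (\<integral>\<^sup>+z. J z \<partial>lborel)"
    unfolding J_def by (rule Fubini'[symmetric]) measurable
  also have "\<dots> = (\<integral>\<^sup>+z. J (of_real (norm (z :: complex))) \<partial>lborel)"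
    by (simp flip: J_norm)
  also have "\<dots> = (\<integral>\<^sup>+r\<in>{0..}. ennreal (2 * pi * r) * J (of_real r) \<partial>lborel)"
    by (rule nn_integral_complex_radial) measurable
  also have "\<dots> = (\<integral>\<^sup>+r. ennreal (2 * pi) * (ennreal r * J (of_real r) * indicator {0..} r) \<partial>lborel)"
    by (intro nn_integral_cong) (auto simp: ennreal_mult indicator_def ac_simps)
  also have "\<dots> = ennreal (2 * pi) * (\<integral>\<^sup>+r\<in>{0..}. ennreal r * J (of_real r) \<partial>lborel)"
    by (rule nn_integral_cmult) measurable
  finally show ?thesis
    using pi_gt_zero by (auto simp: J_def ennreal_mult_cancel_left ennreal_eq_0_iff)
qed

lemma nn_integral_ball_polar:
  fixes F :: "complex \<Rightarrow> ennreal"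
  assumes F: "F \<in> borel_measurable (restrict_space borel (ball 0 R))"
  shows "(\<integral>\<^sup>+z\<in>ball 0 R. F z \<partial>lborel)
    = (\<integral>\<^sup>+r\<in>{0..<R}. ennreal r * (\<integral>\<^sup>+\<zeta>. F (of_real r * \<zeta>) \<partial>circle_measure) \<partial>lborel)"
proof -
  have "(\<integral>\<^sup>+z\<in>ball 0 R. F z \<partial>lborel) = (\<integral>\<^sup>+r\<in>{0..}. ennreal r
      * (\<integral>\<^sup>+\<zeta>. F (of_real r * \<zeta>) * indicator (ball 0 R) (of_real r * \<zeta>) \<partial>circle_measure) \<partial>lborel)"
    using F by (intro nn_integral_complex_polar) (simp add: borel_measurable_restrict_space_iff_ennreal)
  also have "\<dots> = (\<integral>\<^sup>+r\<in>{0..<R}. ennreal r * (\<integral>\<^sup>+\<zeta>. F (of_real r * \<zeta>) \<partial>circle_measure) \<partial>lborel)"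
  proof (rule nn_integral_cong)
    fix r :: real
    have "(\<integral>\<^sup>+\<zeta>. F (of_real r * \<zeta>) * indicator (ball 0 R) (of_real r * \<zeta>) \<partial>circle_measure)
        = (\<integral>\<^sup>+\<zeta>. F (of_real r * \<zeta>) * indicator {..<R} r \<partial>circle_measure)" if "0 \<le> r"
      using that by (intro nn_integral_cong) (auto simp: indicator_def norm_mult)
    then show "ennreal r * (\<integral>\<^sup>+\<zeta>. F (of_real r * \<zeta>) * indicator (ball 0 R) (of_real r * \<zeta>) \<partial>circle_measure)
        * indicator {0..} r
      = ennreal r * (\<integral>\<^sup>+\<zeta>. F (of_real r * \<zeta>) \<partial>circle_measure) * indicator {0..<R} r"
      by (auto simp: indicator_def)
  qed
  finally show ?thesis .
qed

section \<open>Seminorms of p-integrable functions\<close>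

lemma convex_on_powr:
  assumes "1 \<le> p"
  shows "convex_on {0..} (\<lambda>x::real. x powr p)"
proof (rule convex_onI)
  fix t x y :: real
  assume t: "0 < t" "t < 1" and xy: "x \<in> {0..}" "y \<in> {0..}"
  have scale: "(s * x) powr p \<le> s * x powr p" if "0 < s" "s \<le> 1" for s x :: real
    using powr_mono'[of 1 p s] that assms by (simp add: powr_mult mult_right_mono)
  consider "x = 0" | "y = 0" | "0 < x" "0 < y" using xy by fastforce
  then show "((1 - t) *\<^sub>R x + t *\<^sub>R y) powr p \<le> (1 - t) * x powr p + t * y powr p"
  proof cases
    case 3
    then show ?thesis
      using convex_onD[OF powr_convex[OF assms], of t x y] t by simp
  qed (use scale[of t y] scale[of "1 - t" x] t in auto)
qed simp

definition Lp_seminorm :: "'a measure \<Rightarrow> real \<Rightarrow> ('a \<Rightarrow> 'b::real_normed_vector) \<Rightarrow> ennreal" where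
  "Lp_seminorm M p f = root_enn (\<integral>\<^sup>+x. ennreal (norm (f x) powr p) \<partial>M) p"

lemma root_enn_le_iff:
  assumes "0 < p" "0 \<le> c"
  shows "root_enn I p \<le> ennreal c \<longleftrightarrow> I \<le> ennreal (c powr p)"
proof (cases I)
  case (real x)
  have "x powr (1 / p) \<le> c \<longleftrightarrow> x \<le> c powr p"
    using powr_mono2[of p "x powr (1 / p)" c] powr_mono2[of "1 / p" x "c powr p"] assms real
    by (auto simp: powr_powr)
  then show ?thesis using real assms by (simp add: root_enn_def)
qed (simp add: root_enn_def top_unique)

lemma root_enn_less_top_iff: "root_enn I p < \<infinity> \<longleftrightarrow> I < \<infinity>"
  by (simp add: root_enn_def less_top)

lemma Lp_seminorm_le_iff:
  assumes "0 < p" "0 \<le> c"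
  shows "Lp_seminorm M p f \<le> ennreal c \<longleftrightarrow> (\<integral>\<^sup>+x. ennreal (norm (f x) powr p) \<partial>M) \<le> ennreal (c powr p)"
  unfolding Lp_seminorm_def by (rule root_enn_le_iff[OF assms])

lemma Lp_seminorm_mono:
  assumes "0 < p" and "\<And>x. x \<in> space M \<Longrightarrow> norm (f x) \<le> norm (g x)"
  shows "Lp_seminorm M p f \<le> Lp_seminorm M p g"
proof (cases "Lp_seminorm M p g")
  case (real c)
  have "(\<integral>\<^sup>+x. ennreal (norm (f x) powr p) \<partial>M) \<le> (\<integral>\<^sup>+x. ennreal (norm (g x) powr p) \<partial>M)"
    by (intro nn_integral_mono ennreal_leI powr_mono2) (use assms in auto)
  also have "\<dots> \<le> ennreal (c powr p)"
    using real Lp_seminorm_le_iff[OF assms(1), of c M g] by simp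
  finally show ?thesis
    using real assms(1) by (simp add: Lp_seminorm_le_iff)
qed simp

lemma Lp_seminorm_cmult:
  fixes f :: "'a \<Rightarrow> 'b::real_normed_div_algebra"
  assumes "0 < p" and [measurable]: "f \<in> borel_measurable M"
  shows "Lp_seminorm M p (\<lambda>x. c * f x) = ennreal (norm c) * Lp_seminorm M p f"
proof (cases "c = 0")
  case True
  then show ?thesis by (simp add: Lp_seminorm_def root_enn_def)
next
  case False
  have int: "(\<integral>\<^sup>+x. ennreal (norm (c * f x) powr p) \<partial>M)
      = ennreal (norm c powr p) * (\<integral>\<^sup>+x. ennreal (norm (f x) powr p) \<partial>M)"
    by (simp add: norm_mult powr_mult ennreal_mult nn_integral_cmult)
  show ?thesis
  proof (cases "\<integral>\<^sup>+x. ennreal (norm (f x) powr p) \<partial>M")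
    case (real y)
    then show ?thesis
      using assms(1)
      by (simp add: Lp_seminorm_def int root_enn_def powr_mult powr_powr flip: ennreal_mult)
  next
    case top
    then show ?thesis
      using False by (simp add: Lp_seminorm_def int root_enn_def ennreal_mult_top)
  qed
qed

lemma norm_add_powr_le:
  fixes x y :: "'a::real_normed_vector"
  assumes p: "1 \<le> p" and a: "0 < a" and b: "0 < b"
  shows "norm (x + y) powr p
    \<le> (a + b) powr p * (a / (a + b) * (norm x / a) powr p + b / (a + b) * (norm y / b) powr p)"
proof -
  define t where "t = b / (a + b)"
  have t: "0 \<le> t" "t \<le> 1" "1 - t = a / (a + b)"
    using a b by (auto simp: t_def field_simps)
  have "norm (x + y) powr p \<le> (norm x + norm y) powr p"
    using p by (intro powr_mono2 norm_triangle_ineq) auto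
  also have "norm x + norm y = (a + b) * ((1 - t) * (norm x / a) + t * (norm y / b))"
  proof -
    have "(a + b) * (1 - t) = a" "(a + b) * t = b"
      unfolding t(3) using a b by (simp_all add: t_def)
    then show ?thesis
      using a b by (simp add: distrib_left flip: mult.assoc)
  qed
  also have "\<dots> powr p = (a + b) powr p * ((1 - t) * (norm x / a) + t * (norm y / b)) powr p"
    by (simp add: powr_mult)
  also have "\<dots> \<le> (a + b) powr p * ((1 - t) * (norm x / a) powr p + t * (norm y / b) powr p)"
    using convex_onD[OF convex_on_powr[OF p], of t "norm x / a" "norm y / b"] t a b
    by (intro mult_left_mono) auto
  finally show ?thesis by (simp only: t(3)) (simp only: t_def)
qed

lemma Lp_seminorm_add_le_of_bounds:
  fixes f g :: "'a \<Rightarrow> 'b::{real_normed_vector, second_countable_topology}"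
  assumes p: "1 \<le> p" and [measurable]: "f \<in> borel_measurable M" "g \<in> borel_measurable M"
    and a: "Lp_seminorm M p f \<le> ennreal a" "0 < a"
    and b: "Lp_seminorm M p g \<le> ennreal b" "0 < b"
  shows "Lp_seminorm M p (\<lambda>x. f x + g x) \<le> ennreal (a + b)"
proof -
  define s where "s = (a + b) powr p"
  define \<alpha> where "\<alpha> = s * (a / (a + b)) / a powr p"
  define \<beta> where "\<beta> = s * (b / (a + b)) / b powr p"
  have pos: "0 < a + b" "0 \<le> s" "0 \<le> \<alpha>" "0 \<le> \<beta>"
    using a b by (auto simp: \<alpha>_def \<beta>_def s_def)
  have "norm (f x + g x) powr p \<le> \<alpha> * norm (f x) powr p + \<beta> * norm (g x) powr p" for x
    using norm_add_powr_le[OF p a(2) b(2), of "f x" "g x"]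
    by (simp add: \<alpha>_def \<beta>_def s_def powr_divide algebra_simps)
  then have "(\<integral>\<^sup>+x. ennreal (norm (f x + g x) powr p) \<partial>M)
      \<le> (\<integral>\<^sup>+x. ennreal \<alpha> * ennreal (norm (f x) powr p) + ennreal \<beta> * ennreal (norm (g x) powr p) \<partial>M)"
    using pos by (intro nn_integral_mono) (simp flip: ennreal_mult ennreal_plus)
  also have "\<dots> = ennreal \<alpha> * (\<integral>\<^sup>+x. ennreal (norm (f x) powr p) \<partial>M)
      + ennreal \<beta> * (\<integral>\<^sup>+x. ennreal (norm (g x) powr p) \<partial>M)"
    by (simp add: nn_integral_add nn_integral_cmult)
  also have "\<dots> \<le> ennreal \<alpha> * ennreal (a powr p) + ennreal \<beta> * ennreal (b powr p)"
    using a b p by (intro add_mono mult_left_mono) (auto simp: Lp_seminorm_le_iff)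
  also have "\<dots> = ennreal (s * (a / (a + b) + b / (a + b)))"
    using a b pos by (simp add: \<alpha>_def \<beta>_def distrib_left flip: ennreal_mult ennreal_plus)
  also have "a / (a + b) + b / (a + b) = 1"
    using pos(1) by (simp flip: add_divide_distrib)
  finally show ?thesis
    using p a b by (simp add: Lp_seminorm_le_iff s_def del: ennreal_plus)
qed

lemma Lp_seminorm_add_le:
  fixes f g :: "'a \<Rightarrow> 'b::{real_normed_vector, second_countable_topology}"
  assumes "1 \<le> p" "f \<in> borel_measurable M" "g \<in> borel_measurable M"
  shows "Lp_seminorm M p (\<lambda>x. f x + g x) \<le> Lp_seminorm M p f + Lp_seminorm M p g"
proof (rule ennreal_le_epsilon)
  fix e :: real
  assume "Lp_seminorm M p f + Lp_seminorm M p g < top" and e: "0 < e"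
  then obtain a b where ab: "Lp_seminorm M p f = ennreal a" "0 \<le> a" "Lp_seminorm M p g = ennreal b" "0 \<le> b"
    by (cases "Lp_seminorm M p f"; cases "Lp_seminorm M p g") auto
  have "Lp_seminorm M p (\<lambda>x. f x + g x) \<le> ennreal ((a + e / 2) + (b + e / 2))"
    using ab e by (intro Lp_seminorm_add_le_of_bounds assms) (auto intro!: ennreal_leI)
  also have "\<dots> = ennreal a + ennreal b + ennreal e"
    using ab e by (simp flip: ennreal_plus)
  finally show "Lp_seminorm M p (\<lambda>x. f x + g x) \<le> Lp_seminorm M p f + Lp_seminorm M p g + ennreal e"
    by (simp add: ab)
qed

lemma Lp_seminorm_triangle:
  fixes f g :: "'a \<Rightarrow> 'b::{real_normed_vector, second_countable_topology}"
  assumes "1 \<le> p" "f \<in> borel_measurable M" "g \<in> borel_measurable M"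
  shows "Lp_seminorm M p f \<le> Lp_seminorm M p (\<lambda>x. f x - g x) + Lp_seminorm M p g"
  using Lp_seminorm_add_le[of p "\<lambda>x. f x - g x" M g] assms by simp

lemma Lp_seminorm_sum_le:
  fixes f :: "'i \<Rightarrow> 'a \<Rightarrow> 'b::{real_normed_vector, second_countable_topology}"
  assumes p: "1 \<le> p" and "finite I" and f: "\<And>i. i \<in> I \<Longrightarrow> f i \<in> borel_measurable M"
  shows "Lp_seminorm M p (\<lambda>x. \<Sum>i\<in>I. f i x) \<le> (\<Sum>i\<in>I. Lp_seminorm M p (f i))"
  using assms(2) f
proof (induction I rule: finite_induct)
  case empty
  then show ?case by (simp add: Lp_seminorm_def root_enn_def)
next
  case (insert i I)
  have "Lp_seminorm M p (\<lambda>x. \<Sum>i\<in>insert i I. f i x)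
      \<le> Lp_seminorm M p (f i) + Lp_seminorm M p (\<lambda>x. \<Sum>i\<in>I. f i x)"
    using insert Lp_seminorm_add_le[OF p, of "f i" M "\<lambda>x. \<Sum>i\<in>I. f i x"] by simp
  also have "\<dots> \<le> (\<Sum>i\<in>insert i I. Lp_seminorm M p (f i))"
    using insert by (simp add: add_left_mono)
  finally show ?case .
qed

lemma add_powr_le:
  fixes x y l p :: real
  assumes "0 < l" "0 \<le> p" "0 \<le> x" "0 \<le> y"
  shows "(x + y) powr p \<le> (1 + l) powr p * x powr p + (1 + 1/l) powr p * y powr p"
proof (cases "y \<le> l * x")
  case True
  then have "(x + y) powr p \<le> ((1 + l) * x) powr p"
    using assms by (intro powr_mono2) (auto simp: algebra_simps)
  also have "\<dots> = (1 + l) powr p * x powr p" by (rule powr_mult)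
  finally show ?thesis by (simp add: add_increasing2)
next
  case False
  then have "x \<le> y / l" using assms by (simp add: field_simps)
  then have "(x + y) powr p \<le> ((1 + 1/l) * y) powr p"
    using assms by (intro powr_mono2) (auto simp: algebra_simps)
  also have "\<dots> = (1 + 1/l) powr p * y powr p" by (rule powr_mult)
  finally show ?thesis by (simp add: add_increasing)
qed

text \<open>The Brezis--Lieb argument: \<open>|f + g n|\<^sup>p - L |g n|\<^sup>p\<close> is dominated by a multiple of \<open>|f|\<^sup>p\<close>,
  so its integral converges although \<open>g n\<close> need not converge in norm.\<close>

lemma nn_integral_powr_add_null_tendsto:
  fixes f :: "'a \<Rightarrow> 'b::{real_normed_vector, second_countable_topology}"
  assumes p: "0 < p" and L: "1 < L"
    and [measurable]: "f \<in> borel_measurable M" "\<And>n. g n \<in> borel_measurable M"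
    and f: "(\<integral>\<^sup>+x. ennreal (norm (f x) powr p) \<partial>M) < \<infinity>"
    and null: "\<And>x. x \<in> space M \<Longrightarrow> (\<lambda>n. g n x) \<longlonglongrightarrow> 0"
  shows "(\<lambda>n. \<integral>\<^sup>+x. ennreal (norm (f x + g n x) powr p - L * norm (g n x) powr p) \<partial>M)
    \<longlonglongrightarrow> (\<integral>\<^sup>+x. ennreal (norm (f x) powr p) \<partial>M)"
proof -
  define l where "l = L powr (1 / p) - 1"
  have l: "0 < l" "(1 + l) powr p = L"
    using L p by (auto simp: l_def powr_powr)
  define c where "c = (1 + 1 / l) powr p"
  have dominated: "ennreal (norm (f x + g n x) powr p - L * norm (g n x) powr p)
      \<le> ennreal (c * norm (f x) powr p)" for n x
  proof -
    have "norm (f x + g n x) powr p \<le> (norm (g n x) + norm (f x)) powr p"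
      using p norm_triangle_ineq[of "g n x" "f x"] by (intro powr_mono2) (auto simp: add.commute)
    also have "\<dots> \<le> L * norm (g n x) powr p + c * norm (f x) powr p"
      using add_powr_le[OF l(1), of p "norm (g n x)" "norm (f x)"] l p by (simp add: c_def)
    finally show ?thesis by (simp add: ennreal_leI)
  qed
  show ?thesis
  proof (rule nn_integral_dominated_convergence[where w="\<lambda>x. ennreal (c * norm (f x) powr p)"])
    show "(\<integral>\<^sup>+x. ennreal (c * norm (f x) powr p) \<partial>M) < \<infinity>"
      using f by (simp add: c_def ennreal_mult nn_integral_cmult ennreal_mult_less_top)
    show "AE x in M. (\<lambda>n. ennreal (norm (f x + g n x) powr p - L * norm (g n x) powr p))
        \<longlonglongrightarrow> ennreal (norm (f x) powr p)"
    proof (rule AE_I2)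
      fix x assume "x \<in> space M"
      then have "(\<lambda>n. norm (f x + g n x) powr p - L * norm (g n x) powr p)
          \<longlonglongrightarrow> norm (f x + 0) powr p - L * norm (0::'b) powr p"
        using p by (intro tendsto_intros null tendsto_powr') auto
      then show "(\<lambda>n. ennreal (norm (f x + g n x) powr p - L * norm (g n x) powr p))
          \<longlonglongrightarrow> ennreal (norm (f x) powr p)"
        by (intro tendsto_ennrealI) simp
    qed
  qed (use dominated in auto)
qed

lemma nn_integral_powr_add_null_le:
  fixes f :: "'a \<Rightarrow> 'b::{real_normed_vector, second_countable_topology}"
  assumes p: "0 < p" and L: "1 < L"
    and [measurable]: "f \<in> borel_measurable M" "\<And>n. g n \<in> borel_measurable M"
    and f: "(\<integral>\<^sup>+x. ennreal (norm (f x) powr p) \<partial>M) < \<infinity>"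
    and g: "\<And>n. (\<integral>\<^sup>+x. ennreal (norm (g n x) powr p) \<partial>M) \<le> 1"
    and null: "\<And>x. x \<in> space M \<Longrightarrow> (\<lambda>n. g n x) \<longlonglongrightarrow> 0"
  shows "\<forall>\<^sub>F n in sequentially. (\<integral>\<^sup>+x. ennreal (norm (f x + g n x) powr p) \<partial>M)
    \<le> (\<integral>\<^sup>+x. ennreal (norm (f x) powr p) \<partial>M) + ennreal (2 * L)"
proof -
  define D where "D = (\<lambda>n x. ennreal (norm (f x + g n x) powr p - L * norm (g n x) powr p))"
  have [measurable]: "D n \<in> borel_measurable M" for n
    unfolding D_def by measurable
  have split: "ennreal (norm (f x + g n x) powr p) \<le> D n x + ennreal (L * norm (g n x) powr p)" for n x
    unfolding D_def using L
    by (cases "L * norm (g n x) powr p \<le> norm (f x + g n x) powr p")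
      (auto intro: ennreal_leI simp: ennreal_neg simp flip: ennreal_plus)
  have "(\<lambda>n. \<integral>\<^sup>+x. D n x \<partial>M) \<longlonglongrightarrow> (\<integral>\<^sup>+x. ennreal (norm (f x) powr p) \<partial>M)"
    unfolding D_def by (rule nn_integral_powr_add_null_tendsto[OF p L _ _ f null]) auto
  moreover have "(\<integral>\<^sup>+x. ennreal (norm (f x) powr p) \<partial>M)
      < (\<integral>\<^sup>+x. ennreal (norm (f x) powr p) \<partial>M) + ennreal L"
    using f L by (cases "\<integral>\<^sup>+x. ennreal (norm (f x) powr p) \<partial>M")
      (auto simp: ennreal_less_iff simp flip: ennreal_plus)
  ultimately have "\<forall>\<^sub>F n in sequentially.
      (\<integral>\<^sup>+x. D n x \<partial>M) < (\<integral>\<^sup>+x. ennreal (norm (f x) powr p) \<partial>M) + ennreal L"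
    by (rule order_tendstoD(2))
  then show ?thesis
  proof eventually_elim
    case (elim n)
    have "(\<integral>\<^sup>+x. ennreal (norm (f x + g n x) powr p) \<partial>M)
        \<le> (\<integral>\<^sup>+x. D n x + ennreal L * ennreal (norm (g n x) powr p) \<partial>M)"
      using L split by (intro nn_integral_mono) (simp add: ennreal_mult)
    also have "\<dots> = (\<integral>\<^sup>+x. D n x \<partial>M) + ennreal L * (\<integral>\<^sup>+x. ennreal (norm (g n x) powr p) \<partial>M)"
      by (simp add: nn_integral_add nn_integral_cmult)
    also have "\<dots> \<le> ((\<integral>\<^sup>+x. ennreal (norm (f x) powr p) \<partial>M) + ennreal L) + ennreal L * 1"
      using elim g by (intro add_mono mult_left_mono) auto
    also have "\<dots> = (\<integral>\<^sup>+x. ennreal (norm (f x) powr p) \<partial>M) + ennreal (2 * L)"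
      using L by (simp add: add.assoc flip: ennreal_plus)
    finally show ?case .
  qed
qed

section \<open>Circular means of holomorphic functions\<close>

definition circle_mean :: "real \<Rightarrow> (complex \<Rightarrow> complex) \<Rightarrow> complex \<Rightarrow> ennreal" where
  "circle_mean p f z = (\<integral>\<^sup>+\<zeta>. ennreal (norm (f (z * \<zeta>)) powr p) \<partial>circle_measure)"

lemma continuous_on_circle_compose:
  assumes "continuous_on (sphere 0 (norm z)) f"
  shows "continuous_on (sphere 0 1) (\<lambda>\<zeta>. f (z * \<zeta>))" "continuous_on A (\<lambda>\<theta>. f (z * cis \<theta>))"
  by (rule continuous_on_compose2[OF assms]; auto intro!: continuous_intros simp: norm_mult)+

lemma borel_measurable_norm_powr:
  assumes "f \<in> borel_measurable M"
  shows "(\<lambda>x. ennreal (norm (f x) powr p)) \<in> borel_measurable M"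
  using assms by measurable

lemma circle_mean_norm:
  assumes f: "continuous_on (sphere 0 (norm z)) f"
  shows "circle_mean p f (of_real (norm z)) = circle_mean p f z"
proof -
  obtain w where w: "norm w = 1" "z = of_real (norm z) * w"
    by (rule complex_polar_unit)
  have "(\<lambda>\<zeta>. ennreal (norm (f (of_real (norm z) * \<zeta>)) powr p))
      \<in> borel_measurable (restrict_space borel (sphere 0 1))"
    using f
    by (intro borel_measurable_norm_powr borel_measurable_continuous_on_restrict
      continuous_on_circle_compose) simp
  from nn_integral_circle_rotate[OF this w(1)] show ?thesis
    by (simp add: circle_mean_def flip: mult.assoc w(2))
qed

definition circle_integral :: "real \<Rightarrow> (complex \<Rightarrow> complex) \<Rightarrow> complex \<Rightarrow> real" where
  "circle_integral p f z = integral {0..2*pi} (\<lambda>\<theta>. norm (f (z * cis \<theta>)) powr p)"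

lemma circle_powr_integrable:
  assumes "continuous_on (sphere 0 (norm z)) f" "0 < p"
  shows "(\<lambda>\<theta>. norm (f (z * cis \<theta>)) powr p) integrable_on {0..2*pi}"
  using assms(2)
  by (intro integrable_continuous_interval continuous_on_powr' continuous_on_circle_compose[OF assms(1)]
      continuous_intros) auto

lemma circle_integral_nonneg:
  "continuous_on (sphere 0 (norm z)) f \<Longrightarrow> 0 < p \<Longrightarrow> 0 \<le> circle_integral p f z"
  unfolding circle_integral_def by (intro integral_nonneg circle_powr_integrable) auto

lemma circle_mean_eq_integral:
  assumes f: "continuous_on (sphere 0 (norm z)) f" and p: "0 < p"
  shows "circle_mean p f z = ennreal (circle_integral p f z)"
proof -
  have "circle_mean p f z = (\<integral>\<^sup>+\<theta>\<in>{0..<2*pi}. ennreal (norm (f (z * cis \<theta>)) powr p) \<partial>lborel)"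
    unfolding circle_mean_def
    by (intro nn_integral_circle_measure borel_measurable_norm_powr borel_measurable_continuous_on_restrict
        continuous_on_circle_compose f)
  also have "\<dots> = (\<integral>\<^sup>+\<theta>\<in>{0..2*pi}. ennreal (norm (f (z * cis \<theta>)) powr p) \<partial>lborel)"
    by (rule nn_integral_cong_AE, use AE_lborel_singleton[of "2*pi"] in eventually_elim)
      (auto simp: indicator_def)
  also have "\<dots> = ennreal (circle_integral p f z)"
    unfolding circle_integral_def
    by (intro nn_integral_has_integral_lebesgue'[OF _ integrable_integral] circle_powr_integrable f p) auto
  finally show ?thesis .
qed

definition powr_dual :: "real \<Rightarrow> complex \<Rightarrow> complex" where
  "powr_dual p w = cnj w * of_real (norm w powr (p - 2))"

lemma norm_powr_dual: "norm (powr_dual p w) = norm w powr (p - 1)"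
  by (cases "w = 0") (auto simp: powr_dual_def norm_mult powr_mult_base)

lemma mult_powr_dual: "w * powr_dual p w = of_real (norm w powr p)"
proof (cases "w = 0")
  case False
  have "w * powr_dual p w = of_real ((norm w)\<^sup>2 * norm w powr (p - 2))"
    by (simp only: powr_dual_def of_real_mult complex_norm_square mult.assoc)
  also have "(norm w)\<^sup>2 * norm w powr (p - 2) = norm w powr p"
    using False powr_add[of "norm w" 2 "p - 2"] by simp
  finally show ?thesis .
qed simp

lemma continuous_on_powr_dual:
  assumes "1 < p"
  shows "continuous_on UNIV (powr_dual p)"
  unfolding continuous_on_eq_continuous_at[OF open_UNIV]
proof
  fix w
  show "isCont (powr_dual p) w"
  proof (cases "w = 0")
    case True
    have "((\<lambda>w::complex. norm w powr (p - 1)) \<longlongrightarrow> norm (0::complex) powr (p - 1)) (at 0)"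
      by (intro tendsto_intros) (use assms in auto)
    then have "(powr_dual p \<longlongrightarrow> 0) (at 0)"
      by (intro tendsto_norm_zero_cancel[of "powr_dual p"]) (simp add: norm_powr_dual)
    then show ?thesis
      using True by (simp add: isCont_def powr_dual_def)
  next
    case False
    then show ?thesis
      unfolding powr_dual_def[abs_def] by (intro continuous_intros) auto
  qed
qed

lemma Youngs_inequality_powr_minus_1:
  fixes a c p :: real
  assumes "1 < p" "0 \<le> a" "0 \<le> c"
  shows "a * c powr (p - 1) \<le> a powr p / p + (1 - 1/p) * c powr p"
proof -
  have "a * c powr (p - 1) \<le> a powr p / p + (c powr (p - 1)) powr (p / (p - 1)) / (p / (p - 1))"
    by (rule Youngs_inequality) (use assms in \<open>auto simp: field_simps\<close>)
  also have "(c powr (p - 1)) powr (p / (p - 1)) = c powr p"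
    using assms by (simp add: powr_powr)
  also have "c powr p / (p / (p - 1)) = (1 - 1/p) * c powr p"
    using assms by (simp add: field_simps)
  finally show ?thesis .
qed

lemma holomorphic_on_circle_pairing:
  assumes f: "f holomorphic_on ball 0 R" and g: "continuous_on {0..2*pi} g"
  shows "(\<lambda>z. integral {0..2*pi} (\<lambda>\<theta>. f (z * cis \<theta>) * g \<theta>)) holomorphic_on ball 0 R"
  unfolding cbox_interval[symmetric]
proof (rule leibniz_rule_holomorphic)
  fix z :: complex and t :: real assume z: "z \<in> ball 0 R"
  have "(f has_field_derivative deriv f (z * cis t)) (at (z * cis t))"
    by (rule holomorphic_derivI[OF f]) (use z in \<open>auto simp: norm_mult\<close>)
  then have "((\<lambda>z. f (z * cis t)) has_field_derivative deriv f (z * cis t) * (1 * cis t)) (at z)"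
    by (rule DERIV_chain2) (auto intro!: derivative_eq_intros)
  from DERIV_cmult_right[OF this, of "g t"]
  show "((\<lambda>z. f (z * cis t) * g t) has_field_derivative deriv f (z * cis t) * cis t * g t)
      (at z within ball 0 R)"
    by (simp add: has_field_derivative_at_within)
next
  fix z :: complex assume z: "z \<in> ball 0 R"
  have "continuous_on (sphere 0 (norm z)) f"
    by (rule continuous_on_subset[OF holomorphic_on_imp_continuous_on[OF f]]) (use z in auto)
  then show "(\<lambda>\<theta>. f (z * cis \<theta>) * g \<theta>) integrable_on cbox 0 (2*pi)"
    using g by (intro integrable_continuous continuous_on_mult continuous_on_circle_compose) auto
next
  have f': "continuous_on (ball 0 R) (deriv f)"
    by (rule holomorphic_on_imp_continuous_on[OF holomorphic_deriv[OF f]]) simp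
  have "continuous_on (ball 0 R \<times> cbox 0 (2*pi))
      (\<lambda>x. deriv f (fst x * cis (snd x)) * cis (snd x) * g (snd x))"
    by (intro continuous_on_mult continuous_on_compose2[OF f'] continuous_on_compose2[OF g]
      continuous_intros)
      (auto simp: norm_mult)
  then show "continuous_on (ball 0 R \<times> cbox 0 (2*pi)) (\<lambda>(z, t). deriv f (z * cis t) * cis t * g t)"
    by (simp add: case_prod_beta)
qed simp

lemma norm_circle_pairing_le:
  assumes f: "continuous_on (sphere 0 (norm z)) f" "continuous_on (sphere 0 (norm w)) f" and p: "1 < p"
  shows "norm (integral {0..2*pi} (\<lambda>\<theta>. f (z * cis \<theta>) * powr_dual p (f (w * cis \<theta>))))
    \<le> circle_integral p f z / p + (1 - 1/p) * circle_integral p f w"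
proof -
  have int: "(\<lambda>\<theta>. norm (f (z * cis \<theta>)) powr p / p) integrable_on {0..2*pi}"
    "(\<lambda>\<theta>. (1 - 1/p) * norm (f (w * cis \<theta>)) powr p) integrable_on {0..2*pi}"
    using p by (intro integrable_on_divide integrable_on_mult_right circle_powr_integrable f; simp)+
  have "norm (integral {0..2*pi} (\<lambda>\<theta>. f (z * cis \<theta>) * powr_dual p (f (w * cis \<theta>))))
      \<le> integral {0..2*pi} (\<lambda>\<theta>. norm (f (z * cis \<theta>)) powr p / p + (1 - 1/p) * norm (f (w * cis \<theta>)) powr p)"
  proof (rule integral_norm_bound_integral)
    show "(\<lambda>\<theta>. f (z * cis \<theta>) * powr_dual p (f (w * cis \<theta>))) integrable_on {0..2*pi}"
      by (intro integrable_continuous_interval continuous_on_mult continuous_on_circle_compose f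
          continuous_on_compose2[OF continuous_on_powr_dual[OF p]]) auto
  qed (use p int in \<open>auto simp: norm_mult norm_powr_dual intro: Youngs_inequality_powr_minus_1 integrable_add\<close>)
  also have "\<dots> = circle_integral p f z / p + (1 - 1/p) * circle_integral p f w"
    using integral_add[OF int] by (simp add: circle_integral_def)
  finally show ?thesis .
qed

lemma circle_pairing_self:
  assumes "continuous_on (sphere 0 (norm z)) f" "0 < p"
  shows "integral {0..2*pi} (\<lambda>\<theta>. f (z * cis \<theta>) * powr_dual p (f (z * cis \<theta>)))
      = of_real (circle_integral p f z)"
  using integral_linear[OF circle_powr_integrable[OF assms] bounded_linear_of_real[where 'a=complex]]
  by (simp add: circle_integral_def mult_powr_dual comp_def)

text \<open>Hardy's theorem by duality: pairing \<open>\<theta> \<mapsto> f (z cis \<theta>)\<close> with the function that norms the inner circle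
  gives a holomorphic function of \<open>z\<close>, to which the maximum principle applies.\<close>

lemma circle_mean_mono:
  assumes f: "f holomorphic_on ball 0 R" and p: "1 < p" and zw: "norm z \<le> norm w" "norm w < R"
  shows "circle_mean p f z \<le> circle_mean p f w"
proof -
  define I where "I = circle_integral p f"
  define G where "G = (\<lambda>v. integral {0..2*pi} (\<lambda>\<theta>. f (v * cis \<theta>) * powr_dual p (f (z * cis \<theta>))))"
  have p_pos: "0 < p" using p by simp
  have continuous: "continuous_on (sphere 0 (norm v)) f" if "norm v < R" for v :: complex
    by (rule continuous_on_subset[OF holomorphic_on_imp_continuous_on[OF f]]) (use that in auto)
  have I_nonneg: "0 \<le> I v" if "norm v < R" for v
    unfolding I_def by (rule circle_integral_nonneg[OF continuous[OF that] p_pos])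
  have mean: "circle_mean p f v = ennreal (I v)" if "norm v < R" for v
    unfolding I_def by (rule circle_mean_eq_integral[OF continuous[OF that] p_pos])
  have I_norm: "I v = I w" if "norm v = norm w" for v
    using circle_mean_norm[OF continuous, of v p] circle_mean_norm[OF continuous, of w p]
      mean[of v] mean[of w] I_nonneg[of v] I_nonneg[of w] that zw by simp
  have "G holomorphic_on ball 0 R"
    unfolding G_def using zw
    by (intro holomorphic_on_circle_pairing f continuous_on_compose2[OF continuous_on_powr_dual[OF p]]
        continuous_on_circle_compose continuous) auto
  moreover have "cball 0 (norm w) \<subseteq> ball (0::complex) R" using zw by auto
  ultimately have G: "G holomorphic_on cball 0 (norm w)"
    by (rule holomorphic_on_subset)
  have "norm (G z) \<le> I w / p + (1 - 1/p) * I z"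
  proof (rule maximum_modulus_frontier[of G "cball 0 (norm w)" "I w / p + (1 - 1/p) * I z"])
    show "G holomorphic_on interior (cball 0 (norm w))"
      by (rule holomorphic_on_subset[OF G interior_subset])
    show "continuous_on (closure (cball 0 (norm w))) G"
      using holomorphic_on_imp_continuous_on[OF G] by simp
    fix v :: complex assume "v \<in> frontier (cball 0 (norm w))"
    then show "norm (G v) \<le> I w / p + (1 - 1/p) * I z"
      using norm_circle_pairing_le[OF continuous continuous p, of v z] zw I_norm[of v]
      by (simp add: frontier_cball G_def I_def)
  qed (use zw in auto)
  moreover have "G z = of_real (I z)"
    unfolding G_def I_def using zw by (intro circle_pairing_self continuous p_pos) simp
  ultimately have "I z \<le> I w / p + (1 - 1/p) * I z"
    by simp
  then have "I z / p \<le> I w / p" by (simp add: algebra_simps)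
  then have "I z \<le> I w" using p by (simp add: divide_le_cancel)
  then show ?thesis
    using mean[of z] mean[of w] zw by (simp add: ennreal_leI)
qed

lemma nn_integral_ball_translate:
  fixes F :: "complex \<Rightarrow> ennreal"
  assumes F: "F \<in> borel_measurable (restrict_space borel (ball w d))"
  shows "(\<integral>\<^sup>+z\<in>ball w d. F z \<partial>lborel) = (\<integral>\<^sup>+z\<in>ball 0 d. F (w + z) \<partial>lborel)"
proof -
  have "(\<lambda>z. F z * indicator (ball w d) z) \<in> borel_measurable borel"
    using F by (simp add: borel_measurable_restrict_space_iff_ennreal)
  then have "(\<integral>\<^sup>+z\<in>ball w d. F z \<partial>lborel) = (\<integral>\<^sup>+z. F (w + z) * indicator (ball w d) (w + z) \<partial>lborel)"
    by (subst lborel_distr_plus[of w, symmetric]) (simp add: nn_integral_distr)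
  also have "\<dots> = (\<integral>\<^sup>+z\<in>ball 0 d. F (w + z) \<partial>lborel)"
    by (intro nn_integral_cong) (simp add: indicator_def dist_norm)
  finally show ?thesis .
qed

lemma powr_norm_submean:
  assumes f: "f holomorphic_on ball w d" and d: "0 < d" and p: "1 < p"
  shows "ennreal (pi * d\<^sup>2 * norm (f w) powr p) \<le> (\<integral>\<^sup>+z\<in>ball w d. ennreal (norm (f z) powr p) \<partial>lborel)"
proof -
  define h where "h = (\<lambda>z. f (w + z))"
  have h: "h holomorphic_on ball 0 d"
    unfolding h_def
    by (rule holomorphic_on_compose_gen[of "\<lambda>z. w + z" _ f, unfolded comp_def, OF _ f])
      (auto intro!: holomorphic_intros simp: dist_norm)
  have measurable: "(\<lambda>z. ennreal (norm (g z) powr p)) \<in> borel_measurable (restrict_space borel (ball a d))"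
    if "g holomorphic_on ball a d" for g and a :: complex
    using that
    by (intro borel_measurable_norm_powr borel_measurable_continuous_on_restrict
      holomorphic_on_imp_continuous_on)
  have "ennreal (pi * d\<^sup>2 * norm (f w) powr p)
      = (\<integral>\<^sup>+z\<in>ball (0::complex) d. ennreal (norm (h 0) powr p) \<partial>lborel)"
    using d by (subst nn_integral_cmult_indicator)
      (auto simp: h_def emeasure_ball unit_ball_vol_2 mult.commute simp flip: ennreal_mult)
  also have "\<dots> = (\<integral>\<^sup>+r\<in>{0..<d}. ennreal r * circle_mean p h 0 \<partial>lborel)"
    by (subst nn_integral_ball_polar) (simp_all add: circle_mean_def)
  also have "\<dots> \<le> (\<integral>\<^sup>+r\<in>{0..<d}. ennreal r * circle_mean p h (of_real r) \<partial>lborel)"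
    by (intro nn_integral_mono) (auto simp: indicator_def intro!: mult_left_mono circle_mean_mono[OF h p])
  also have "\<dots> = (\<integral>\<^sup>+z\<in>ball 0 d. ennreal (norm (h z) powr p) \<partial>lborel)"
    unfolding circle_mean_def by (rule nn_integral_ball_polar[symmetric, OF measurable[OF h]])
  also have "\<dots> = (\<integral>\<^sup>+z\<in>ball w d. ennreal (norm (f z) powr p) \<partial>lborel)"
    unfolding h_def by (rule nn_integral_ball_translate[symmetric, OF measurable[OF f]])
  finally show ?thesis .
qed

lemma norm_higher_deriv_powr_le:
  assumes f: "f holomorphic_on ball w d" and d: "0 < d" and p: "1 < p"
    and x: "(\<integral>\<^sup>+z\<in>ball w d. ennreal (norm (f z) powr p) \<partial>lborel) \<le> ennreal x" "0 \<le> x"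
  shows "norm ((deriv ^^ k) f w) powr p \<le> (fact k * 2 ^ k) powr p * 4 / pi * (x / (d\<^sup>2 * d powr (k * p)))"
proof -
  define B where "B = (4 * x / (pi * d\<^sup>2)) powr (1 / p)"
  have bound: "norm (f y) \<le> B" if y: "norm (w - y) = d / 2" for y
  proof -
    have sub: "ball y (d / 2) \<subseteq> ball w d"
    proof
      fix z assume "z \<in> ball y (d / 2)"
      then show "z \<in> ball w d" using y dist_triangle[of w z y] by (simp add: dist_norm)
    qed
    have "ennreal (pi * (d / 2)\<^sup>2 * norm (f y) powr p)
        \<le> (\<integral>\<^sup>+z\<in>ball y (d / 2). ennreal (norm (f z) powr p) \<partial>lborel)"
      by (rule powr_norm_submean[OF holomorphic_on_subset[OF f sub]]) (use d p in auto)
    also have "\<dots> \<le> (\<integral>\<^sup>+z\<in>ball w d. ennreal (norm (f z) powr p) \<partial>lborel)"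
      by (intro nn_integral_mono) (use sub in \<open>auto simp: indicator_def\<close>)
    also note x(1)
    finally have "norm (f y) powr p \<le> 4 * x / (pi * d\<^sup>2)"
      using d x(2) by (simp add: field_simps)
    then have "(norm (f y) powr p) powr (1 / p) \<le> B"
      unfolding B_def by (intro powr_mono2) (use p in auto)
    then show ?thesis using p by (simp add: powr_powr)
  qed
  have sub: "cball w (d / 2) \<subseteq> ball w d" using d by (auto simp: subset_iff)
  have "norm ((deriv ^^ k) f w) \<le> fact k * B / (d / 2) ^ k"
  proof (rule Cauchy_inequality)
    show "f holomorphic_on ball w (d / 2)"
      by (rule holomorphic_on_subset[OF f]) (use d in auto)
    show "continuous_on (cball w (d / 2)) f"
      by (rule continuous_on_subset[OF holomorphic_on_imp_continuous_on[OF f] sub])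
  qed (use d bound in auto)
  also have "fact k * B / (d / 2) ^ k = fact k * 2 ^ k * (B / d powr k)"
    using d by (simp add: powr_realpow power_divide)
  finally have "norm ((deriv ^^ k) f w) powr p \<le> (fact k * 2 ^ k * (B / d powr k)) powr p"
    by (intro powr_mono2) (use p in auto)
  also have "\<dots> = (fact k * 2 ^ k) powr p * ((4 * x / (pi * d\<^sup>2)) / d powr (k * p))"
    using d x p by (simp add: powr_mult powr_divide B_def powr_powr)
  finally show ?thesis by (simp add: mult.assoc)
qed

section \<open>Radial weights\<close>

lemma mem_disc_iff: "z \<in> disc \<longleftrightarrow> norm z < 1"
  by (simp add: disc_def)

lemma open_disc: "open disc"
  by (simp add: disc_def)

lemma disc_in_borel [measurable]: "disc \<in> sets borel"
  by (simp add: disc_def)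

definition bergman_measure :: "(real \<Rightarrow> real) \<Rightarrow> complex measure" where
  "bergman_measure w = density (restrict_space lborel disc) (\<lambda>z. ennreal (w (norm z) / pi))"

lemma sets_bergman_measure [simp, measurable_cong]:
  "sets (bergman_measure w) = sets (restrict_space borel disc)"
  by (simp add: bergman_measure_def cong: sets_restrict_space_cong)

lemma space_bergman_measure [simp]: "space (bergman_measure w) = disc"
  by (simp add: bergman_measure_def space_restrict_space)

lemma radial_measurable:
  assumes w: "w \<in> borel_measurable (restrict_space borel {0..<1})"
  shows "(\<lambda>z::complex. ennreal (w (norm z) / pi)) \<in> borel_measurable (restrict_space lborel disc)"
proof -
  have "norm \<in> measurable (restrict_space lborel disc) (restrict_space borel {0..<1::real})"
    by (intro measurable_restrict_space3) (auto simp: mem_disc_iff)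
  from measurable_compose[OF this w] show ?thesis by measurable
qed

lemma nn_integral_bergman_measure_density:
  assumes "w \<in> borel_measurable (restrict_space borel {0..<1})"
      "F \<in> borel_measurable (restrict_space borel disc)"
  shows "(\<integral>\<^sup>+z. F z \<partial>bergman_measure w) = (\<integral>\<^sup>+z\<in>disc. ennreal (w (norm z) / pi) * F z \<partial>lborel)"
proof -
  have "F \<in> borel_measurable (restrict_space lborel disc)"
    using assms(2) by (simp add: measurable_cong_sets[OF sets_restrict_space_cong[OF sets_lborel] refl])
  then show ?thesis
    unfolding bergman_measure_def
    by (simp add: nn_integral_density radial_measurable[OF assms(1)] nn_integral_restrict_space)
qed

lemma nn_integral_bergman_measure:
  assumes w: "w \<in> borel_measurable (restrict_space borel {0..<1})"
    and F: "F \<in> borel_measurable (restrict_space borel disc)"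
  shows "(\<integral>\<^sup>+z. F z \<partial>bergman_measure w)
    = (\<integral>\<^sup>+r\<in>{0..<1}. ennreal (r * w r / pi) * (\<integral>\<^sup>+\<zeta>. F (of_real r * \<zeta>) \<partial>circle_measure) \<partial>lborel)"
proof -
  have wF: "(\<lambda>z. ennreal (w (norm z) / pi) * F z) \<in> borel_measurable (restrict_space borel (ball 0 1))"
    using radial_measurable[OF w] F
    by (simp add: disc_def measurable_cong_sets[OF sets_restrict_space_cong[OF sets_lborel] refl])
  have F_circle: "(\<lambda>\<zeta>. F (of_real r * \<zeta>)) \<in> borel_measurable circle_measure" if "r \<in> {0..<1}" for r
    using that unfolding measurable_cong_sets[OF sets_circle_measure refl]
    by (intro measurable_compose[OF measurable_restrict_space3 F]) (auto simp: mem_disc_iff norm_mult)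
  have "(\<integral>\<^sup>+z. F z \<partial>bergman_measure w) = (\<integral>\<^sup>+z\<in>ball 0 1. ennreal (w (norm z) / pi) * F z \<partial>lborel)"
    unfolding disc_def[symmetric] by (rule nn_integral_bergman_measure_density[OF w F])
  also have "\<dots> = (\<integral>\<^sup>+r\<in>{0..<1}. ennreal r
      * (\<integral>\<^sup>+\<zeta>. ennreal (w (norm (of_real r * \<zeta>)) / pi) * F (of_real r * \<zeta>) \<partial>circle_measure) \<partial>lborel)"
    by (rule nn_integral_ball_polar[OF wF])
  also have "\<dots> = (\<integral>\<^sup>+r\<in>{0..<1}. ennreal (r * w r / pi) * (\<integral>\<^sup>+\<zeta>. F (of_real r * \<zeta>) \<partial>circle_measure) \<partial>lborel)"
  proof (rule nn_integral_cong)
    fix r :: real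
    have "(\<integral>\<^sup>+\<zeta>. ennreal (w (norm (of_real r * \<zeta>)) / pi) * F (of_real r * \<zeta>) \<partial>circle_measure)
        = ennreal (w r / pi) * (\<integral>\<^sup>+\<zeta>. F (of_real r * \<zeta>) \<partial>circle_measure)" if r: "r \<in> {0..<1}"
    proof -
      have "(\<integral>\<^sup>+\<zeta>. ennreal (w (norm (of_real r * \<zeta>)) / pi) * F (of_real r * \<zeta>) \<partial>circle_measure)
          = (\<integral>\<^sup>+\<zeta>. ennreal (w r / pi) * F (of_real r * \<zeta>) \<partial>circle_measure)"
        using r by (intro nn_integral_cong) (simp add: norm_mult)
      then show ?thesis
        by (simp add: nn_integral_cmult[OF F_circle[OF r]])
    qed
    moreover have "ennreal (r * w r / pi) = ennreal r * ennreal (w r / pi)" if "0 \<le> r"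
      using ennreal_mult'[OF that, of "w r / pi"] by simp
    ultimately show "ennreal r
        * (\<integral>\<^sup>+\<zeta>. ennreal (w (norm (of_real r * \<zeta>)) / pi) * F (of_real r * \<zeta>) \<partial>circle_measure)
        * indicator {0..<1} r
      = ennreal (r * w r / pi) * (\<integral>\<^sup>+\<zeta>. F (of_real r * \<zeta>) \<partial>circle_measure) * indicator {0..<1} r"
      by (simp add: indicator_def mult.assoc)
  qed
  finally show ?thesis .
qed

lemma holomorphic_on_disc_measurable:
  "f holomorphic_on disc \<Longrightarrow> f \<in> borel_measurable (restrict_space borel disc)"
  by (intro borel_measurable_continuous_on_restrict holomorphic_on_imp_continuous_on)

lemma Ap_int_eq_nn_integral:
  assumes w: "w \<in> borel_measurable (restrict_space borel {0..<1})"
    and f: "f \<in> borel_measurable (restrict_space borel disc)"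
  shows "Ap_int w p f = (\<integral>\<^sup>+z. ennreal (norm (f z) powr p) \<partial>bergman_measure w)"
proof -
  have "ennreal (norm (f z) powr p * w (norm z) / pi)
      = ennreal (w (norm z) / pi) * ennreal (norm (f z) powr p)" for z
    using ennreal_mult'[of "norm (f z) powr p" "w (norm z) / pi"] by (simp add: mult.commute)
  then show ?thesis
    by (simp add: Ap_int_def nn_integral_bergman_measure_density[OF w borel_measurable_norm_powr[OF f]])
qed

lemma Ap_int_polar:
  assumes "w \<in> borel_measurable (restrict_space borel {0..<1})"
    and "f \<in> borel_measurable (restrict_space borel disc)"
  shows "Ap_int w p f = (\<integral>\<^sup>+r\<in>{0..<1}. ennreal (r * w r / pi) * circle_mean p f (of_real r) \<partial>lborel)"
  using assms
  by (simp add: Ap_int_eq_nn_integral nn_integral_bergman_measure circle_mean_def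
    borel_measurable_norm_powr)

lemma circle_mean_measurable:
  assumes f: "f \<in> borel_measurable (restrict_space borel disc)"
  shows "(\<lambda>r. circle_mean p f (of_real r)) \<in> borel_measurable (restrict_space borel {0..<1::real})"
  unfolding circle_mean_def
proof (rule circle_measure.borel_measurable_nn_integral)
  have "fst \<in> borel_measurable (restrict_space borel {0..<1::real} \<Otimes>\<^sub>M circle_measure)"
    by (rule measurable_compose[OF measurable_fst]) (simp add: measurable_restrict_space1)
  then have "(\<lambda>x. of_real (fst x) * snd x)
      \<in> borel_measurable (restrict_space borel {0..<1::real} \<Otimes>\<^sub>M circle_measure)"
    by measurable
  then have "(\<lambda>x. of_real (fst x) * snd x)
      \<in> restrict_space borel {0..<1::real} \<Otimes>\<^sub>M circle_measure \<rightarrow>\<^sub>M restrict_space borel disc"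
    by (rule measurable_restrict_space2[rotated]) (auto simp: space_pair_measure mem_disc_iff norm_mult)
  from measurable_compose[OF this f]
  show "(\<lambda>(r, \<zeta>). ennreal (norm (f (of_real r * \<zeta>)) powr p))
      \<in> borel_measurable (restrict_space borel {0..<1} \<Otimes>\<^sub>M circle_measure)"
    by (simp add: case_prod_unfold)
qed

locale disc_weight =
  fixes \<omega> :: "real \<Rightarrow> real"
  assumes radial_weight: "radial_weight \<omega>"
begin

lemma omega_nonneg: "0 \<le> t \<Longrightarrow> t \<le> 1 \<Longrightarrow> 0 \<le> \<omega> t"
  using radial_weight by (simp add: radial_weight_def)

lemma omega_measurable: "A \<subseteq> {0..1} \<Longrightarrow> \<omega> \<in> borel_measurable (restrict_space borel A)"
proof (rule measurable_restrict_mono)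
  show "\<omega> \<in> borel_measurable (restrict_space borel {0..1})"
    using radial_weight
    by (auto simp: radial_weight_def set_integrable_def borel_measurable_restrict_space_iff
      dest: borel_measurable_integrable)
qed auto

lemma omega_measurable_Ico: "\<omega> \<in> borel_measurable (restrict_space borel {0..<1})"
  by (rule omega_measurable) auto

lemma omega_hat_pos: "0 \<le> r \<Longrightarrow> r < 1 \<Longrightarrow> 0 < omega_hat \<omega> r"
  using radial_weight by (simp add: radial_weight_def)

lemma omega_hat_nonneg: "0 \<le> r \<Longrightarrow> 0 \<le> omega_hat \<omega> r"
  unfolding omega_hat_def set_lebesgue_integral_def
  by (intro integral_nonneg_AE AE_I2) (auto simp: indicator_def omega_nonneg)

lemma nn_integral_omega:
  assumes r: "0 \<le> r"
  shows "(\<integral>\<^sup>+t\<in>{r..1}. ennreal (\<omega> t) \<partial>lborel) = ennreal (omega_hat \<omega> r)"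
proof -
  have "set_integrable lborel {r..1} \<omega>"
    using radial_weight r by (auto simp: radial_weight_def intro: set_integrable_subset)
  then have "(\<integral>\<^sup>+t. ennreal (indicator {r..1} t *\<^sub>R \<omega> t) \<partial>lborel) = ennreal (omega_hat \<omega> r)"
    unfolding omega_hat_def set_lebesgue_integral_def set_integrable_def
    using r by (intro nn_integral_eq_integral) (auto simp: indicator_def omega_nonneg)
  moreover have "ennreal (\<omega> t) * indicator {r..1} t = ennreal (indicator {r..1} t *\<^sub>R \<omega> t)" for t
    by (simp add: indicator_def)
  ultimately show ?thesis by simp
qed

lemma omega_hat_antimono:
  assumes "0 \<le> r" "r \<le> t"
  shows "omega_hat \<omega> t \<le> omega_hat \<omega> r"
proof -
  have "ennreal (omega_hat \<omega> t) \<le> ennreal (omega_hat \<omega> r)"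
    using assms by (auto intro!: nn_integral_mono simp: indicator_def simp flip: nn_integral_omega)
  then show ?thesis using assms by (simp add: omega_hat_nonneg)
qed

lemma nn_integral_omega_Ico:
  assumes r: "0 \<le> r" "r \<le> t" "t \<le> 1"
  shows "(\<integral>\<^sup>+s\<in>{r..<t}. ennreal (\<omega> s) \<partial>lborel) = ennreal (omega_hat \<omega> r - omega_hat \<omega> t)"
proof -
  have measurable: "(\<lambda>s. ennreal (\<omega> s) * indicator A s) \<in> borel_measurable borel"
    if "A \<subseteq> {0..1}" "A \<in> sets borel" for A
    using omega_measurable[OF that(1)] that(2)
    by (simp flip: borel_measurable_restrict_space_iff_ennreal)
  have "ennreal (omega_hat \<omega> r)
      = (\<integral>\<^sup>+s. ennreal (\<omega> s) * indicator {r..<t} s + ennreal (\<omega> s) * indicator {t..1} s \<partial>lborel)"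
    unfolding nn_integral_omega[OF r(1), symmetric]
    by (intro nn_integral_cong) (use r in \<open>auto simp: indicator_def\<close>)
  also have "\<dots> = (\<integral>\<^sup>+s\<in>{r..<t}. ennreal (\<omega> s) \<partial>lborel) + (\<integral>\<^sup>+s\<in>{t..1}. ennreal (\<omega> s) \<partial>lborel)"
    using r by (intro nn_integral_add) (auto intro!: measurable)
  also have "(\<integral>\<^sup>+s\<in>{t..1}. ennreal (\<omega> s) \<partial>lborel) = ennreal (omega_hat \<omega> t)"
    using r by (intro nn_integral_omega) simp
  finally show ?thesis
    using r by (simp add: omega_hat_nonneg flip: ennreal_minus)
qed

lemma omega_hat_measurable: "omega_hat \<omega> \<in> borel_measurable (restrict_space borel {0..})"
proof -
  have "mono_on {0..} (\<lambda>r. - omega_hat \<omega> r)"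
    by (intro mono_onI) (auto intro!: omega_hat_antimono)
  from borel_measurable_uminus[OF borel_measurable_mono_on_fnc[OF this]] show ?thesis
    by simp
qed

lemma emeasure_bergman_measure_finite: "emeasure (bergman_measure \<omega>) disc < \<infinity>"
proof -
  have "emeasure (bergman_measure \<omega>) disc = (\<integral>\<^sup>+z. 1 \<partial>bergman_measure \<omega>)"
    using space_bergman_measure[of \<omega>] by simp
  also have "\<dots> = (\<integral>\<^sup>+r\<in>{0..<1}. ennreal (r * \<omega> r / pi) * ennreal (2 * pi) \<partial>lborel)"
    using nn_integral_bergman_measure[OF omega_measurable_Ico, of "\<lambda>_. 1"]
    by (simp add: emeasure_circle_measure_space)
  also have "\<dots> \<le> (\<integral>\<^sup>+r\<in>{0..1}. ennreal 2 * ennreal (\<omega> r) \<partial>lborel)"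
  proof (rule nn_integral_mono)
    fix r :: real
    have "ennreal (r * \<omega> r / pi) * ennreal (2 * pi) \<le> ennreal 2 * ennreal (\<omega> r)" if "r \<in> {0..1}"
    proof -
      have "ennreal (r * \<omega> r / pi) * ennreal (2 * pi) = ennreal (2 * (r * \<omega> r))"
        by (subst ennreal_mult''[symmetric]) (auto simp: mult_ac)
      also have "\<dots> \<le> ennreal (2 * \<omega> r)"
        using that omega_nonneg[of r] by (intro ennreal_leI) (simp add: mult_left_le_one_le)
      also have "\<dots> = ennreal 2 * ennreal (\<omega> r)"
        by (rule ennreal_mult') simp
      finally show ?thesis .
    qed
    then show "ennreal (r * \<omega> r / pi) * ennreal (2 * pi) * indicator {0..<1} r
        \<le> ennreal 2 * ennreal (\<omega> r) * indicator {0..1} r"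
      by (auto simp: indicator_def)
  qed
  also have "\<dots> = ennreal 2 * ennreal (omega_hat \<omega> 0)"
    using omega_measurable[of "{0..1}"]
    by (subst nn_integral_omega[symmetric], simp, subst nn_integral_cmult[symmetric])
      (auto simp: borel_measurable_restrict_space_iff_ennreal[symmetric] mult.assoc)
  finally show ?thesis
    by (rule le_less_trans) (simp add: ennreal_mult_less_top)
qed

end

definition omega_tilde :: "(real \<Rightarrow> real) \<Rightarrow> real \<Rightarrow> real" where
  "omega_tilde \<omega> r = omega_hat \<omega> r / (1 - r)"

lemma (in disc_weight) omega_tilde_measurable:
  "omega_tilde \<omega> \<in> borel_measurable (restrict_space borel {0..<1})"
proof -
  have "omega_hat \<omega> \<in> borel_measurable (restrict_space borel {0..<1})"
    by (rule measurable_restrict_mono[OF omega_hat_measurable]) auto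
  moreover have "(\<lambda>r::real. 1 - r) \<in> borel_measurable (restrict_space borel {0..<1})"
    by (intro measurable_restrict_space1) measurable
  ultimately show ?thesis
    unfolding omega_tilde_def[abs_def] by (rule borel_measurable_divide)
qed

locale doubling_weight = disc_weight +
  fixes \<kappa> :: real
  assumes kappa_ge_1: "1 \<le> \<kappa>"
    and doubling: "\<And>r. 0 \<le> r \<Longrightarrow> r < 1 \<Longrightarrow> omega_hat \<omega> r \<le> \<kappa> * omega_hat \<omega> ((1 + r) / 2)"
begin

lemma omega_hat_le_scale:
  assumes "0 \<le> r" "0 \<le> s" "s < 1" "1 - r \<le> 2 ^ n * (1 - s)"
  shows "omega_hat \<omega> r \<le> \<kappa> ^ n * omega_hat \<omega> s"
  using assms(1,4)
proof (induction n arbitrary: r)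
  case 0
  then show ?case using assms omega_hat_antimono[of s r] by simp
next
  case (Suc n)
  show ?case
  proof (cases "r < 1")
    case True
    have "omega_hat \<omega> r \<le> \<kappa> * omega_hat \<omega> ((1 + r) / 2)"
      using Suc.prems True by (intro doubling)
    also have "1 - (1 + r) / 2 \<le> 2 ^ n * (1 - s)"
      using Suc.prems by (simp add: field_simps)
    then have "\<kappa> * omega_hat \<omega> ((1 + r) / 2) \<le> \<kappa> * (\<kappa> ^ n * omega_hat \<omega> s)"
      using Suc.prems kappa_ge_1 by (intro mult_left_mono Suc.IH) auto
    finally show ?thesis by (simp add: mult.assoc)
  next
    case False
    then have "omega_hat \<omega> r \<le> omega_hat \<omega> s"
      using assms by (intro omega_hat_antimono) auto
    moreover have "1 \<le> \<kappa> ^ Suc n" using kappa_ge_1 by (rule one_le_power)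
    ultimately show ?thesis
      using mult_right_mono[of 1 "\<kappa> ^ Suc n" "omega_hat \<omega> s"] omega_hat_nonneg[OF assms(2)] by simp
  qed
qed

lemma omega_hat_le_powr:
  assumes "0 \<le> r" "r \<le> s" "s < 1"
  shows "omega_hat \<omega> r \<le> \<kappa> * ((1 - r) / (1 - s)) powr log 2 \<kappa> * omega_hat \<omega> s"
proof -
  define x where "x = (1 - r) / (1 - s)"
  have x: "1 \<le> x" using assms by (simp add: x_def)
  define n where "n = nat \<lceil>log 2 x\<rceil>"
  have n: "log 2 x \<le> n" "n \<le> log 2 x + 1"
    using x by (auto simp: n_def)
  have "2 powr log 2 x \<le> 2 powr n" by (intro powr_mono n) simp
  then have "x \<le> 2 ^ n" using x by (simp add: powr_realpow)
  then have "omega_hat \<omega> r \<le> \<kappa> ^ n * omega_hat \<omega> s"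
    using assms by (intro omega_hat_le_scale) (auto simp: x_def field_simps)
  also have "\<dots> \<le> \<kappa> * x powr log 2 \<kappa> * omega_hat \<omega> s"
  proof (rule mult_right_mono)
    have "\<kappa> ^ n = \<kappa> powr n"
      using kappa_ge_1 by (simp add: powr_realpow)
    also have "\<dots> \<le> \<kappa> powr (log 2 x + 1)"
      using kappa_ge_1 by (intro powr_mono n)
    also have "\<dots> = \<kappa> * \<kappa> powr log 2 x"
      using kappa_ge_1 by (simp add: powr_add)
    also have "\<kappa> powr log 2 x = x powr log 2 \<kappa>"
      using kappa_ge_1 x by (simp add: powr_def log_def)
    finally show "\<kappa> ^ n \<le> \<kappa> * x powr log 2 \<kappa>" .
  qed (use assms in \<open>simp add: omega_hat_nonneg\<close>)
  finally show ?thesis by (simp add: x_def)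
qed

end

locale regular_weight = doubling_weight +
  fixes \<sigma> \<Lambda> :: real
  assumes sigma_gt_1: "1 < \<sigma>" and Lambda_gt_1: "1 < \<Lambda>"
    and reverse_doubling: "\<And>r. 0 \<le> r \<Longrightarrow> r < 1 \<Longrightarrow> \<Lambda> * omega_hat \<omega> (1 - (1 - r) / \<sigma>) \<le> omega_hat \<omega> r"
begin

definition reg_const :: real where
  "reg_const = \<Lambda> / (\<Lambda> - 1) * (\<sigma> - 1)"

lemma reg_const_pos: "0 < reg_const"
  using sigma_gt_1 Lambda_gt_1 by (simp add: reg_const_def)

lemma omega_tilde_le_annulus:
  assumes r: "0 \<le> r" "r < 1"
  shows "ennreal (omega_tilde \<omega> r)
    \<le> ennreal (\<Lambda> / (\<Lambda> - 1) / (1 - r)) * (\<integral>\<^sup>+t\<in>{r..<1 - (1 - r) / \<sigma>}. ennreal (\<omega> t) \<partial>lborel)"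
proof -
  define s where "s = 1 - (1 - r) / \<sigma>"
  have s: "r \<le> s" "s \<le> 1"
  proof -
    have "(1 - r) / \<sigma> \<le> (1 - r) / 1" using r sigma_gt_1 by (intro divide_left_mono) auto
    then show "r \<le> s" by (simp add: s_def)
    show "s \<le> 1" using r sigma_gt_1 by (simp add: s_def)
  qed
  have "omega_hat \<omega> r * (\<Lambda> - 1) \<le> \<Lambda> * (omega_hat \<omega> r - omega_hat \<omega> s)"
    using reverse_doubling[OF r] by (simp add: s_def algebra_simps)
  then have "omega_hat \<omega> r \<le> \<Lambda> / (\<Lambda> - 1) * (omega_hat \<omega> r - omega_hat \<omega> s)"
    using Lambda_gt_1 by (simp add: field_simps)
  from divide_right_mono[OF this, of "1 - r"]
  have "omega_tilde \<omega> r \<le> \<Lambda> / (\<Lambda> - 1) / (1 - r) * (omega_hat \<omega> r - omega_hat \<omega> s)"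
    using r by (simp add: omega_tilde_def)
  then have "ennreal (omega_tilde \<omega> r)
      \<le> ennreal (\<Lambda> / (\<Lambda> - 1) / (1 - r)) * ennreal (omega_hat \<omega> r - omega_hat \<omega> s)"
    using Lambda_gt_1 r by (subst ennreal_mult'[symmetric]) (auto intro: ennreal_leI)
  then show ?thesis
    using nn_integral_omega_Ico[OF r(1) s] by (simp add: s_def)
qed

lemma nn_integral_annulus_le:
  fixes M :: "real \<Rightarrow> ennreal"
  assumes t: "0 \<le> t" "t < 1" and c: "0 \<le> c"
    and mono: "\<And>r. 0 \<le> r \<Longrightarrow> r \<le> t \<Longrightarrow> M r \<le> M t"
  shows "(\<integral>\<^sup>+r\<in>{r. 0 \<le> r \<and> r \<le> t \<and> t < 1 - (1 - r) / \<sigma>}. ennreal (c / (1 - r)) * M r \<partial>lborel)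
    \<le> ennreal (c * (\<sigma> - 1)) * M t"
proof -
  define A where "A = {1 - \<sigma> * (1 - t)<..t}"
  have "ennreal (c / (1 - r)) * M r * indicator {r. 0 \<le> r \<and> r \<le> t \<and> t < 1 - (1 - r) / \<sigma>} r
      \<le> ennreal (c / (1 - t)) * M t * indicator A r" for r
  proof (cases "0 \<le> r \<and> r \<le> t \<and> t < 1 - (1 - r) / \<sigma>")
    case True
    then have "(1 - r) / \<sigma> < 1 - t" by simp
    then have "r \<in> A" using True sigma_gt_1 by (simp add: A_def field_simps)
    moreover have "ennreal (c / (1 - r)) \<le> ennreal (c / (1 - t))"
      using True t c by (intro ennreal_leI divide_left_mono) auto
    ultimately show ?thesis
      using True mono[of r] by (auto intro!: mult_mono)
  qed auto
  then have "(\<integral>\<^sup>+r\<in>{r. 0 \<le> r \<and> r \<le> t \<and> t < 1 - (1 - r) / \<sigma>}. ennreal (c / (1 - r)) * M r \<partial>lborel)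
      \<le> (\<integral>\<^sup>+r. ennreal (c / (1 - t)) * M t * indicator A r \<partial>lborel)"
    by (rule nn_integral_mono)
  also have "\<dots> = ennreal (c / (1 - t)) * M t * ennreal ((\<sigma> - 1) * (1 - t))"
    using t sigma_gt_1 mult_right_mono[of 1 \<sigma> "1 - t"]
    by (subst nn_integral_cmult_indicator) (auto simp: A_def algebra_simps)
  also have "\<dots> = (ennreal (c / (1 - t)) * ennreal ((\<sigma> - 1) * (1 - t))) * M t"
    by (simp add: mult_ac)
  also have "ennreal (c / (1 - t)) * ennreal ((\<sigma> - 1) * (1 - t)) = ennreal (c * (\<sigma> - 1))"
    using t c by (subst ennreal_mult'[symmetric]) auto
  finally show ?thesis .
qed

text \<open>Unlike \<open>\<omega>\<close>, which may vanish on large annuli, \<open>omega_tilde \<omega>\<close> is nearly constant on discs of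
  hyperbolic size. To compare the two against an increasing function \<open>M\<close>, spread \<open>omega_hat \<omega> r\<close> over the
  annulus \<open>r \<le> t < 1 - (1 - r) / \<sigma>\<close>, where \<open>M r \<le> M t\<close>, and integrate over \<open>r\<close> first.\<close>

definition annulus_kernel :: "real \<Rightarrow> real \<Rightarrow> ennreal" where
  "annulus_kernel r t = ennreal (\<Lambda> / (\<Lambda> - 1) / (1 - r)) * (ennreal (\<omega> t) * indicator {0..<1} t)
     * indicator {(r, t). 0 \<le> r \<and> r \<le> t \<and> t < 1 - (1 - r) / \<sigma>} (r, t)"

lemma omega_indicator_measurable: "(\<lambda>t. ennreal (\<omega> t) * indicator {0..<1} t) \<in> borel_measurable borel"
  using measurable_compose[OF omega_measurable_Ico measurable_ennreal]
  by (simp add: borel_measurable_restrict_space_iff_ennreal)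

lemma annulus_kernel_measurable: "case_prod annulus_kernel \<in> borel_measurable (lborel \<Otimes>\<^sub>M lborel)"
proof -
  note [measurable] = omega_indicator_measurable
  show ?thesis
    unfolding annulus_kernel_def[abs_def] by measurable
qed

lemma omega_tilde_le_annulus_kernel:
  assumes r: "0 \<le> r" "r < 1"
  shows "ennreal (omega_tilde \<omega> r) \<le> (\<integral>\<^sup>+t. annulus_kernel r t \<partial>lborel)"
proof -
  have "1 - (1 - r) / \<sigma> \<le> 1" using r sigma_gt_1 by simp
  then have "annulus_kernel r t
      = ennreal (\<Lambda> / (\<Lambda> - 1) / (1 - r)) * (ennreal (\<omega> t) * indicator {r..<1 - (1 - r) / \<sigma>} t)" for t
    using r by (auto simp: annulus_kernel_def indicator_def)
  moreover have "(\<lambda>t. ennreal (\<omega> t) * indicator {r..<1 - (1 - r) / \<sigma>} t) \<in> borel_measurable borel"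
    using r \<open>1 - (1 - r) / \<sigma> \<le> 1\<close>
    by (subst borel_measurable_restrict_space_iff_ennreal[symmetric])
      (auto intro!: measurable_compose[OF omega_measurable measurable_ennreal])
  ultimately show ?thesis
    using omega_tilde_le_annulus[OF r] by (simp add: nn_integral_cmult)
qed

lemma nn_integral_annulus_kernel_le:
  fixes M :: "real \<Rightarrow> ennreal"
  assumes [measurable]: "M \<in> borel_measurable borel" and t: "0 \<le> t" "t < 1"
    and mono: "\<And>r. 0 \<le> r \<Longrightarrow> r \<le> t \<Longrightarrow> M r \<le> M t"
  shows "(\<integral>\<^sup>+r. annulus_kernel r t * M r \<partial>lborel) \<le> ennreal reg_const * (ennreal (\<omega> t) * M t)"
proof -
  have "(\<integral>\<^sup>+r. annulus_kernel r t * M r \<partial>lborel)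
      = (\<integral>\<^sup>+r. ennreal (\<omega> t) * (ennreal (\<Lambda> / (\<Lambda> - 1) / (1 - r)) * M r
          * indicator {r. 0 \<le> r \<and> r \<le> t \<and> t < 1 - (1 - r) / \<sigma>} r) \<partial>lborel)"
    using t by (intro nn_integral_cong) (auto simp: annulus_kernel_def indicator_def mult_ac)
  also have "\<dots> = ennreal (\<omega> t) * (\<integral>\<^sup>+r\<in>{r. 0 \<le> r \<and> r \<le> t \<and> t < 1 - (1 - r) / \<sigma>}.
      ennreal (\<Lambda> / (\<Lambda> - 1) / (1 - r)) * M r \<partial>lborel)"
    by (rule nn_integral_cmult) measurable
  also have "\<dots> \<le> ennreal (\<omega> t) * (ennreal reg_const * M t)"
    unfolding reg_const_def using t Lambda_gt_1 by (intro mult_left_mono nn_integral_annulus_le mono) auto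
  finally show ?thesis by (simp add: mult_ac)
qed

lemma nn_integral_omega_tilde_le:
  fixes M :: "real \<Rightarrow> ennreal"
  assumes M: "M \<in> borel_measurable (restrict_space borel {0..<1})"
    and mono: "\<And>r t. 0 \<le> r \<Longrightarrow> r \<le> t \<Longrightarrow> t < 1 \<Longrightarrow> M r \<le> M t"
  shows "(\<integral>\<^sup>+r\<in>{0..<1}. ennreal (omega_tilde \<omega> r) * M r \<partial>lborel)
    \<le> ennreal reg_const * (\<integral>\<^sup>+t\<in>{0..<1}. ennreal (\<omega> t) * M t \<partial>lborel)"
proof -
  define N where "N r = M r * indicator {0..<1} r" for r
  have N [measurable]: "N \<in> borel_measurable borel"
    using M by (simp add: N_def[abs_def] borel_measurable_restrict_space_iff_ennreal)
  note [measurable] = annulus_kernel_measurable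
  have "(\<integral>\<^sup>+r\<in>{0..<1}. ennreal (omega_tilde \<omega> r) * M r \<partial>lborel)
      \<le> (\<integral>\<^sup>+r. (\<integral>\<^sup>+t. annulus_kernel r t \<partial>lborel) * N r \<partial>lborel)"
    using omega_tilde_le_annulus_kernel
    by (intro nn_integral_mono) (auto simp: N_def indicator_def intro!: mult_right_mono)
  also have "\<dots> = (\<integral>\<^sup>+r. (\<integral>\<^sup>+t. annulus_kernel r t * N r \<partial>lborel) \<partial>lborel)"
    by (intro nn_integral_cong nn_integral_multc[symmetric]) measurable
  also have "\<dots> = (\<integral>\<^sup>+t. (\<integral>\<^sup>+r. annulus_kernel r t * N r \<partial>lborel) \<partial>lborel)"
    by (rule lborel_pair.Fubini'[symmetric]) measurable
  also have "\<dots> \<le> (\<integral>\<^sup>+t. ennreal reg_const * (ennreal (\<omega> t) * indicator {0..<1} t * N t) \<partial>lborel)"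
  proof (rule nn_integral_mono)
    fix t :: real
    show "(\<integral>\<^sup>+r. annulus_kernel r t * N r \<partial>lborel)
        \<le> ennreal reg_const * (ennreal (\<omega> t) * indicator {0..<1} t * N t)"
    proof (cases "t \<in> {0..<1}")
      case True
      then show ?thesis
        using nn_integral_annulus_kernel_le[of N t] mono by (simp add: N_def)
    qed (simp add: annulus_kernel_def)
  qed
  also have "\<dots> = ennreal reg_const * (\<integral>\<^sup>+t. ennreal (\<omega> t) * indicator {0..<1} t * N t \<partial>lborel)"
    using borel_measurable_times_ennreal[OF omega_indicator_measurable N] by (intro nn_integral_cmult) simp
  also have "(\<integral>\<^sup>+t. ennreal (\<omega> t) * indicator {0..<1} t * N t \<partial>lborel)
      = (\<integral>\<^sup>+t\<in>{0..<1}. ennreal (\<omega> t) * M t \<partial>lborel)"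
    by (intro nn_integral_cong) (auto simp: N_def indicator_def)
  finally show ?thesis .
qed

lemma Ap_int_omega_tilde_le:
  assumes p: "1 < p" and f: "f holomorphic_on disc"
  shows "Ap_int (omega_tilde \<omega>) p f \<le> ennreal reg_const * Ap_int \<omega> p f"
proof -
  define M where "M = (\<lambda>r. ennreal (r / pi) * circle_mean p f (of_real r))"
  have split: "ennreal (r * x / pi) * y = ennreal x * (ennreal (r / pi) * y)" if "0 \<le> r" for r x y
    using ennreal_mult'[of "r / pi" x] that by (simp add: mult_ac)
  have mean: "Ap_int w p f = (\<integral>\<^sup>+r\<in>{0..<1}. ennreal (w r) * M r \<partial>lborel)"
    if "w \<in> borel_measurable (restrict_space borel {0..<1})" for w
    unfolding Ap_int_polar[OF that holomorphic_on_disc_measurable[OF f]] M_def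
    by (intro nn_integral_cong) (simp add: split indicator_def)
  have "(\<lambda>r. ennreal (r / pi)) \<in> borel_measurable (restrict_space borel {0..<1::real})"
    by (intro measurable_restrict_space1) measurable
  then have M: "M \<in> borel_measurable (restrict_space borel {0..<1})"
    unfolding M_def
    by (intro borel_measurable_times_ennreal circle_mean_measurable holomorphic_on_disc_measurable f)
  have "M r \<le> M t" if "0 \<le> r" "r \<le> t" "t < 1" for r t
    unfolding M_def using that f
    by (intro mult_mono ennreal_leI divide_right_mono circle_mean_mono[OF _ p, of _ 1])
      (auto simp: disc_def)
  from nn_integral_omega_tilde_le[OF M this] show ?thesis
    by (simp add: mean omega_tilde_measurable omega_measurable_Ico)
qed

end

lemma weight_D_imp_regular_weight:
  assumes "weight_D \<omega>"
  obtains \<kappa> \<sigma> \<Lambda> where "regular_weight \<omega> \<kappa> \<sigma> \<Lambda>"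
proof -
  obtain \<kappa> where "1 \<le> \<kappa>" "\<forall>r\<in>{0..<1}. omega_hat \<omega> r \<le> \<kappa> * omega_hat \<omega> ((1 + r) / 2)"
    using assms by (auto simp: weight_D_def weight_Dhat_def)
  moreover obtain \<sigma> \<Lambda> where "1 < \<sigma>" "1 < \<Lambda>" "\<forall>r\<in>{0..<1}. \<Lambda> * omega_hat \<omega> (1 - (1 - r) / \<sigma>) \<le> omega_hat \<omega> r"
    using assms by (auto simp: weight_D_def)
  moreover have "radial_weight \<omega>"
    using assms by (simp add: weight_D_def weight_Dhat_def)
  ultimately have "regular_weight \<omega> \<kappa> \<sigma> \<Lambda>"
    by unfold_locales auto
  then show thesis by (rule that)
qed

section \<open>Test functions\<close>

lemma Jordan_sin_inequality:
  assumes "0 \<le> x" "x \<le> pi / 2"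
  shows "2 / pi * x \<le> sin x"
proof -
  have "concave_on {0..pi} sin"
  proof (rule f''_le0_imp_concave)
    show "(sin has_real_derivative cos x) (at x)" "(cos has_real_derivative - sin x) (at x)" for x :: real
      by (auto intro!: derivative_eq_intros)
  qed (auto simp: sin_ge_zero)
  from concave_onD[OF this, of "2 / pi * x" 0 "pi / 2"] show ?thesis
    using assms by (simp add: field_simps)
qed

lemma angle_near_0_if_cis_near_1:
  assumes \<theta>: "0 \<le> \<theta>" "\<theta> < 2 * pi" and near: "norm (1 - cis \<theta>) < 2 * h"
  shows "\<theta> \<in> {0..pi * h} \<union> {2 * pi - pi * h..2 * pi}"
proof -
  have "norm (1 - cis \<theta>) = 2 * \<bar>sin (\<theta> / 2)\<bar>"
    using dist_exp_i_1[of \<theta>] by (simp add: cis_conv_exp norm_minus_commute)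
  then have sin: "pi * sin (\<theta> / 2) < pi * h" using near by simp
  show ?thesis
  proof (cases "\<theta> \<le> pi")
    case True
    then have "\<theta> \<le> pi * sin (\<theta> / 2)"
      using Jordan_sin_inequality[of "\<theta> / 2"] \<theta> by (simp add: field_simps)
    then have "\<theta> < pi * h" using sin by linarith
    then show ?thesis using \<theta> by simp
  next
    case False
    then have "2 / pi * (pi - \<theta> / 2) \<le> sin (\<theta> / 2)"
      using Jordan_sin_inequality[of "pi - \<theta> / 2"] \<theta> by simp
    then have "2 * pi - \<theta> \<le> pi * sin (\<theta> / 2)"
      by (simp add: field_simps)
    then have "2 * pi - \<theta> < pi * h" using sin by linarith
    then show ?thesis using \<theta> by simp
  qed
qed

lemma emeasure_circle_near_1_le:
  assumes h: "0 < h"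
  shows "emeasure circle_measure {\<zeta>\<in>sphere 0 1. norm (1 - \<zeta>) < 2 * h} \<le> ennreal (2 * pi * h)"
proof -
  have "emeasure circle_measure {\<zeta>\<in>sphere 0 1. norm (1 - \<zeta>) < 2 * h}
      = (\<integral>\<^sup>+\<theta>\<in>{0..<2*pi}. indicator {\<zeta>\<in>sphere 0 1. norm (1 - \<zeta>) < 2 * h} (cis \<theta>) \<partial>lborel)"
    by (rule emeasure_circle_measure) (auto simp: sets_restrict_space_iff)
  also have "\<dots> \<le> (\<integral>\<^sup>+\<theta>. indicator ({0..pi * h} \<union> {2 * pi - pi * h..2 * pi}) \<theta> \<partial>lborel)"
    using angle_near_0_if_cis_near_1[of _ h] by (intro nn_integral_mono) (auto simp: indicator_def)
  also have "\<dots> \<le> emeasure lborel {0..pi * h} + emeasure lborel {2 * pi - pi * h..2 * pi}"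
    by (simp add: emeasure_subadditive)
  also have "\<dots> = ennreal (2 * pi * h)"
    using h by (simp add: mult_ac flip: ennreal_plus)
  finally show ?thesis .
qed

lemma emeasure_circle_near_le:
  assumes b: "norm b \<le> 1" and h: "0 < h"
  shows "emeasure circle_measure {\<zeta>\<in>sphere 0 1. norm (1 - b * \<zeta>) < h} \<le> ennreal (2 * pi * h)"
proof -
  obtain w where w: "norm w = 1" "b = of_real (norm b) * w"
    by (rule complex_polar_unit)
  define A where "A = {\<zeta>\<in>sphere (0::complex) 1. norm (1 - \<zeta>) < 2 * h}"
  define B where "B = {\<zeta>\<in>sphere (0::complex) 1. norm (1 - b * \<zeta>) < h}"
  have sets: "A \<in> sets circle_measure" "B \<in> sets circle_measure"
    by (auto simp: A_def B_def sets_restrict_space_iff)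
  have near: "w * \<zeta> \<in> A" if "\<zeta> \<in> B" for \<zeta>
  proof -
    have \<zeta>: "norm \<zeta> = 1" "norm (1 - b * \<zeta>) < h" using that by (auto simp: B_def)
    have "b * \<zeta> - w * \<zeta> = of_real (norm b - 1) * (w * \<zeta>)"
      by (subst w(2)) (simp add: algebra_simps)
    then have "norm (b * \<zeta> - w * \<zeta>) = 1 - norm b"
      using w(1) \<zeta> b by (simp add: norm_mult del: of_real_diff)
    moreover have "1 - norm b \<le> norm (1 - b * \<zeta>)"
      using norm_triangle_ineq2[of 1 "b * \<zeta>"] \<zeta> by (simp add: norm_mult)
    ultimately show ?thesis
      using norm_triangle_ineq[of "1 - b * \<zeta>" "b * \<zeta> - w * \<zeta>"] \<zeta> w(1) by (simp add: A_def norm_mult)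
  qed
  have "emeasure circle_measure B \<le> (\<integral>\<^sup>+\<zeta>. indicator A (w * \<zeta>) \<partial>circle_measure)"
    unfolding nn_integral_indicator[OF sets(2), symmetric]
    using near by (intro nn_integral_mono) (auto simp: indicator_def)
  also have "\<dots> = emeasure circle_measure A"
    using nn_integral_circle_rotate[OF _ w(1), of "indicator A"] sets by simp
  also have "\<dots> \<le> ennreal (2 * pi * h)"
    unfolding A_def by (rule emeasure_circle_near_1_le[OF h])
  finally show ?thesis by (simp add: B_def)
qed

lemma norm_one_minus_cnj_mult_ge:
  assumes "norm a < 1" "norm z < 1"
  shows "1 - norm a \<le> norm (1 - cnj a * z)" "1 - norm z \<le> norm (1 - cnj a * z)"
proof -
  have "1 - norm a * norm z \<le> norm (1 - cnj a * z)"
    using norm_triangle_ineq2[of 1 "cnj a * z"] by (simp add: norm_mult)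
  moreover have "norm a * norm z \<le> norm a" "norm a * norm z \<le> norm z"
    using assms by (auto intro!: mult_left_le mult_left_le_one_le)
  ultimately show "1 - norm a \<le> norm (1 - cnj a * z)" "1 - norm z \<le> norm (1 - cnj a * z)"
    by linarith+
qed

lemma norm_one_minus_cnj_mult_pos:
  assumes "norm a < 1" "norm z < 1"
  shows "0 < norm (1 - cnj a * z)"
  using norm_one_minus_cnj_mult_ge(1)[OF assms] assms(1) by linarith

definition boundary_nbhd :: "complex \<Rightarrow> real \<Rightarrow> complex set" where
  "boundary_nbhd a h = {z\<in>disc. norm (1 - cnj a * z) < h}"

lemma boundary_nbhd_sets: "boundary_nbhd a h \<in> sets (restrict_space borel disc)"
  by (auto simp: boundary_nbhd_def sets_restrict_space_iff)

lemma nn_integral_circle_boundary_nbhd_le: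
  assumes a: "norm a < 1" and h: "0 < h" and r: "0 \<le> r" "r < 1"
  shows "(\<integral>\<^sup>+\<zeta>. indicator (boundary_nbhd a h) (of_real r * \<zeta>) \<partial>circle_measure)
    \<le> ennreal (2 * pi * h) * indicator {1 - h..1} r"
proof (cases "1 - h \<le> r")
  case True
  define A where "A = {\<zeta>\<in>sphere 0 1. norm (1 - (cnj a * of_real r) * \<zeta>) < h}"
  have "(\<integral>\<^sup>+\<zeta>. indicator (boundary_nbhd a h) (of_real r * \<zeta>) \<partial>circle_measure)
      \<le> (\<integral>\<^sup>+\<zeta>. indicator A \<zeta> \<partial>circle_measure)"
    by (intro nn_integral_mono) (auto simp: indicator_def boundary_nbhd_def A_def mult.assoc)
  also have "\<dots> = emeasure circle_measure A"
    by (intro nn_integral_indicator) (auto simp: A_def sets_restrict_space_iff)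
  also have "\<dots> \<le> ennreal (2 * pi * h)"
    unfolding A_def using a r h mult_left_le[of r "norm a"]
    by (intro emeasure_circle_near_le) (auto simp: norm_mult)
  finally show ?thesis using True r by simp
next
  case False
  have "of_real r * \<zeta> \<notin> boundary_nbhd a h" if "norm \<zeta> = 1" for \<zeta>
    using norm_one_minus_cnj_mult_ge(2)[OF a, of "of_real r * \<zeta>"] that False r
    by (auto simp: boundary_nbhd_def norm_mult)
  then have "(\<integral>\<^sup>+\<zeta>. indicator (boundary_nbhd a h) (of_real r * \<zeta>) \<partial>circle_measure)
      = (\<integral>\<^sup>+\<zeta>. 0 \<partial>circle_measure)"
    by (intro nn_integral_cong) (simp add: indicator_def)
  then show ?thesis by simp
qed

lemma (in disc_weight) emeasure_boundary_nbhd_le: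
  assumes a: "norm a < 1" and h: "0 < h"
  shows "emeasure (bergman_measure \<omega>) (boundary_nbhd a h) \<le> ennreal (2 * h * omega_hat \<omega> (max 0 (1 - h)))"
proof -
  define R where "R = max 0 (1 - h)"
  have "emeasure (bergman_measure \<omega>) (boundary_nbhd a h)
      = (\<integral>\<^sup>+r\<in>{0..<1}. ennreal (r * \<omega> r / pi)
          * (\<integral>\<^sup>+\<zeta>. indicator (boundary_nbhd a h) (of_real r * \<zeta>) \<partial>circle_measure) \<partial>lborel)"
    using boundary_nbhd_sets[of a h] nn_integral_bergman_measure[OF omega_measurable_Ico, of
      "indicator (boundary_nbhd a h)"]
    by simp
  also have "\<dots> \<le> (\<integral>\<^sup>+r\<in>{R..1}. ennreal (2 * h) * ennreal (\<omega> r) \<partial>lborel)"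
  proof (rule nn_integral_mono)
    fix r :: real
    have "ennreal (r * \<omega> r / pi) * ennreal (2 * pi * h) \<le> ennreal (2 * h) * ennreal (\<omega> r)" if "r \<in> {0..<1}"
    proof -
      have "ennreal (r * \<omega> r / pi) * ennreal (2 * pi * h) = ennreal (2 * h * (r * \<omega> r))"
        using h by (subst ennreal_mult''[symmetric]) (auto simp: mult_ac)
      also have "\<dots> \<le> ennreal (2 * h * \<omega> r)"
        using that h omega_nonneg[of r]
        by (intro ennreal_leI mult_left_mono) (auto simp: mult_left_le_one_le)
      also have "\<dots> = ennreal (2 * h) * ennreal (\<omega> r)"
        using h by (intro ennreal_mult') simp
      finally show ?thesis .
    qed
    then show "ennreal (r * \<omega> r / pi)
          * (\<integral>\<^sup>+\<zeta>. indicator (boundary_nbhd a h) (of_real r * \<zeta>) \<partial>circle_measure) * indicator {0..<1} r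
        \<le> ennreal (2 * h) * ennreal (\<omega> r) * indicator {R..1} r"
      using nn_integral_circle_boundary_nbhd_le[OF a h, of r]
      by (auto simp: R_def indicator_def split: if_splits intro: order_trans[OF mult_left_mono])
  qed
  also have "\<dots> = ennreal (2 * h) * (\<integral>\<^sup>+r\<in>{R..1}. ennreal (\<omega> r) \<partial>lborel)"
  proof -
    have "(\<lambda>r. ennreal (\<omega> r)) \<in> borel_measurable (restrict_space borel {R..1})"
      by (rule measurable_compose[OF omega_measurable measurable_ennreal]) (simp add: R_def)
    then show ?thesis
      by (simp add: borel_measurable_restrict_space_iff_ennreal mult.assoc nn_integral_cmult)
  qed
  also have "\<dots> = ennreal (2 * h * omega_hat \<omega> R)"
    using h by (simp add: nn_integral_omega R_def flip: ennreal_mult')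
  finally show ?thesis by (simp add: R_def)
qed

definition peak_fun :: "complex \<Rightarrow> complex \<Rightarrow> complex" where
  "peak_fun a z = of_real (1 - (norm a)\<^sup>2) / (1 - cnj a * z)"

lemma norm_peak_fun:
  assumes "norm a < 1"
  shows "norm (peak_fun a z) = (1 + norm a) * (1 - norm a) / norm (1 - cnj a * z)"
proof -
  have "(norm a)\<^sup>2 \<le> 1" using assms by (simp add: power_le_one)
  then have "norm (peak_fun a z) = (1 - (norm a)\<^sup>2) / norm (1 - cnj a * z)"
    unfolding peak_fun_def norm_divide norm_of_real by simp
  then show ?thesis by (simp add: algebra_simps power2_eq_square)
qed

lemma norm_peak_fun_le:
  assumes "norm a < 1" "norm z < 1"
  shows "norm (peak_fun a z) \<le> 2 * (1 - norm a) / norm (1 - cnj a * z)" "norm (peak_fun a z) \<le> 2"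
proof -
  show "norm (peak_fun a z) \<le> 2 * (1 - norm a) / norm (1 - cnj a * z)"
    unfolding norm_peak_fun[OF assms(1)] using assms by (intro divide_right_mono mult_right_mono) auto
  also have "\<dots> \<le> 2 * (1 - norm a) / (1 - norm a)"
    using norm_one_minus_cnj_mult_ge(1)[OF assms] norm_one_minus_cnj_mult_pos[OF assms] assms
    by (intro divide_left_mono) auto
  also have "\<dots> = 2" using assms by (simp add: field_simps)
  finally show "norm (peak_fun a z) \<le> 2" .
qed

lemma norm_peak_fun_ge:
  assumes a: "norm a < 1" and z: "dist a z < (1 - norm a) / 2"
  shows "2/3 \<le> norm (peak_fun a z)"
proof -
  define D where "D = (1 + norm a) * (1 - norm a)"
  have "of_real (1 - (norm a)\<^sup>2) = 1 - cnj a * a"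
    by (simp only: of_real_diff of_real_1 complex_norm_square mult.commute)
  then have "1 - cnj a * z = of_real (1 - (norm a)\<^sup>2) + cnj a * (a - z)"
    by (simp add: algebra_simps)
  also have "1 - (norm a)\<^sup>2 = D"
    by (simp add: D_def algebra_simps power2_eq_square)
  finally have "norm (1 - cnj a * z) \<le> norm (of_real D :: complex) + norm (cnj a * (a - z))"
    by (metis norm_triangle_ineq)
  also have "norm (of_real D :: complex) = D"
    unfolding norm_of_real using a by (simp add: D_def)
  also have "norm (cnj a * (a - z)) = norm a * dist a z"
    by (simp add: norm_mult dist_norm)
  also have "D + norm a * dist a z \<le> D + 1 * ((1 - norm a) / 2)"
    using a z by (intro add_left_mono mult_mono) auto
  also have "(1 - norm a) \<le> D"
    using a mult_right_mono[of 1 "1 + norm a" "1 - norm a"] by (simp add: D_def)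
  finally have "norm (1 - cnj a * z) \<le> 3/2 * D" by simp
  moreover have "norm z < 1"
    using norm_triangle_sub[of z a] z a by (simp add: dist_norm norm_minus_commute)
  ultimately show ?thesis
    using norm_one_minus_cnj_mult_pos[OF a, of z] by (simp add: norm_peak_fun[OF a] D_def pos_le_divide_eq)
qed

lemma peak_fun_power_holomorphic:
  assumes a: "norm a < 1"
  shows "(\<lambda>z. peak_fun a z ^ n) holomorphic_on disc"
proof -
  have "1 - cnj a * z \<noteq> 0" if "z \<in> disc" for z
    using norm_one_minus_cnj_mult_pos[OF a, of z] that by (auto simp: mem_disc_iff)
  then show ?thesis unfolding peak_fun_def by (intro holomorphic_intros) auto
qed

lemma deriv_peak_fun_power:
  assumes a: "norm a < 1" and z: "norm z < 1"
  shows "deriv (\<lambda>z. peak_fun a z ^ n) z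
    = of_nat n * (cnj a / of_real (1 - (norm a)\<^sup>2)) * peak_fun a z ^ Suc n"
proof -
  define D :: complex where "D = of_real (1 - (norm a)\<^sup>2)"
  have "(norm a)\<^sup>2 < 1" using a by (simp add: power_less_one_iff abs_square_less_1)
  then have D: "D \<noteq> 0" unfolding D_def of_real_eq_0_iff by simp
  have nz: "1 - cnj a * z \<noteq> 0" using norm_one_minus_cnj_mult_pos[OF a z] by auto
  have "((\<lambda>z. (D / (1 - cnj a * z)) ^ n) has_field_derivative
      of_nat n * (D / (1 - cnj a * z)) ^ (n - 1) * (D * cnj a / (1 - cnj a * z)\<^sup>2)) (at z)"
    using nz by (auto intro!: derivative_eq_intros simp: power2_eq_square)
  then have "deriv (\<lambda>z. peak_fun a z ^ n) z
      = of_nat n * (D / (1 - cnj a * z)) ^ (n - 1) * (D * cnj a / (1 - cnj a * z)\<^sup>2)"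
    unfolding peak_fun_def D_def by (rule DERIV_imp_deriv)
  also have "D * cnj a / (1 - cnj a * z)\<^sup>2 = (cnj a / D) * (D / (1 - cnj a * z))\<^sup>2"
    using D by (simp add: power2_eq_square)
  also have "of_nat n * (D / (1 - cnj a * z)) ^ (n - 1) * ((cnj a / D) * (D / (1 - cnj a * z))\<^sup>2)
      = of_nat n * (cnj a / D) * (D / (1 - cnj a * z)) ^ Suc n"
    by (cases n) (simp_all add: power2_eq_square)
  finally show ?thesis unfolding peak_fun_def D_def .
qed

lemma norm_peak_fun_powr_le_dyadic:
  assumes a: "norm a < 1" and z: "z \<in> disc" and s: "0 \<le> s"
  shows "ennreal (norm (peak_fun a z) powr s)
    \<le> (\<Sum>j. ennreal ((4 / 2 ^ j) powr s) * indicator (boundary_nbhd a (2 ^ j * (1 - norm a))) z)"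
proof -
  define \<delta> where "\<delta> = 1 - norm a"
  define N where "N = norm (1 - cnj a * z)"
  have \<delta>: "0 < \<delta>" "\<delta> \<le> N"
    using norm_one_minus_cnj_mult_ge(1)[OF a] z a by (auto simp: \<delta>_def N_def mem_disc_iff)
  have "\<exists>n. N < 2 ^ n * \<delta>"
    using real_arch_pow[of 2 "N / \<delta>"] \<delta> by (auto simp: field_simps)
  moreover have "\<not> N < 2 ^ 0 * \<delta>" using \<delta> by simp
  ultimately obtain i where i: "\<not> N < 2 ^ i * \<delta>" "N < 2 ^ Suc i * \<delta>"
    using ex_least_nat_less[of "\<lambda>n. N < 2 ^ n * \<delta>"] by blast
  have "norm (peak_fun a z) \<le> 2 * \<delta> / N"
    using norm_peak_fun_le(1)[OF a] z by (simp add: \<delta>_def N_def mem_disc_iff)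
  also have "\<dots> \<le> 4 / 2 ^ Suc i"
    using i(1) \<delta> by (simp add: field_simps)
  finally have "norm (peak_fun a z) powr s \<le> (4 / 2 ^ Suc i) powr s"
    using s by (intro powr_mono2) auto
  then have "ennreal (norm (peak_fun a z) powr s)
      \<le> (\<Sum>j\<in>{Suc i}. ennreal ((4 / 2 ^ j) powr s) * indicator (boundary_nbhd a (2 ^ j * \<delta>)) z)"
    using z i(2) by (simp add: boundary_nbhd_def N_def ennreal_leI)
  also have "\<dots> \<le> (\<Sum>j. ennreal ((4 / 2 ^ j) powr s) * indicator (boundary_nbhd a (2 ^ j * \<delta>)) z)"
    by (rule sum_le_suminf) auto
  finally show ?thesis by (simp add: \<delta>_def)
qed

lemma dyadic_power_le:
  fixes s x :: real
  assumes "0 \<le> x" "2 * x \<le> 2 powr s"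
  shows "(4 / 2 ^ j) powr s * x ^ j \<le> 4 powr s * (1/2) ^ j"
proof -
  have "(x * 2) ^ j \<le> (2 powr s) ^ j"
    using assms by (intro power_mono) auto
  also have "(2 powr s) ^ j = (2 ^ j) powr s"
    by (simp add: powr_powr mult.commute flip: powr_realpow)
  finally have "x ^ j / (2 ^ j) powr s \<le> (1/2) ^ j"
    unfolding power_mult_distrib by (simp add: power_one_over field_simps)
  then have "4 powr s * (x ^ j / (2 ^ j) powr s) \<le> 4 powr s * (1/2) ^ j"
    by (intro mult_left_mono) auto
  then show ?thesis by (simp add: powr_divide)
qed

context doubling_weight
begin

lemma emeasure_dyadic_nbhd_le:
  assumes a: "norm a < 1"
  shows "emeasure (bergman_measure \<omega>) (boundary_nbhd a (2 ^ j * (1 - norm a)))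
    \<le> ennreal (2 * (2 * \<kappa>) ^ j * (omega_hat \<omega> (norm a) * (1 - norm a)))"
proof -
  define h where "h = 2 ^ j * (1 - norm a)"
  have h: "0 < h" using a by (simp add: h_def)
  have "emeasure (bergman_measure \<omega>) (boundary_nbhd a h) \<le> ennreal (2 * h * omega_hat \<omega> (max 0 (1 - h)))"
    by (rule emeasure_boundary_nbhd_le[OF a h])
  also have "\<dots> \<le> ennreal (2 * h * (\<kappa> ^ j * omega_hat \<omega> (norm a)))"
    using h a by (intro ennreal_leI mult_left_mono omega_hat_le_scale) (auto simp: h_def)
  also have "2 * h * (\<kappa> ^ j * omega_hat \<omega> (norm a))
      = 2 * (2 * \<kappa>) ^ j * (omega_hat \<omega> (norm a) * (1 - norm a))"
    by (simp add: h_def power_mult_distrib)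
  finally show ?thesis by (simp add: h_def)
qed

lemma suminf_dyadic_nbhd_le:
  assumes s: "log 2 \<kappa> + 2 \<le> s" and a: "norm a < 1"
  shows "(\<Sum>j. ennreal ((4 / 2 ^ j) powr s)
      * emeasure (bergman_measure \<omega>) (boundary_nbhd a (2 ^ j * (1 - norm a))))
    \<le> ennreal (4 powr (s + 1) * (omega_hat \<omega> (norm a) * (1 - norm a)))"
proof -
  define W where "W = omega_hat \<omega> (norm a) * (1 - norm a)"
  have W: "0 \<le> W" using a by (simp add: W_def omega_hat_nonneg)
  have "2 powr (log 2 \<kappa> + 2) \<le> 2 powr s" using s by (intro powr_mono) auto
  then have s: "4 * \<kappa> \<le> 2 powr s" using kappa_ge_1 by (simp add: powr_add)
  have "(\<Sum>j. ennreal ((4 / 2 ^ j) powr s)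
      * emeasure (bergman_measure \<omega>) (boundary_nbhd a (2 ^ j * (1 - norm a))))
      \<le> (\<Sum>j. ennreal (2 * 4 powr s * W * (1/2) ^ j))"
  proof (intro suminf_le allI)
    fix j
    have "ennreal ((4 / 2 ^ j) powr s)
        * emeasure (bergman_measure \<omega>) (boundary_nbhd a (2 ^ j * (1 - norm a)))
        \<le> ennreal ((4 / 2 ^ j) powr s) * ennreal (2 * (2 * \<kappa>) ^ j * W)"
      unfolding W_def by (intro mult_left_mono emeasure_dyadic_nbhd_le a) simp
    also have "\<dots> = ennreal ((4 / 2 ^ j) powr s * (2 * \<kappa>) ^ j * (2 * W))"
      by (simp add: mult_ac flip: ennreal_mult')
    also have "\<dots> \<le> ennreal (4 powr s * (1/2) ^ j * (2 * W))"
      using W s kappa_ge_1 by (intro ennreal_leI mult_right_mono dyadic_power_le) auto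
    also have "4 powr s * (1/2) ^ j * (2 * W) = 2 * 4 powr s * W * (1/2) ^ j"
      by simp
    finally show "ennreal ((4 / 2 ^ j) powr s)
        * emeasure (bergman_measure \<omega>) (boundary_nbhd a (2 ^ j * (1 - norm a)))
        \<le> ennreal (2 * 4 powr s * W * (1/2) ^ j)" .
  qed auto
  also have "\<dots> = ennreal (2 * 4 powr s * W * 2)"
    using W geometric_sums[of "1/2 :: real"]
    by (intro suminf_ennreal_eq sums_mult) auto
  finally show ?thesis by (simp add: W_def powr_add mult_ac)
qed

lemma Ap_int_peak_fun_power_le:
  assumes n: "log 2 \<kappa> + 2 \<le> n * p" and a: "norm a < 1"
  shows "Ap_int \<omega> p (\<lambda>z. peak_fun a z ^ n)
      \<le> ennreal (4 powr (n * p + 1) * (omega_hat \<omega> (norm a) * (1 - norm a)))"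
proof -
  define E where "E j = boundary_nbhd a (2 ^ j * (1 - norm a))" for j :: nat
  have E: "E j \<in> sets (bergman_measure \<omega>)" for j
    by (simp add: E_def boundary_nbhd_sets)
  have "0 \<le> log 2 \<kappa>" using kappa_ge_1 by simp
  with n have np: "0 < n * p" by linarith
  then have power: "norm (peak_fun a z ^ n) powr p = norm (peak_fun a z) powr (n * p)" for z
    by (cases "n = 0") (simp_all add: norm_power powr_powr flip: powr_realpow')
  have "Ap_int \<omega> p (\<lambda>z. peak_fun a z ^ n)
      = (\<integral>\<^sup>+z. ennreal (norm (peak_fun a z) powr (n * p)) \<partial>bergman_measure \<omega>)"
    using Ap_int_eq_nn_integral[OF omega_measurable_Ico
        holomorphic_on_disc_measurable[OF peak_fun_power_holomorphic[OF a]]]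
    by (simp add: power)
  also have "\<dots> \<le> (\<integral>\<^sup>+z. (\<Sum>j. ennreal ((4 / 2 ^ j) powr (n * p)) * indicator (E j) z) \<partial>bergman_measure \<omega>)"
    unfolding E_def using norm_peak_fun_powr_le_dyadic[OF a] np by (intro nn_integral_mono) simp
  also have "\<dots> = (\<Sum>j. ennreal ((4 / 2 ^ j) powr (n * p)) * emeasure (bergman_measure \<omega>) (E j))"
    using E by (simp add: nn_integral_suminf nn_integral_cmult_indicator)
  also have "\<dots> \<le> ennreal (4 powr (n * p + 1) * (omega_hat \<omega> (norm a) * (1 - norm a)))"
    unfolding E_def by (rule suminf_dyadic_nbhd_le[OF n a])
  finally show ?thesis .
qed

end

locale bergman_doubling = doubling_weight +
  fixes p :: real
  assumes p_gt_1: "1 < p"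
begin

lemma p_pos: "0 < p"
  using p_gt_1 by simp

definition test_exponent :: nat where
  "test_exponent = nat \<lceil>(log 2 \<kappa> + 2) / p\<rceil>"

definition test_const :: real where
  "test_const = 4 powr ((test_exponent + 2) * p + 1)"

definition test_fun :: "nat \<Rightarrow> complex \<Rightarrow> complex \<Rightarrow> complex" where
  "test_fun j a z = of_real ((test_const * (omega_hat \<omega> (norm a) * (1 - norm a))) powr (- 1 / p))
     * peak_fun a z ^ (test_exponent + j)"

lemma test_const_pos: "0 < test_const"
  by (simp add: test_const_def)

lemma test_exponent_ge: "log 2 \<kappa> + 2 \<le> (test_exponent + j) * p"
proof -
  have "(log 2 \<kappa> + 2) / p \<le> test_exponent + j"
    unfolding test_exponent_def by linarith
  then show ?thesis using p_pos by (simp add: field_simps)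
qed

lemma test_fun_holomorphic: "norm a < 1 \<Longrightarrow> test_fun j a holomorphic_on disc"
  unfolding test_fun_def[abs_def] by (intro holomorphic_intros peak_fun_power_holomorphic)

lemma Ap_int_cmult:
  assumes "f holomorphic_on disc"
  shows "Ap_int \<omega> p (\<lambda>z. c * f z) = ennreal (norm c powr p) * Ap_int \<omega> p f"
proof -
  have f: "f \<in> borel_measurable (restrict_space borel disc)"
    "(\<lambda>z. c * f z) \<in> borel_measurable (restrict_space borel disc)"
    using assms by (auto intro!: holomorphic_on_disc_measurable holomorphic_intros)
  then have "f \<in> borel_measurable (bergman_measure \<omega>)"
    by (simp add: measurable_cong_sets[OF sets_bergman_measure refl])
  then show ?thesis
    by (simp add: Ap_int_eq_nn_integral[OF omega_measurable_Ico] f norm_mult powr_mult ennreal_mult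
      nn_integral_cmult)
qed

lemma Ap_int_test_fun_le:
  assumes j: "j \<le> 2" and a: "norm a < 1"
  shows "Ap_int \<omega> p (test_fun j a) \<le> 1"
proof -
  define W where "W = omega_hat \<omega> (norm a) * (1 - norm a)"
  have W: "0 < W" using a by (simp add: W_def omega_hat_pos)
  have "Ap_int \<omega> p (\<lambda>z. peak_fun a z ^ (test_exponent + j))
      \<le> ennreal (4 powr ((test_exponent + j) * p + 1) * W)"
    unfolding W_def by (rule Ap_int_peak_fun_power_le[OF test_exponent_ge a])
  also have "\<dots> \<le> ennreal (test_const * W)"
    unfolding test_const_def using W j p_pos by (intro ennreal_leI mult_right_mono powr_mono) auto
  finally have "Ap_int \<omega> p (\<lambda>z. peak_fun a z ^ (test_exponent + j)) \<le> ennreal (test_const * W)" .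
  moreover have "((test_const * W) powr (- 1 / p)) powr p = 1 / (test_const * W)"
    unfolding powr_powr using p_pos W test_const_pos by (simp add: powr_minus_divide)
  then have "Ap_int \<omega> p (test_fun j a)
      = ennreal (1 / (test_const * W)) * Ap_int \<omega> p (\<lambda>z. peak_fun a z ^ (test_exponent + j))"
    unfolding test_fun_def[abs_def] W_def[symmetric]
    by (simp add: Ap_int_cmult peak_fun_power_holomorphic a)
  ultimately have "Ap_int \<omega> p (test_fun j a) \<le> ennreal (1 / (test_const * W)) * ennreal (test_const * W)"
    by (simp add: mult_left_mono)
  also have "\<dots> = 1" using W test_const_pos by (simp flip: ennreal_mult')
  finally show ?thesis .
qed

lemma norm_test_fun_le:
  assumes a: "norm a < 1" and z: "norm z < 1"
  shows "norm (test_fun j a z) \<le> (test_const * omega_hat \<omega> 0 / \<kappa>) powr (- 1 / p)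
    * (2 / (1 - norm z)) ^ (test_exponent + j) * (1 - norm a) powr (1 / p)"
proof -
  define \<delta> where "\<delta> = 1 - norm a"
  define n where "n = test_exponent + j"
  define e where "e = (log 2 \<kappa> + 1) / p"
  have \<delta>: "0 < \<delta>" "\<delta> \<le> 1" using a by (auto simp: \<delta>_def)
  have "omega_hat \<omega> 0 \<le> \<kappa> * (1 / \<delta>) powr log 2 \<kappa> * omega_hat \<omega> (norm a)"
    using omega_hat_le_powr[of 0 "norm a"] a by (simp add: \<delta>_def)
  then have "test_const * omega_hat \<omega> 0 / \<kappa> * \<delta> powr (log 2 \<kappa> + 1)
      \<le> test_const * (omega_hat \<omega> (norm a) * \<delta>)"
    using \<delta> kappa_ge_1 test_const_pos by (simp add: powr_add powr_divide field_simps)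
  then have "(test_const * (omega_hat \<omega> (norm a) * \<delta>)) powr (- 1 / p)
      \<le> (test_const * omega_hat \<omega> 0 / \<kappa> * \<delta> powr (log 2 \<kappa> + 1)) powr (- 1 / p)"
    using \<delta> kappa_ge_1 test_const_pos p_pos omega_hat_pos[of 0] by (intro powr_mono2') auto
  also have "\<dots> = (test_const * omega_hat \<omega> 0 / \<kappa>) powr (- 1 / p) * \<delta> powr - e"
    unfolding powr_mult[of _ "\<delta> powr (log 2 \<kappa> + 1)"] powr_powr by (simp add: e_def)
  finally have factor: "(test_const * (omega_hat \<omega> (norm a) * \<delta>)) powr (- 1 / p)
      \<le> (test_const * omega_hat \<omega> 0 / \<kappa>) powr (- 1 / p) * \<delta> powr - e" .
  have "norm (peak_fun a z) \<le> 2 * \<delta> / norm (1 - cnj a * z)"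
    using norm_peak_fun_le(1)[OF a z] by (simp add: \<delta>_def)
  also have "\<dots> \<le> 2 * \<delta> / (1 - norm z)"
    using norm_one_minus_cnj_mult_ge(2)[OF a z] z \<delta> by (intro divide_left_mono mult_pos_pos) auto
  finally have "norm (peak_fun a z) ^ n \<le> (2 / (1 - norm z) * \<delta>) ^ n"
    by (intro power_mono) simp_all
  also have "\<dots> = (2 / (1 - norm z)) ^ n * \<delta> powr n"
    by (simp only: power_mult_distrib powr_realpow[OF \<delta>(1)])
  finally have "norm (test_fun j a z)
      \<le> ((test_const * omega_hat \<omega> 0 / \<kappa>) powr (- 1 / p) * \<delta> powr - e)
        * ((2 / (1 - norm z)) ^ n * \<delta> powr n)"
    using factor unfolding test_fun_def \<delta>_def[symmetric] n_def[symmetric] norm_mult norm_power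
    by (intro mult_mono) auto
  also have "\<dots> = (test_const * omega_hat \<omega> 0 / \<kappa>) powr (- 1 / p) * (2 / (1 - norm z)) ^ n
      * \<delta> powr (n - e)"
    by (simp add: powr_diff powr_minus divide_inverse mult_ac)
  also have "\<delta> powr (n - e) \<le> \<delta> powr (1 / p)"
    using test_exponent_ge[of j] \<delta> p_pos by (intro powr_mono') (auto simp: n_def e_def field_simps)
  finally show ?thesis
    using z by (simp add: \<delta>_def n_def mult_left_mono)
qed

lemma test_fun_tendsto_0:
  assumes a: "\<And>i. norm (a i) < 1" "(\<lambda>i. norm (a i)) \<longlonglongrightarrow> 1" and z: "z \<in> disc"
  shows "(\<lambda>i. test_fun j (a i) z) \<longlonglongrightarrow> 0"
proof (rule Lim_null_comparison)
  define C where "C = (test_const * omega_hat \<omega> 0 / \<kappa>) powr (- 1 / p)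
      * (2 / (1 - norm z)) ^ (test_exponent + j)"
  show "\<forall>\<^sub>F i in sequentially. norm (test_fun j (a i) z) \<le> C * (1 - norm (a i)) powr (1 / p)"
    unfolding C_def using z a(1)
    by (intro always_eventually allI norm_test_fun_le) (auto simp: mem_disc_iff)
  have "(\<lambda>i. C * (1 - norm (a i)) powr (1 / p)) \<longlonglongrightarrow> C * (1 - 1) powr (1 / p)"
    using a p_pos by (intro tendsto_intros) (auto intro!: always_eventually less_imp_le)
  then show "(\<lambda>i. C * (1 - norm (a i)) powr (1 / p)) \<longlonglongrightarrow> 0"
    by simp
qed

end

section \<open>Derivatives and the Carleson embedding\<close>

lemma norm_near_disc:
  fixes w z :: complex
  assumes "dist w z < (1 - norm w) / 4"
  shows "3/4 * (1 - norm w) < 1 - norm z" "1 - norm z < 5/4 * (1 - norm w)"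
    and "dist z w < (1 - norm z) / 2"
proof -
  have "\<bar>norm w - norm z\<bar> \<le> dist w z" unfolding dist_norm by (rule norm_triangle_ineq3)
  then show bounds: "3/4 * (1 - norm w) < 1 - norm z" "1 - norm z < 5/4 * (1 - norm w)" using assms by auto
  have "0 < (1 - norm w) / 4" by (rule le_less_trans[OF zero_le_dist assms])
  then show "dist z w < (1 - norm z) / 2" using bounds assms by (simp add: dist_commute)
qed

lemma ball_subset_disc:
  assumes "d \<le> 1 - norm w"
  shows "ball w d \<subseteq> disc"
proof
  fix z assume "z \<in> ball w d"
  then show "z \<in> disc"
    using norm_triangle_sub[of z w] assms by (simp add: mem_disc_iff dist_norm norm_minus_commute)
qed

lemma disc_id_measurable: "(\<lambda>z. z) \<in> borel_measurable (restrict_space borel disc)"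
  by (rule measurable_restrict_space1) simp

context bergman_doubling
begin

definition eval_gauge :: "nat \<Rightarrow> real \<Rightarrow> real" where
  "eval_gauge k r = (1 - r) powr (k * p) * (omega_hat \<omega> r * (1 - r))"

definition gauge_const :: "nat \<Rightarrow> real" where
  "gauge_const k = (5/4) powr (k * p) * (\<kappa> * (5/4))"

lemma eval_gauge_pos: "0 \<le> r \<Longrightarrow> r < 1 \<Longrightarrow> 0 < eval_gauge k r"
  by (simp add: eval_gauge_def omega_hat_pos)

lemma gauge_const_pos: "0 < gauge_const k"
  using kappa_ge_1 by (simp add: gauge_const_def)

lemma eval_gauge_antimono:
  assumes "0 \<le> r" "r \<le> s" "s < 1"
  shows "eval_gauge k s \<le> eval_gauge k r"
  unfolding eval_gauge_def using assms p_pos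
  by (intro mult_mono powr_mono2 omega_hat_antimono mult_nonneg_nonneg omega_hat_nonneg) auto

lemma eval_gauge_le:
  assumes "0 \<le> r" "r < 1" "0 \<le> s" "s < 1" "1 - r \<le> 5/4 * (1 - s)"
  shows "eval_gauge k r \<le> gauge_const k * eval_gauge k s"
proof -
  have "omega_hat \<omega> r \<le> \<kappa> * omega_hat \<omega> s"
    using omega_hat_le_scale[of r s 1] assms by simp
  then have hat: "omega_hat \<omega> r * (1 - r) \<le> (\<kappa> * omega_hat \<omega> s) * (5/4 * (1 - s))"
    using assms kappa_ge_1 by (intro mult_mono) (auto simp: omega_hat_nonneg)
  have "(1 - r) powr (k * p) \<le> (5/4 * (1 - s)) powr (k * p)"
    using assms p_pos by (intro powr_mono2) auto
  also have "\<dots> = (5/4) powr (k * p) * (1 - s) powr (k * p)"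
    by (rule powr_mult)
  finally have "eval_gauge k r
      \<le> ((5/4) powr (k * p) * (1 - s) powr (k * p)) * ((\<kappa> * omega_hat \<omega> s) * (5/4 * (1 - s)))"
    unfolding eval_gauge_def using hat by (rule mult_mono) (use assms in \<open>auto simp: omega_hat_nonneg\<close>)
  then show ?thesis
    by (simp only: eval_gauge_def gauge_const_def mult_ac)
qed

lemma eval_gauge_measurable: "eval_gauge k \<in> borel_measurable (restrict_space borel {0..<1})"
proof -
  have "omega_hat \<omega> \<in> borel_measurable (restrict_space borel {0..<1})"
    by (rule measurable_restrict_mono[OF omega_hat_measurable]) auto
  moreover have "(\<lambda>r. (1 - r) powr (k * p)) \<in> borel_measurable (restrict_space borel {0..<1})"
    "(\<lambda>r::real. 1 - r) \<in> borel_measurable (restrict_space borel {0..<1})"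
    by (intro measurable_restrict_space1; measurable)+
  ultimately show ?thesis
    unfolding eval_gauge_def[abs_def] by (intro borel_measurable_times)
qed

definition tilde_mass :: "(complex \<Rightarrow> complex) \<Rightarrow> complex measure" where
  "tilde_mass f = density (bergman_measure (omega_tilde \<omega>)) (\<lambda>z. ennreal (norm (f z) powr p))"

lemma sets_tilde_mass [simp, measurable_cong]: "sets (tilde_mass f) = sets (restrict_space borel disc)"
  by (simp add: tilde_mass_def)

lemma space_tilde_mass [simp]: "space (tilde_mass f) = disc"
  by (simp add: tilde_mass_def)

lemma emeasure_tilde_mass:
  assumes f: "f holomorphic_on disc" and A: "A \<in> sets (restrict_space borel disc)"
  shows "emeasure (tilde_mass f) A
    = (\<integral>\<^sup>+z\<in>A. ennreal (omega_tilde \<omega> (norm z) / pi) * ennreal (norm (f z) powr p) \<partial>lborel)"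
proof -
  have f_powr: "(\<lambda>z. ennreal (norm (f z) powr p)) \<in> borel_measurable (restrict_space borel disc)"
    by (intro borel_measurable_norm_powr holomorphic_on_disc_measurable f)
  have "A \<subseteq> disc" using A by (simp add: sets_restrict_space_iff)
  have "emeasure (tilde_mass f) A = (\<integral>\<^sup>+z\<in>A. ennreal (norm (f z) powr p) \<partial>bergman_measure (omega_tilde \<omega>))"
    unfolding tilde_mass_def using f_powr A
    by (intro emeasure_density) (simp_all add: measurable_cong_sets[OF sets_bergman_measure refl])
  also have "\<dots> = (\<integral>\<^sup>+z\<in>disc. ennreal (omega_tilde \<omega> (norm z) / pi)
      * (ennreal (norm (f z) powr p) * indicator A z) \<partial>lborel)"
    using f_powr A by (intro nn_integral_bergman_measure_density omega_tilde_measurable) auto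
  also have "\<dots> = (\<integral>\<^sup>+z\<in>A. ennreal (omega_tilde \<omega> (norm z) / pi) * ennreal (norm (f z) powr p) \<partial>lborel)"
    using \<open>A \<subseteq> disc\<close> by (intro nn_integral_cong) (auto simp: indicator_def)
  finally show ?thesis .
qed

lemma emeasure_tilde_mass_disc:
  assumes "f holomorphic_on disc"
  shows "emeasure (tilde_mass f) disc = Ap_int (omega_tilde \<omega>) p f"
proof -
  have "ennreal (norm (f z) powr p * omega_tilde \<omega> (norm z) / pi)
      = ennreal (omega_tilde \<omega> (norm z) / pi) * ennreal (norm (f z) powr p)" for z
    using ennreal_mult'[of "norm (f z) powr p" "omega_tilde \<omega> (norm z) / pi"] by (simp add: mult.commute)
  then show ?thesis
    by (simp add: emeasure_tilde_mass[OF assms] sets_restrict_space_iff Ap_int_def)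
qed

lemma omega_tilde_near_ge:
  fixes w z :: complex
  assumes w: "norm w < 1" and z: "dist w z < (1 - norm w) / 4"
  shows "omega_hat \<omega> (norm w) / (\<kappa> * (5/4 * (1 - norm w))) \<le> omega_tilde \<omega> (norm z)"
proof -
  note near = norm_near_disc[OF z]
  have "omega_hat \<omega> (norm w) \<le> \<kappa> * omega_hat \<omega> (norm z)"
    using omega_hat_le_scale[of "norm w" "norm z" 1] near w by simp
  then have "omega_hat \<omega> (norm w) / \<kappa> / (5/4 * (1 - norm w)) \<le> omega_hat \<omega> (norm z) / (1 - norm z)"
    using near w kappa_ge_1 by (intro frac_le) (auto simp: omega_hat_nonneg field_simps)
  then show ?thesis by (simp add: omega_tilde_def)
qed

lemma nn_integral_near_le_tilde_mass:
  assumes f: "f holomorphic_on disc" and w: "norm w < 1"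
  shows "(\<integral>\<^sup>+z\<in>ball w ((1 - norm w) / 4). ennreal (norm (f z) powr p) \<partial>lborel)
    \<le> ennreal (\<kappa> * (5/4 * (1 - norm w)) * pi / omega_hat \<omega> (norm w))
      * emeasure (tilde_mass f) (ball w ((1 - norm w) / 4))"
proof -
  define B where "B = ball w ((1 - norm w) / 4)"
  define c where "c = \<kappa> * (5/4 * (1 - norm w)) * pi / omega_hat \<omega> (norm w)"
  have c: "0 < c" using w kappa_ge_1 by (simp add: c_def omega_hat_pos)
  have B: "B \<subseteq> disc" "B \<in> sets (restrict_space borel disc)"
    unfolding B_def using ball_subset_disc[of "(1 - norm w) / 4" w] w
    by (simp_all add: sets_restrict_space_iff)
  define G where "G = (\<lambda>z. ennreal (omega_tilde \<omega> (norm z) / pi) * ennreal (norm (f z) powr p))"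
  have "G \<in> borel_measurable (restrict_space lborel disc)"
    unfolding G_def using borel_measurable_norm_powr[OF holomorphic_on_disc_measurable[OF f]]
    by (intro borel_measurable_times_ennreal radial_measurable omega_tilde_measurable)
      (simp add: measurable_cong_sets[OF sets_restrict_space_cong[OF sets_lborel] refl])
  from measurable_restrict_mono[OF this B(1)]
  have G: "(\<lambda>z. G z * indicator B z) \<in> borel_measurable lborel"
    by (simp add: B_def borel_measurable_restrict_space_iff_ennreal)
  have "(\<integral>\<^sup>+z\<in>B. ennreal (norm (f z) powr p) \<partial>lborel) \<le> (\<integral>\<^sup>+z. ennreal c * (G z * indicator B z) \<partial>lborel)"
  proof (rule nn_integral_mono)
    fix z
    have "ennreal (norm (f z) powr p) \<le> ennreal c * G z" if "z \<in> B"
    proof -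
      have "omega_hat \<omega> (norm w) / (\<kappa> * (5/4 * (1 - norm w))) \<le> omega_tilde \<omega> (norm z)"
        using that w by (intro omega_tilde_near_ge) (auto simp: B_def)
      from divide_right_mono[OF this, of pi]
      have "1 / c \<le> omega_tilde \<omega> (norm z) / pi"
        by (simp add: c_def mult_ac)
      then have "1 \<le> c * (omega_tilde \<omega> (norm z) / pi)"
        using c by (simp add: pos_divide_le_eq mult.commute)
      then have "ennreal 1 \<le> ennreal c * ennreal (omega_tilde \<omega> (norm z) / pi)"
        using c by (subst ennreal_mult'[symmetric]) (auto intro: ennreal_leI)
      from mult_right_mono[OF this, of "ennreal (norm (f z) powr p)"] show ?thesis
        by (simp add: G_def mult.assoc)
    qed
    then show "ennreal (norm (f z) powr p) * indicator B z \<le> ennreal c * (G z * indicator B z)"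
      by (simp add: indicator_def)
  qed
  also have "\<dots> = ennreal c * emeasure (tilde_mass f) B"
    using G by (simp add: nn_integral_cmult emeasure_tilde_mass[OF f B(2)] G_def)
  finally show ?thesis by (simp add: B_def c_def)
qed

definition deriv_const :: "nat \<Rightarrow> real" where
  "deriv_const k = (fact k * 2 ^ k) powr p * 4 / pi * (\<kappa> * (5/4) * pi * 4\<^sup>2 * 4 powr (k * p))"

lemma deriv_const_pos: "0 < deriv_const k"
  using kappa_ge_1 by (simp add: deriv_const_def)

lemma norm_higher_deriv_powr_le_tilde_mass:
  assumes f: "f holomorphic_on disc" and fin: "finite_measure (tilde_mass f)" and w: "norm w < 1"
  shows "norm ((deriv ^^ k) f w) powr p
    \<le> deriv_const k / eval_gauge k (norm w) * measure (tilde_mass f) (ball w ((1 - norm w) / 4))"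
proof -
  define \<delta> where "\<delta> = 1 - norm w"
  define h where "h = omega_hat \<omega> (norm w)"
  define m where "m = measure (tilde_mass f) (ball w (\<delta> / 4))"
  interpret finite_measure "tilde_mass f" by (rule fin)
  have pos: "0 < \<delta>" "0 < h" using w by (auto simp: \<delta>_def h_def omega_hat_pos)
  have hol: "f holomorphic_on ball w (\<delta> / 4)"
    by (rule holomorphic_on_subset[OF f ball_subset_disc]) (use w in \<open>simp add: \<delta>_def\<close>)
  have "(\<integral>\<^sup>+z\<in>ball w (\<delta> / 4). ennreal (norm (f z) powr p) \<partial>lborel)
      \<le> ennreal (\<kappa> * (5/4 * \<delta>) * pi / h) * ennreal m"
    using nn_integral_near_le_tilde_mass[OF f w] by (simp add: \<delta>_def h_def m_def emeasure_eq_measure)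
  also have "\<dots> = ennreal (\<kappa> * (5/4 * \<delta>) * pi / h * m)"
    by (simp add: m_def flip: ennreal_mult'')
  finally have "norm ((deriv ^^ k) f w) powr p
      \<le> (fact k * 2 ^ k) powr p * 4 / pi
        * (\<kappa> * (5/4 * \<delta>) * pi / h * m / ((\<delta> / 4)\<^sup>2 * (\<delta> / 4) powr (k * p)))"
    using pos kappa_ge_1 p_gt_1 by (intro norm_higher_deriv_powr_le hol) (auto simp: m_def)
  also have "\<kappa> * (5/4 * \<delta>) * pi / h * m / ((\<delta> / 4)\<^sup>2 * (\<delta> / 4) powr (k * p))
      = \<kappa> * (5/4) * pi * 4\<^sup>2 * 4 powr (k * p) * (m / (\<delta> powr (k * p) * (h * \<delta>)))"
    using pos by (simp add: powr_divide power2_eq_square mult_ac)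
  finally show ?thesis by (simp add: eval_gauge_def deriv_const_def \<delta>_def h_def m_def)
qed

end

locale bergman_regular = regular_weight + bergman_doubling
begin

lemma emeasure_tilde_mass_le:
  assumes "f holomorphic_on disc" "Ap_int \<omega> p f \<le> 1"
  shows "emeasure (tilde_mass f) disc \<le> ennreal reg_const"
proof -
  have "emeasure (tilde_mass f) disc \<le> ennreal reg_const * Ap_int \<omega> p f"
    unfolding emeasure_tilde_mass_disc[OF assms(1)] by (rule Ap_int_omega_tilde_le[OF p_gt_1 assms(1)])
  also have "\<dots> \<le> ennreal reg_const * 1"
    by (intro mult_left_mono assms) simp
  finally show ?thesis by simp
qed

lemma finite_measure_tilde_mass:
  assumes "f holomorphic_on disc" "Ap_int \<omega> p f \<le> 1"
  shows "finite_measure (tilde_mass f)" "measure (tilde_mass f) A \<le> reg_const"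
proof -
  show fin: "finite_measure (tilde_mass f)"
    using le_less_trans[OF emeasure_tilde_mass_le[OF assms] ennreal_less_top]
    by (intro finite_measureI) simp
  interpret finite_measure "tilde_mass f" by (rule fin)
  have "measure (tilde_mass f) A \<le> measure (tilde_mass f) disc"
    using bounded_measure[of A] by simp
  also have "\<dots> \<le> reg_const"
    using emeasure_tilde_mass_le[OF assms] reg_const_pos by (simp add: emeasure_eq_measure)
  finally show "measure (tilde_mass f) A \<le> reg_const" .
qed

lemma norm_higher_deriv_powr_le_gauge:
  assumes f: "f holomorphic_on disc" "Ap_int \<omega> p f \<le> 1" and w: "norm w < 1"
  shows "norm ((deriv ^^ k) f w) powr p \<le> deriv_const k / eval_gauge k (norm w) * reg_const"
proof (rule order_trans[OF norm_higher_deriv_powr_le_tilde_mass mult_left_mono])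
  show "0 \<le> deriv_const k / eval_gauge k (norm w)"
    using deriv_const_pos[of k] eval_gauge_pos[of "norm w" k] w by simp
qed (use assms finite_measure_tilde_mass in auto)

lemma Ap_ball_locally_bounded:
  assumes R: "R < 1"
  obtains B where "\<And>f z. f holomorphic_on disc \<Longrightarrow> Ap_int \<omega> p f \<le> 1 \<Longrightarrow> norm z \<le> R
    \<Longrightarrow> norm ((deriv ^^ k) f z) \<le> B"
proof (rule that)
  fix f z
  assume f: "f holomorphic_on disc" "Ap_int \<omega> p f \<le> 1" and z: "norm (z::complex) \<le> R"
  have "norm ((deriv ^^ k) f z) powr p \<le> deriv_const k / eval_gauge k (norm z) * reg_const"
    by (rule norm_higher_deriv_powr_le_gauge[OF f]) (use z R in simp)
  also have "\<dots> \<le> deriv_const k / eval_gauge k (max 0 R) * reg_const"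
    using z R deriv_const_pos[of k] reg_const_pos eval_gauge_pos[of "max 0 R" k]
      eval_gauge_antimono[of "norm z" "max 0 R" k]
    by (intro mult_right_mono divide_left_mono mult_pos_pos eval_gauge_pos) auto
  finally have "(norm ((deriv ^^ k) f z) powr p) powr (1 / p)
      \<le> (deriv_const k / eval_gauge k (max 0 R) * reg_const) powr (1 / p)"
    using p_pos by (intro powr_mono2) auto
  then show "norm ((deriv ^^ k) f z) \<le> (deriv_const k / eval_gauge k (max 0 R) * reg_const) powr (1 / p)"
    using p_pos by (simp add: powr_powr)
qed

lemma norm_higher_deriv_powr_q_le:
  assumes f: "f holomorphic_on disc" "Ap_int \<omega> p f \<le> 1" and w: "norm w < 1" and q: "p \<le> q"
  shows "norm ((deriv ^^ k) f w) powr q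
    \<le> (deriv_const k / eval_gauge k (norm w)) powr (q / p) * reg_const powr (q / p - 1)
      * measure (tilde_mass f) (ball w ((1 - norm w) / 4))"
proof -
  define x where "x = measure (tilde_mass f) (ball w ((1 - norm w) / 4))"
  have x: "0 \<le> x" "x \<le> reg_const"
    using finite_measure_tilde_mass(2)[OF f] by (simp_all add: x_def)
  have qp: "1 \<le> q / p" using q p_pos by simp
  have "norm ((deriv ^^ k) f w) powr q = (norm ((deriv ^^ k) f w) powr p) powr (q / p)"
    using p_pos by (simp add: powr_powr)
  also have "\<dots> \<le> (deriv_const k / eval_gauge k (norm w) * x) powr (q / p)"
    unfolding x_def using qp finite_measure_tilde_mass(1)[OF f] w
    by (intro powr_mono2 norm_higher_deriv_powr_le_tilde_mass f) auto
  also have "\<dots> = (deriv_const k / eval_gauge k (norm w)) powr (q / p) * x powr (q / p)"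
    by (rule powr_mult)
  also have "x powr (q / p) = x powr (q / p - 1) * x"
    using x powr_add[of x "q / p - 1" 1] by simp
  also have "(deriv_const k / eval_gauge k (norm w)) powr (q / p) * \<dots>
      \<le> (deriv_const k / eval_gauge k (norm w)) powr (q / p) * (reg_const powr (q / p - 1) * x)"
    using x qp by (intro mult_left_mono mult_right_mono powr_mono2) auto
  finally show ?thesis by (simp add: x_def mult.assoc)
qed

definition carleson_const :: "real \<Rightarrow> nat \<Rightarrow> real" where
  "carleson_const q k = (deriv_const k * gauge_const k * reg_const) powr (q / p)"

lemma carleson_const_pos: "0 < carleson_const q k"
  using deriv_const_pos[of k] gauge_const_pos[of k] reg_const_pos by (simp add: carleson_const_def)

definition carleson_kernel :: "real \<Rightarrow> nat \<Rightarrow> real \<Rightarrow> complex \<Rightarrow> complex \<Rightarrow> ennreal" where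
  "carleson_kernel q k R w \<zeta> = ennreal ((deriv_const k / eval_gauge k (norm w)) powr (q / p))
     * indicator {w. 1 - 4/5 * (1 - R) < norm w \<and> dist w \<zeta> < (1 - norm w) / 4} w"

lemma carleson_kernel_measurable:
  assumes \<nu>: "sets \<nu> = sets (restrict_space borel disc)" and \<mu>: "sets \<mu> = sets (restrict_space borel disc)"
  shows "case_prod (carleson_kernel q k R) \<in> borel_measurable (\<nu> \<Otimes>\<^sub>M \<mu>)"
proof -
  have [measurable]: "fst \<in> borel_measurable (\<nu> \<Otimes>\<^sub>M \<mu>)" "snd \<in> borel_measurable (\<nu> \<Otimes>\<^sub>M \<mu>)"
    by (auto intro!: measurable_compose[OF measurable_fst] measurable_compose[OF measurable_snd]
        simp: measurable_cong_sets[OF \<nu> refl] measurable_cong_sets[OF \<mu> refl] disc_id_measurable)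
  have "norm \<in> restrict_space borel disc \<rightarrow>\<^sub>M restrict_space borel {0..<1::real}"
    by (intro measurable_restrict_space3) (auto simp: mem_disc_iff)
  from measurable_compose[OF this eval_gauge_measurable]
  have "(\<lambda>w::complex. eval_gauge k (norm w)) \<in> borel_measurable \<nu>"
    by (simp add: measurable_cong_sets[OF \<nu> refl])
  from measurable_compose[OF measurable_fst this]
  have [measurable]: "(\<lambda>x. eval_gauge k (norm (fst x))) \<in> borel_measurable (\<nu> \<Otimes>\<^sub>M \<mu>)" .
  have "(\<lambda>x. ennreal ((deriv_const k / eval_gauge k (norm (fst x))) powr (q / p))
      * (if 1 - 4/5 * (1 - R) < norm (fst x) \<and> dist (fst x) (snd x) < (1 - norm (fst x)) / 4 then 1 else 0))
    \<in> borel_measurable (\<nu> \<Otimes>\<^sub>M \<mu>)"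
    by measurable
  then show ?thesis
    by (simp add: carleson_kernel_def case_prod_unfold indicator_def of_bool_def)
qed

lemma norm_higher_deriv_powr_le_kernel:
  assumes f: "f holomorphic_on disc" "Ap_int \<omega> p f \<le> 1" and w: "norm w < 1" and q: "p \<le> q"
  shows "ennreal (norm ((deriv ^^ k) f w) powr q) * indicator {w. 1 - 4/5 * (1 - R) < norm w} w
    \<le> ennreal (reg_const powr (q / p - 1)) * (\<integral>\<^sup>+\<zeta>. carleson_kernel q k R w \<zeta> \<partial>tilde_mass f)"
proof (cases "1 - 4/5 * (1 - R) < norm w")
  case True
  define B where "B = ball w ((1 - norm w) / 4)"
  define g where "g = (deriv_const k / eval_gauge k (norm w)) powr (q / p)"
  interpret finite_measure "tilde_mass f" by (rule finite_measure_tilde_mass(1)[OF f])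
  have "B \<in> sets (tilde_mass f)"
    using ball_subset_disc[of "(1 - norm w) / 4" w] w by (simp add: B_def sets_restrict_space_iff)
  then have "(\<integral>\<^sup>+\<zeta>. carleson_kernel q k R w \<zeta> \<partial>tilde_mass f) = ennreal g * emeasure (tilde_mass f) B"
    using True by (subst nn_integral_cmult_indicator[symmetric])
      (auto intro!: nn_integral_cong simp: carleson_kernel_def B_def g_def indicator_def)
  moreover have "ennreal (norm ((deriv ^^ k) f w) powr q)
      \<le> ennreal (reg_const powr (q / p - 1)) * (ennreal g * emeasure (tilde_mass f) B)"
    using norm_higher_deriv_powr_q_le[OF f w q, of k]
    by (simp add: B_def g_def emeasure_eq_measure mult_ac ennreal_leI flip: ennreal_mult'')
  ultimately show ?thesis using True by simp
qed simp

lemma nn_integral_carleson_kernel_le: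
  assumes \<nu>: "sets \<nu> = sets (restrict_space borel disc)" and M: "0 \<le> M" and q: "0 < q"
    and carleson: "\<And>a. R \<le> norm a \<Longrightarrow> norm a < 1 \<Longrightarrow>
       emeasure \<nu> (ball a ((1 - norm a) / 2)) \<le> ennreal (M * eval_gauge k (norm a) powr (q / p))"
    and \<zeta>: "norm \<zeta> < 1"
  shows "(\<integral>\<^sup>+w. carleson_kernel q k R w \<zeta> \<partial>\<nu>) \<le> ennreal ((deriv_const k * gauge_const k) powr (q / p) * M)"
proof (cases "R \<le> norm \<zeta>")
  case True
  define c where "c = (deriv_const k * gauge_const k / eval_gauge k (norm \<zeta>)) powr (q / p)"
  have pos: "0 < eval_gauge k (norm \<zeta>)" using \<zeta> by (simp add: eval_gauge_pos)
  have "(\<integral>\<^sup>+w. carleson_kernel q k R w \<zeta> \<partial>\<nu>)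
      \<le> (\<integral>\<^sup>+w. ennreal c * indicator (ball \<zeta> ((1 - norm \<zeta>) / 2)) w \<partial>\<nu>)"
  proof (rule nn_integral_mono)
    fix w assume "w \<in> space \<nu>"
    then have w: "norm w < 1"
      using sets_eq_imp_space_eq[OF \<nu>] by (simp add: mem_disc_iff)
    have "(deriv_const k / eval_gauge k (norm w)) powr (q / p) \<le> c" "w \<in> ball \<zeta> ((1 - norm \<zeta>) / 2)"
      if "dist w \<zeta> < (1 - norm w) / 4"
    proof -
      note near = norm_near_disc[OF that]
      show "w \<in> ball \<zeta> ((1 - norm \<zeta>) / 2)" using near(3) by simp
      have "eval_gauge k (norm \<zeta>) \<le> gauge_const k * eval_gauge k (norm w)"
        using near \<zeta> w by (intro eval_gauge_le) auto
      then have "deriv_const k / eval_gauge k (norm w)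
          \<le> deriv_const k * gauge_const k / eval_gauge k (norm \<zeta>)"
        using pos eval_gauge_pos[of "norm w" k] w deriv_const_pos[of k] by (simp add: field_simps)
      then show "(deriv_const k / eval_gauge k (norm w)) powr (q / p) \<le> c"
        unfolding c_def using eval_gauge_pos[of "norm w" k] w deriv_const_pos[of k] q p_pos
        by (intro powr_mono2) auto
    qed
    then show "carleson_kernel q k R w \<zeta> \<le> ennreal c * indicator (ball \<zeta> ((1 - norm \<zeta>) / 2)) w"
      by (auto simp: carleson_kernel_def indicator_def intro: ennreal_leI)
  qed
  also have "\<dots> = ennreal c * emeasure \<nu> (ball \<zeta> ((1 - norm \<zeta>) / 2))"
    using ball_subset_disc[of "(1 - norm \<zeta>) / 2" \<zeta>] \<zeta>
    by (intro nn_integral_cmult_indicator) (simp add: \<nu> sets_restrict_space_iff)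
  also have "\<dots> \<le> ennreal c * ennreal (M * eval_gauge k (norm \<zeta>) powr (q / p))"
    by (intro mult_left_mono carleson True \<zeta>) simp
  also have "\<dots> = ennreal ((deriv_const k * gauge_const k) powr (q / p) * M)"
    using pos M by (simp add: c_def powr_divide flip: ennreal_mult)
  finally show ?thesis .
next
  case False
  have "\<not> (1 - 4/5 * (1 - R) < norm w \<and> dist w \<zeta> < (1 - norm w) / 4)" for w
  proof
    assume "1 - 4/5 * (1 - R) < norm w \<and> dist w \<zeta> < (1 - norm w) / 4"
    then show False using norm_near_disc(2)[of w \<zeta>] False by argo
  qed
  then show ?thesis by (simp add: carleson_kernel_def)
qed

lemma carleson_embedding:
  assumes q: "p \<le> q" and \<nu>: "sets \<nu> = sets (restrict_space borel disc)" "finite_measure \<nu>" and M: "0 \<le> M"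
    and carleson: "\<And>a. R \<le> norm a \<Longrightarrow> norm a < 1 \<Longrightarrow>
       emeasure \<nu> (ball a ((1 - norm a) / 2)) \<le> ennreal (M * eval_gauge k (norm a) powr (q / p))"
    and f: "f holomorphic_on disc" "Ap_int \<omega> p f \<le> 1"
  shows "(\<integral>\<^sup>+w\<in>{w. 1 - 4/5 * (1 - R) < norm w}. ennreal (norm ((deriv ^^ k) f w) powr q) \<partial>\<nu>)
    \<le> ennreal (carleson_const q k * M)"
proof -
  define c where "c = reg_const powr (q / p - 1)"
  have q_pos: "0 < q" using q p_pos by simp
  interpret \<nu>: finite_measure \<nu> by (rule \<nu>(2))
  interpret \<mu>: finite_measure "tilde_mass f" by (rule finite_measure_tilde_mass(1)[OF f])
  interpret pair_sigma_finite \<nu> "tilde_mass f" ..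
  note kernel = carleson_kernel_measurable[OF \<nu>(1) sets_tilde_mass, of q k R f]
  have "norm w < 1" if "w \<in> space \<nu>" for w
    using that sets_eq_imp_space_eq[OF \<nu>(1)] by (simp add: mem_disc_iff)
  then have "(\<integral>\<^sup>+w\<in>{w. 1 - 4/5 * (1 - R) < norm w}. ennreal (norm ((deriv ^^ k) f w) powr q) \<partial>\<nu>)
      \<le> (\<integral>\<^sup>+w. ennreal c * (\<integral>\<^sup>+\<zeta>. carleson_kernel q k R w \<zeta> \<partial>tilde_mass f) \<partial>\<nu>)"
    unfolding c_def by (intro nn_integral_mono norm_higher_deriv_powr_le_kernel f q)
  also have "\<dots> = ennreal c * (\<integral>\<^sup>+w. (\<integral>\<^sup>+\<zeta>. carleson_kernel q k R w \<zeta> \<partial>tilde_mass f) \<partial>\<nu>)"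
    using kernel by (intro nn_integral_cmult \<mu>.borel_measurable_nn_integral)
  also have "\<dots> = ennreal c * (\<integral>\<^sup>+\<zeta>. (\<integral>\<^sup>+w. carleson_kernel q k R w \<zeta> \<partial>\<nu>) \<partial>tilde_mass f)"
    by (simp only: Fubini'[OF kernel])
  also have "\<dots> \<le> ennreal c * (\<integral>\<^sup>+\<zeta>. ennreal ((deriv_const k * gauge_const k) powr (q / p)
      * M) \<partial>tilde_mass f)"
    by (intro mult_left_mono nn_integral_mono nn_integral_carleson_kernel_le[OF \<nu>(1) M q_pos carleson])
      (auto simp: mem_disc_iff)
  also have "\<dots> \<le> ennreal c * (ennreal ((deriv_const k * gauge_const k) powr (q / p) * M)
      * ennreal reg_const)"
    using emeasure_tilde_mass_le[OF f] by (auto intro!: mult_left_mono)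
  also have "\<dots> = ennreal ((deriv_const k * gauge_const k) powr (q / p) * (c * reg_const) * M)"
    using M reg_const_pos by (simp add: c_def mult_ac flip: ennreal_mult)
  also have "c * reg_const = reg_const powr (q / p)"
    using reg_const_pos by (simp add: c_def powr_diff)
  finally show ?thesis by (simp add: carleson_const_def powr_mult)
qed

end

section \<open>Compact operators\<close>

locale disc_measure =
  fixes \<upsilon> :: "complex measure"
  assumes sets_measure: "sets \<upsilon> = sets borel"
begin

lemma sets_restrict_measure: "sets (restrict_space \<upsilon> disc) = sets (restrict_space borel disc)"
  by (rule sets_restrict_space_cong[OF sets_measure])

lemma measurable_restrict_measure:
  "borel_measurable (restrict_space \<upsilon> disc) = borel_measurable (restrict_space borel disc)"
  by (rule measurable_cong_sets[OF sets_restrict_measure refl])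

lemma disc_in_measure: "disc \<inter> space \<upsilon> \<in> sets \<upsilon>"
  by (simp add: sets_measure)

lemma space_restrict_measure: "space (restrict_space \<upsilon> disc) = disc"
  using sets_eq_imp_space_eq[OF sets_measure] by (simp add: space_restrict_space)

lemma Lq_norm_eq_Lp_seminorm: "Lq_norm \<upsilon> q g = Lp_seminorm (restrict_space \<upsilon> disc) q g"
  by (simp add: Lq_norm_def Lq_int_def Lp_seminorm_def nn_integral_restrict_space[OF disc_in_measure])

lemma Lq_space_iff:
  "g \<in> Lq_space \<upsilon> q \<longleftrightarrow> g \<in> borel_measurable borel \<and> Lq_norm \<upsilon> q g < \<infinity>"
  by (simp add: Lq_space_def Lq_norm_def root_enn_less_top_iff[unfolded infinity_ennreal_def]
      measurable_cong_sets[OF sets_measure refl])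

lemma Lq_space_measurable: "g \<in> Lq_space \<upsilon> q \<Longrightarrow> g \<in> borel_measurable (restrict_space borel disc)"
  by (simp add: Lq_space_iff measurable_restrict_space1)

lemma Lq_norm_add_le:
  assumes "1 \<le> q" "g \<in> borel_measurable (restrict_space borel disc)"
      "h \<in> borel_measurable (restrict_space borel disc)"
  shows "Lq_norm \<upsilon> q (\<lambda>z. g z + h z) \<le> Lq_norm \<upsilon> q g + Lq_norm \<upsilon> q h"
  unfolding Lq_norm_eq_Lp_seminorm using assms
  by (intro Lp_seminorm_add_le) (simp_all add: measurable_restrict_measure)

lemma Lq_norm_triangle:
  assumes "1 \<le> q" "g \<in> borel_measurable (restrict_space borel disc)"
      "h \<in> borel_measurable (restrict_space borel disc)"
  shows "Lq_norm \<upsilon> q g \<le> Lq_norm \<upsilon> q (\<lambda>z. g z - h z) + Lq_norm \<upsilon> q h"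
  unfolding Lq_norm_eq_Lp_seminorm using assms
  by (intro Lp_seminorm_triangle) (simp_all add: measurable_restrict_measure)

lemma Lq_norm_diff_commute: "Lq_norm \<upsilon> q (\<lambda>z. g z - h z) = Lq_norm \<upsilon> q (\<lambda>z. h z - g z)"
  by (simp add: Lq_norm_def Lq_int_def norm_minus_commute)

lemma Lq_norm_cmult:
  assumes "0 < q" "g \<in> borel_measurable (restrict_space borel disc)"
  shows "Lq_norm \<upsilon> q (\<lambda>z. c * g z) = ennreal (norm c) * Lq_norm \<upsilon> q g"
  unfolding Lq_norm_eq_Lp_seminorm using assms
  by (intro Lp_seminorm_cmult) (simp_all add: measurable_restrict_measure)

lemma Lq_norm_mono:
  assumes "0 < q" "\<And>z. z \<in> disc \<Longrightarrow> norm (g z) \<le> norm (h z)"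
  shows "Lq_norm \<upsilon> q g \<le> Lq_norm \<upsilon> q h"
  unfolding Lq_norm_eq_Lp_seminorm using assms
  by (intro Lp_seminorm_mono) (simp_all add: space_restrict_measure)

lemma Lq_space_add:
  assumes "1 \<le> q" "g \<in> Lq_space \<upsilon> q" "h \<in> Lq_space \<upsilon> q"
  shows "(\<lambda>z. g z + h z) \<in> Lq_space \<upsilon> q"
proof -
  have "Lq_norm \<upsilon> q (\<lambda>z. g z + h z) \<le> Lq_norm \<upsilon> q g + Lq_norm \<upsilon> q h"
    using assms by (intro Lq_norm_add_le Lq_space_measurable)
  also have "\<dots> < \<infinity>" using assms by (simp add: Lq_space_iff)
  finally show ?thesis using assms by (auto simp: Lq_space_iff)
qed

end

lemma Ap_norm_le_1_iff: "0 < p \<Longrightarrow> Ap_norm \<omega> p f \<le> 1 \<longleftrightarrow> Ap_int \<omega> p f \<le> 1"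
  using root_enn_le_iff[of p 1 "Ap_int \<omega> p f"] by (simp add: Ap_norm_def)

lemma compact_op_linear:
  assumes "compact_op \<omega> p \<upsilon> q T"
  shows "f \<in> Ap_space \<omega> p \<Longrightarrow> g \<in> Ap_space \<omega> p \<Longrightarrow> T (\<lambda>z. f z + g z) = (\<lambda>z. T f z + T g z)"
    and "f \<in> Ap_space \<omega> p \<Longrightarrow> T (\<lambda>z. c * f z) = (\<lambda>z. c * T f z)"
proof -
  have linear: "T (\<lambda>z. a * f z + b * g z) = (\<lambda>z. a * T f z + b * T g z)"
    if "f \<in> Ap_space \<omega> p" "g \<in> Ap_space \<omega> p" for f g a b
    using assms that unfolding compact_op_def by blast
  show "f \<in> Ap_space \<omega> p \<Longrightarrow> g \<in> Ap_space \<omega> p \<Longrightarrow> T (\<lambda>z. f z + g z) = (\<lambda>z. T f z + T g z)"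
    using linear[of f g 1 1] by simp
  show "f \<in> Ap_space \<omega> p \<Longrightarrow> T (\<lambda>z. c * f z) = (\<lambda>z. c * T f z)"
    using linear[of f f c 0] by simp
qed

lemma compact_op_in_Lq: "compact_op \<omega> p \<upsilon> q T \<Longrightarrow> f \<in> Ap_space \<omega> p \<Longrightarrow> T f \<in> Lq_space \<upsilon> q"
  by (simp add: compact_op_def)

lemma compact_op_subseq:
  assumes "compact_op \<omega> p \<upsilon> q T" "0 < p"
    and "\<And>n. F n \<in> Ap_space \<omega> p" "\<And>n. Ap_int \<omega> p (F n) \<le> 1"
  obtains r h where "strict_mono (r::nat \<Rightarrow> nat)" "h \<in> Lq_space \<upsilon> q"
    "(\<lambda>n. Lq_norm \<upsilon> q (\<lambda>z. T (F (r n)) z - h z)) \<longlonglongrightarrow> 0"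
proof -
  have "\<forall>n. F n \<in> Ap_space \<omega> p \<and> Ap_norm \<omega> p (F n) \<le> 1"
    using assms Ap_norm_le_1_iff[OF assms(2)] by simp
  then show thesis using assms(1) that unfolding compact_op_def by blast
qed

lemma Lq_norm_le_op_norm:
  assumes "0 < p" "f \<in> Ap_space \<omega> p" "Ap_int \<omega> p f \<le> 1"
  shows "Lq_norm \<upsilon> q (T f) \<le> op_norm \<omega> p \<upsilon> q T"
  unfolding op_norm_def using assms by (intro SUP_upper) (simp add: Ap_norm_le_1_iff)

lemma op_norm_le:
  assumes "0 < p" "\<And>f. f holomorphic_on disc \<Longrightarrow> Ap_int \<omega> p f \<le> 1 \<Longrightarrow> Lq_norm \<upsilon> q (T f) \<le> c"
  shows "op_norm \<omega> p \<upsilon> q T \<le> c"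
  unfolding op_norm_def using assms by (intro SUP_least) (auto simp: Ap_norm_le_1_iff Ap_space_def)

lemma Ap_space_if_Ap_int_le:
  "f holomorphic_on disc \<Longrightarrow> Ap_int \<omega> p f \<le> ennreal c \<Longrightarrow> f \<in> Ap_space \<omega> p"
  using le_less_trans[OF _ ennreal_less_top] by (auto simp: Ap_space_def)

context bergman_doubling
begin

lemma Ap_space_cmult: "f \<in> Ap_space \<omega> p \<Longrightarrow> (\<lambda>z. c * f z) \<in> Ap_space \<omega> p"
  by (auto simp: Ap_space_def Ap_int_cmult ennreal_mult_less_top intro!: holomorphic_intros)

lemma Ap_int_add_null_le:
  assumes f: "f \<in> Ap_space \<omega> p" and g: "\<And>n. g n \<in> Ap_space \<omega> p" "\<And>n. Ap_int \<omega> p (g n) \<le> 1"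
    and null: "\<And>z. z \<in> disc \<Longrightarrow> (\<lambda>n. g n z) \<longlonglongrightarrow> 0"
  shows "\<forall>\<^sub>F n in sequentially. Ap_int \<omega> p (\<lambda>z. f z + g n z) \<le> Ap_int \<omega> p f + ennreal 3"
proof -
  have hol: "f holomorphic_on disc" "g n holomorphic_on disc" for n
    using f g by (auto simp: Ap_space_def)
  have Ap_int: "Ap_int \<omega> p h = (\<integral>\<^sup>+z. ennreal (norm (h z) powr p) \<partial>bergman_measure \<omega>)"
    if "h holomorphic_on disc" for h
    by (rule Ap_int_eq_nn_integral[OF omega_measurable_Ico holomorphic_on_disc_measurable[OF that]])
  have measurable: "h \<in> borel_measurable (bergman_measure \<omega>)" if "h holomorphic_on disc"
    for h :: "complex \<Rightarrow> complex"
    using holomorphic_on_disc_measurable[OF that]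
    by (simp add: measurable_cong_sets[OF sets_bergman_measure refl])
  have "\<forall>\<^sub>F n in sequentially. (\<integral>\<^sup>+z. ennreal (norm (f z + g n z) powr p) \<partial>bergman_measure \<omega>)
      \<le> (\<integral>\<^sup>+z. ennreal (norm (f z) powr p) \<partial>bergman_measure \<omega>) + ennreal (2 * (3/2))"
    using f g(2) null
    by (intro nn_integral_powr_add_null_le measurable hol p_pos)
      (simp_all add: Ap_space_def Ap_int[OF hol(1)] Ap_int[OF hol(2)])
  then show ?thesis
    by (simp add: Ap_int hol holomorphic_intros)
qed

end

locale bergman_Lq = bergman_doubling + disc_measure +
  fixes q :: real
  assumes q_ge_1: "1 \<le> q"
begin

lemma q_pos: "0 < q"
  using q_ge_1 by simp

lemma compact_op_measurable:
  assumes "compact_op \<omega> p \<upsilon> q T" "f \<in> Ap_space \<omega> p"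
  shows "T f \<in> borel_measurable (restrict_space borel disc)"
  by (rule Lq_space_measurable[OF compact_op_in_Lq[OF assms]])

lemma compact_op_op_norm_finite:
  assumes T: "compact_op \<omega> p \<upsilon> q T"
  shows "op_norm \<omega> p \<upsilon> q T < \<infinity>"
proof (rule ccontr)
  assume "\<not> ?thesis"
  then have "op_norm \<omega> p \<upsilon> q T = top"
    by (simp add: not_less top_unique)
  then have "ennreal (real n) < op_norm \<omega> p \<upsilon> q T" for n
    by simp
  then have "\<forall>n. \<exists>f. f \<in> Ap_space \<omega> p \<and> Ap_int \<omega> p f \<le> 1 \<and> ennreal (real n) < Lq_norm \<upsilon> q (T f)"
    by (simp add: op_norm_def less_SUP_iff Ap_norm_le_1_iff[OF p_pos] conj_assoc Bex_def)
  from choice[OF this] obtain F where F: "\<And>n. F n \<in> Ap_space \<omega> p" "\<And>n. Ap_int \<omega> p (F n) \<le> 1"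
    "\<And>n::nat. ennreal (real n) < Lq_norm \<upsilon> q (T (F n))"
    by blast
  obtain r h where r: "strict_mono r" and h: "h \<in> Lq_space \<upsilon> q"
    and lim: "(\<lambda>n. Lq_norm \<upsilon> q (\<lambda>z. T (F (r n)) z - h z)) \<longlonglongrightarrow> 0"
    by (rule compact_op_subseq[OF T p_pos F(1,2)])
  obtain b where b: "Lq_norm \<upsilon> q h = ennreal b" "0 \<le> b"
    using h by (cases "Lq_norm \<upsilon> q h") (auto simp: Lq_space_iff)
  obtain m :: nat where m: "1 + b < real m" using reals_Archimedean2 by blast
  have "\<forall>\<^sub>F n in sequentially. Lq_norm \<upsilon> q (\<lambda>z. T (F (r n)) z - h z) < ennreal 1"
    by (rule order_tendstoD(2)[OF lim]) simp
  moreover have "\<forall>\<^sub>F n in sequentially. m \<le> r n"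
    using filterlim_subseq[OF r] by (simp add: filterlim_at_top)
  ultimately have "\<forall>\<^sub>F n in sequentially. False"
  proof eventually_elim
    case (elim n)
    have "ennreal (real (r n)) < Lq_norm \<upsilon> q (T (F (r n)))" by (rule F(3))
    also have "\<dots> \<le> Lq_norm \<upsilon> q (\<lambda>z. T (F (r n)) z - h z) + Lq_norm \<upsilon> q h"
      by (intro Lq_norm_triangle q_ge_1 compact_op_measurable[OF T] Lq_space_measurable[OF h] F)
    also have "\<dots> \<le> ennreal 1 + ennreal b"
      using elim b by (intro add_mono) auto
    also have "\<dots> = ennreal (1 + b)" using b by simp
    finally show False using m elim(2) b by (simp add: ennreal_less_iff del: ennreal_plus)
  qed
  then show False by simp
qed

lemma compact_op_Lq_norm_le:
  assumes T: "compact_op \<omega> p \<upsilon> q T" and f: "f \<in> Ap_space \<omega> p" "Ap_int \<omega> p f \<le> ennreal s" and s: "0 < s"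
  shows "Lq_norm \<upsilon> q (T f) \<le> ennreal (s powr (1 / p)) * op_norm \<omega> p \<upsilon> q T"
proof -
  define t where "t = s powr (- 1 / p)"
  have t: "0 < t" "t powr p = 1 / s" "s powr (1 / p) * t = 1"
    using s p_pos by (simp_all only: t_def powr_powr flip: powr_add) (simp_all add: powr_minus_divide)
  have "Ap_int \<omega> p (\<lambda>z. of_real t * f z) = ennreal (1 / s) * Ap_int \<omega> p f"
    using f t(1,2) by (simp add: Ap_space_def Ap_int_cmult)
  also have "\<dots> \<le> ennreal (1 / s) * ennreal s"
    using f by (intro mult_left_mono) auto
  also have "\<dots> = 1" using s by (simp flip: ennreal_mult')
  finally have "Lq_norm \<upsilon> q (T (\<lambda>z. of_real t * f z)) \<le> op_norm \<omega> p \<upsilon> q T"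
    using f by (intro Lq_norm_le_op_norm p_pos Ap_space_cmult)
  then have "ennreal t * Lq_norm \<upsilon> q (T f) \<le> op_norm \<omega> p \<upsilon> q T"
    using t(1)
    by (simp add: compact_op_linear(2)[OF T f(1)] Lq_norm_cmult q_pos compact_op_measurable[OF T f(1)])
  then have "ennreal (s powr (1 / p)) * (ennreal t * Lq_norm \<upsilon> q (T f))
      \<le> ennreal (s powr (1 / p)) * op_norm \<omega> p \<upsilon> q T"
    by (rule mult_left_mono) simp
  moreover have "ennreal (s powr (1 / p)) * ennreal t = 1"
    using t by (simp flip: ennreal_mult')
  ultimately show ?thesis by (simp flip: mult.assoc)
qed

lemma compact_op_sparse_sum:
  assumes T: "compact_op \<omega> p \<upsilon> q T" and G: "\<And>n. G n \<in> Ap_space \<omega> p" "\<And>n. Ap_int \<omega> p (G n) \<le> 1"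
    and null: "\<And>z. z \<in> disc \<Longrightarrow> (\<lambda>n. G n z) \<longlonglongrightarrow> 0"
    and h: "h \<in> Lq_space \<upsilon> q" and lim: "(\<lambda>n. Lq_norm \<upsilon> q (\<lambda>z. T (G n) z - h z)) \<longlonglongrightarrow> 0"
    and e: "0 < e"
  shows "\<exists>S\<in>Ap_space \<omega> p. Ap_int \<omega> p S \<le> ennreal (3 * real N)
    \<and> Lq_norm \<upsilon> q (\<lambda>z. T S z - of_nat N * h z) \<le> ennreal (real N * e)"
proof (induction N)
  case 0
  have zero: "(\<lambda>_. 0) \<in> Ap_space \<omega> p" by (simp add: Ap_space_def Ap_int_def)
  have "T (\<lambda>_. 0) = (\<lambda>_. 0)" using compact_op_linear(2)[OF T zero, of 0] by simp
  then show ?case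
    by (intro bexI[OF _ zero]) (simp add: Ap_int_def Lq_norm_def Lq_int_def root_enn_def)
next
  case (Suc N)
  then obtain S where S: "S \<in> Ap_space \<omega> p" "Ap_int \<omega> p S \<le> ennreal (3 * real N)"
    "Lq_norm \<upsilon> q (\<lambda>z. T S z - of_nat N * h z) \<le> ennreal (real N * e)" by blast
  have "\<forall>\<^sub>F n in sequentially. Lq_norm \<upsilon> q (\<lambda>z. T (G n) z - h z) < ennreal e"
    by (rule order_tendstoD(2)[OF lim]) (use e in simp)
  with Ap_int_add_null_le[OF S(1) G null]
  have "\<forall>\<^sub>F n in sequentially. Ap_int \<omega> p (\<lambda>z. S z + G n z) \<le> Ap_int \<omega> p S + ennreal 3
      \<and> Lq_norm \<upsilon> q (\<lambda>z. T (G n) z - h z) < ennreal e"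
    by (rule eventually_conj)
  then obtain n where n: "Ap_int \<omega> p (\<lambda>z. S z + G n z) \<le> Ap_int \<omega> p S + ennreal 3"
    "Lq_norm \<upsilon> q (\<lambda>z. T (G n) z - h z) < ennreal e"
    using eventually_happens'[OF sequentially_bot] by blast
  have "Ap_int \<omega> p (\<lambda>z. S z + G n z) \<le> ennreal (3 * real N) + ennreal 3"
    by (rule order_trans[OF n(1)]) (intro add_right_mono S)
  also have "\<dots> = ennreal (3 * real (Suc N))"
    by (subst ennreal_plus[symmetric]) (simp_all add: distrib_left add.commute)
  finally have norm: "Ap_int \<omega> p (\<lambda>z. S z + G n z) \<le> ennreal (3 * real (Suc N))" .
  have mem: "(\<lambda>z. S z + G n z) \<in> Ap_space \<omega> p"
    using S(1) G(1)[of n]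
    by (intro Ap_space_if_Ap_int_le[OF _ norm]) (auto simp: Ap_space_def intro!: holomorphic_intros)
  have "Lq_norm \<upsilon> q (\<lambda>z. T (\<lambda>z. S z + G n z) z - of_nat (Suc N) * h z)
      = Lq_norm \<upsilon> q (\<lambda>z. (T S z - of_nat N * h z) + (T (G n) z - h z))"
    by (simp add: compact_op_linear(1)[OF T S(1) G(1)] algebra_simps)
  also have "\<dots> \<le> Lq_norm \<upsilon> q (\<lambda>z. T S z - of_nat N * h z) + Lq_norm \<upsilon> q (\<lambda>z. T (G n) z - h z)"
    using compact_op_measurable[OF T S(1)] compact_op_measurable[OF T G(1), of n] Lq_space_measurable[OF h]
    by (intro Lq_norm_add_le q_ge_1) auto
  also have "\<dots> \<le> ennreal (real N * e) + ennreal e"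
    using S(3) n(2) by (intro add_mono) auto
  also have "\<dots> = ennreal (real (Suc N) * e)"
    using e by (simp add: distrib_right add.commute flip: ennreal_plus)
  finally show ?case using norm mem by blast
qed

text \<open>Gliding hump: the sum of \<open>N\<close> sparse terms has norm at most \<open>(3 N) powr (1 / p)\<close>, while its image is
  close to \<open>N h\<close>; as \<open>p > 1\<close>, boundedness of \<open>T\<close> forces \<open>h = 0\<close>.\<close>

lemma compact_op_null_limit:
  assumes T: "compact_op \<omega> p \<upsilon> q T" and G: "\<And>n. G n \<in> Ap_space \<omega> p" "\<And>n. Ap_int \<omega> p (G n) \<le> 1"
    and null: "\<And>z. z \<in> disc \<Longrightarrow> (\<lambda>n. G n z) \<longlonglongrightarrow> 0"
    and h: "h \<in> Lq_space \<upsilon> q" and lim: "(\<lambda>n. Lq_norm \<upsilon> q (\<lambda>z. T (G n) z - h z)) \<longlonglongrightarrow> 0"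
  shows "Lq_norm \<upsilon> q h = 0"
proof -
  obtain B where B: "op_norm \<omega> p \<upsilon> q T = ennreal B" "0 \<le> B"
    using compact_op_op_norm_finite[OF T] by (cases "op_norm \<omega> p \<upsilon> q T") auto
  obtain b where b: "Lq_norm \<upsilon> q h = ennreal b" "0 \<le> b"
    using h by (cases "Lq_norm \<upsilon> q h") (auto simp: Lq_space_iff)
  have "b \<le> 1 / real N + 3 powr (1 / p) * B * real N powr (1 / p - 1)" if N: "1 \<le> N" for N :: nat
  proof -
    obtain S where S: "S \<in> Ap_space \<omega> p" "Ap_int \<omega> p S \<le> ennreal (3 * real N)"
      "Lq_norm \<upsilon> q (\<lambda>z. T S z - of_nat N * h z) \<le> ennreal 1"
      using compact_op_sparse_sum[OF T G null h lim, of "1 / real N" N] N by auto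
    have "ennreal (real N * b) = Lq_norm \<upsilon> q (\<lambda>z. of_nat N * h z)"
      using b by (simp add: Lq_norm_cmult q_pos Lq_space_measurable[OF h] ennreal_mult)
    also have "\<dots> \<le> Lq_norm \<upsilon> q (\<lambda>z. T S z - of_nat N * h z) + Lq_norm \<upsilon> q (T S)"
      using Lq_space_measurable[OF h] compact_op_measurable[OF T S(1)]
      by (subst Lq_norm_diff_commute) (intro Lq_norm_triangle q_ge_1; auto)
    also have "\<dots> \<le> ennreal 1 + ennreal ((3 * real N) powr (1 / p)) * ennreal B"
      using N S compact_op_Lq_norm_le[OF T S(1,2)] by (intro add_mono) (auto simp: B)
    also have "\<dots> = ennreal (1 + (3 * real N) powr (1 / p) * B)"
      using B by (simp add: ennreal_mult)
    finally have "real N * b \<le> 1 + (3 * real N) powr (1 / p) * B"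
      using B by (simp add: ennreal_le_iff del: ennreal_plus)
    then have "b \<le> (1 + (3 * real N) powr (1 / p) * B) / real N"
      using N by (simp add: field_simps)
    also have "\<dots> = 1 / real N + 3 powr (1 / p) * B * real N powr (1 / p - 1)"
      using N by (simp add: powr_mult powr_diff field_simps)
    finally show ?thesis .
  qed
  moreover have "(\<lambda>N. 1 / real N + 3 powr (1 / p) * B * real N powr (1 / p - 1))
      \<longlonglongrightarrow> 0 + 3 powr (1 / p) * B * 0"
    using p_gt_1
    by (intro tendsto_intros lim_inverse_n' tendsto_neg_powr filterlim_real_sequentially)
      (simp add: field_simps)
  ultimately have "b \<le> 0 + 3 powr (1 / p) * B * 0"
    by (intro LIMSEQ_le_const) auto
  then show ?thesis using b by simp
qed

lemma compact_op_null:
  assumes T: "compact_op \<omega> p \<upsilon> q T" and F: "\<And>n. F n \<in> Ap_space \<omega> p" "\<And>n. Ap_int \<omega> p (F n) \<le> 1"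
    and null: "\<And>z. z \<in> disc \<Longrightarrow> (\<lambda>n. F n z) \<longlonglongrightarrow> 0"
  shows "(\<lambda>n. Lq_norm \<upsilon> q (T (F n))) \<longlonglongrightarrow> 0"
proof (rule ccontr)
  assume "\<not> ?thesis"
  then obtain e where e: "0 < e" "\<not> (\<forall>\<^sub>F n in sequentially. Lq_norm \<upsilon> q (T (F n)) < e)"
    by (auto simp: order_tendsto_iff)
  from not_eventually_sequentiallyD[OF e(2)]
  obtain s :: "nat \<Rightarrow> nat" where s: "strict_mono s" "\<And>n. \<not> Lq_norm \<upsilon> q (T (F (s n))) < e"
    by blast
  obtain r h where r: "strict_mono r" and h: "h \<in> Lq_space \<upsilon> q"
    and lim: "(\<lambda>n. Lq_norm \<upsilon> q (\<lambda>z. T (F (s (r n))) z - h z)) \<longlonglongrightarrow> 0"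
    by (rule compact_op_subseq[OF T p_pos F[of "s _"]])
  have "(\<lambda>n. F (s (r n)) z) \<longlonglongrightarrow> 0" if "z \<in> disc" for z
    using LIMSEQ_subseq_LIMSEQ[OF null[OF that] strict_mono_o[OF s(1) r]] by (simp add: comp_def)
  from compact_op_null_limit[OF T F[of "s (r _)"] this h lim] have "Lq_norm \<upsilon> q h = 0" by simp
  then have image_le: "Lq_norm \<upsilon> q (T (F (s (r n)))) \<le> Lq_norm \<upsilon> q (\<lambda>z. T (F (s (r n))) z - h z)" for n
    using Lq_norm_triangle[OF q_ge_1 compact_op_measurable[OF T F(1)] Lq_space_measurable[OF h], of "s (r n)"]
    by simp
  obtain n where "Lq_norm \<upsilon> q (\<lambda>z. T (F (s (r n))) z - h z) < e"
    using eventually_happens'[OF sequentially_bot order_tendstoD(2)[OF lim e(1)]] by blast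
  with image_le have "Lq_norm \<upsilon> q (T (F (s (r n)))) < e" by (rule le_less_trans)
  then show False using s(2) by simp
qed

lemma compact_op_add:
  assumes S: "compact_op \<omega> p \<upsilon> q S" and T: "compact_op \<omega> p \<upsilon> q T"
  shows "compact_op \<omega> p \<upsilon> q (\<lambda>f z. S f z + T f z)"
  unfolding compact_op_def
proof (intro conjI ballI allI impI)
  fix f assume "f \<in> Ap_space \<omega> p"
  then show "(\<lambda>z. S f z + T f z) \<in> Lq_space \<upsilon> q"
    by (intro Lq_space_add q_ge_1 compact_op_in_Lq[OF S] compact_op_in_Lq[OF T])
next
  fix f g a b assume fg: "f \<in> Ap_space \<omega> p" "g \<in> Ap_space \<omega> p"
  have "S (\<lambda>z. a * f z + b * g z) = (\<lambda>z. a * S f z + b * S g z)"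
    "T (\<lambda>z. a * f z + b * g z) = (\<lambda>z. a * T f z + b * T g z)"
    using S T fg unfolding compact_op_def by blast+
  then show "(\<lambda>z. S (\<lambda>z. a * f z + b * g z) z + T (\<lambda>z. a * f z + b * g z) z)
      = (\<lambda>z. a * (S f z + T f z) + b * (S g z + T g z))"
    by (simp add: fun_eq_iff algebra_simps)
next
  fix F assume "\<forall>n::nat. F n \<in> Ap_space \<omega> p \<and> Ap_norm \<omega> p (F n) \<le> 1"
  then have F: "F n \<in> Ap_space \<omega> p" "Ap_int \<omega> p (F n) \<le> 1" for n
    using Ap_norm_le_1_iff[OF p_pos] by auto
  obtain r g where r: "strict_mono r" and g: "g \<in> Lq_space \<upsilon> q"
    and lim_S: "(\<lambda>n. Lq_norm \<upsilon> q (\<lambda>z. S (F (r n)) z - g z)) \<longlonglongrightarrow> 0"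
    by (rule compact_op_subseq[OF S p_pos F])
  obtain t h where t: "strict_mono t" and h: "h \<in> Lq_space \<upsilon> q"
    and lim_T: "(\<lambda>n. Lq_norm \<upsilon> q (\<lambda>z. T (F (r (t n))) z - h z)) \<longlonglongrightarrow> 0"
    by (rule compact_op_subseq[OF T p_pos F[of "r _"]])
  have lim: "(\<lambda>n. Lq_norm \<upsilon> q (\<lambda>z. S (F (r (t n))) z - g z) + Lq_norm \<upsilon> q (\<lambda>z. T (F (r (t n))) z - h z))
      \<longlonglongrightarrow> 0 + 0"
    using LIMSEQ_subseq_LIMSEQ[OF lim_S t] lim_T by (intro tendsto_add) (simp_all add: comp_def)
  have "(\<lambda>n. Lq_norm \<upsilon> q (\<lambda>z. S (F (r (t n))) z + T (F (r (t n))) z - (g z + h z))) \<longlonglongrightarrow> 0"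
  proof (rule tendsto_sandwich[OF _ _ tendsto_const lim[unfolded add_0]])
    have "Lq_norm \<upsilon> q (\<lambda>z. S f z + T f z - (g z + h z))
        \<le> Lq_norm \<upsilon> q (\<lambda>z. S f z - g z) + Lq_norm \<upsilon> q (\<lambda>z. T f z - h z)"
      if "f \<in> Ap_space \<omega> p" for f
      using Lq_norm_add_le[OF q_ge_1, of "\<lambda>z. S f z - g z" "\<lambda>z. T f z - h z"]
        compact_op_measurable[OF S that] compact_op_measurable[OF T that]
        Lq_space_measurable[OF g] Lq_space_measurable[OF h]
      by (simp add: algebra_simps)
    then show "\<forall>\<^sub>F n in sequentially. Lq_norm \<upsilon> q (\<lambda>z. S (F (r (t n))) z + T (F (r (t n))) z - (g z + h z))
        \<le> Lq_norm \<upsilon> q (\<lambda>z. S (F (r (t n))) z - g z) + Lq_norm \<upsilon> q (\<lambda>z. T (F (r (t n))) z - h z)"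
      using F by simp
  qed simp
  then show "\<exists>r h. strict_mono r \<and> h \<in> Lq_space \<upsilon> q
      \<and> (\<lambda>n. Lq_norm \<upsilon> q (\<lambda>z. S (F (r n)) z + T (F (r n)) z - h z)) \<longlonglongrightarrow> 0"
    by (intro exI[of _ "r \<circ> t"] exI[of _ "\<lambda>z. g z + h z"] conjI)
      (use strict_mono_o[OF r t] Lq_space_add[OF q_ge_1 g h] in \<open>auto simp: comp_def\<close>)
qed

lemma compact_op_test_fun_small:
  assumes T: "compact_op \<omega> p \<upsilon> q T" and j: "j \<le> 2" and e: "0 < e"
  shows "\<forall>\<^sub>F r in at_left 1. \<forall>a. norm a = r \<longrightarrow> Lq_norm \<upsilon> q (T (test_fun j a)) \<le> e"
proof (rule sequentially_imp_eventually_at_left[of 0])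
  fix f :: "nat \<Rightarrow> real" assume f: "\<And>n. 0 < f n" "\<And>n. f n < 1" "f \<longlonglongrightarrow> 1"
  have "\<forall>n. \<exists>a. norm a = f n \<and> (Lq_norm \<upsilon> q (T (test_fun j a)) \<le> e
      \<longrightarrow> (\<forall>b. norm b = f n \<longrightarrow> Lq_norm \<upsilon> q (T (test_fun j b)) \<le> e))"
  proof
    fix n
    have "norm (of_real (f n) :: complex) = f n" using f(1)[of n] by simp
    then show "\<exists>a. norm a = f n \<and> (Lq_norm \<upsilon> q (T (test_fun j a)) \<le> e
      \<longrightarrow> (\<forall>b. norm b = f n \<longrightarrow> Lq_norm \<upsilon> q (T (test_fun j b)) \<le> e))" by blast
  qed
  from choice[OF this] obtain a where a: "\<And>n. norm (a n) = f n"
    and worst: "\<And>n b. Lq_norm \<upsilon> q (T (test_fun j (a n))) \<le> e \<Longrightarrow> norm b = f n \<Longrightarrow>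
        Lq_norm \<upsilon> q (T (test_fun j b)) \<le> e"
    by blast
  have mem: "test_fun j (a n) \<in> Ap_space \<omega> p" and le_1: "Ap_int \<omega> p (test_fun j (a n)) \<le> 1" for n
    using f(2)[of n] a Ap_int_test_fun_le[OF j, of "a n"]
    by (auto intro!: Ap_space_if_Ap_int_le[where c = 1] test_fun_holomorphic)
  have "(\<lambda>n. Lq_norm \<upsilon> q (T (test_fun j (a n)))) \<longlonglongrightarrow> 0"
    using f a by (intro compact_op_null[OF T] mem le_1 test_fun_tendsto_0) auto
  then have "\<forall>\<^sub>F n in sequentially. Lq_norm \<upsilon> q (T (test_fun j (a n))) < e"
    using e by (rule order_tendstoD)
  then show "\<forall>\<^sub>F n in sequentially. \<forall>b. norm b = f n \<longrightarrow> Lq_norm \<upsilon> q (T (test_fun j b)) \<le> e"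
    by eventually_elim (use worst in \<open>auto dest: less_imp_le\<close>)
qed simp

end

section \<open>Truncated operators\<close>

definition trunc_wC :: "real \<Rightarrow> (complex \<Rightarrow> complex) \<Rightarrow> (complex \<Rightarrow> complex) \<Rightarrow> opr" where
  "trunc_wC R u \<tau> g z = (if z \<in> disc \<and> norm (\<tau> z) \<le> R then wC u \<tau> g z else 0)"

lemma holomorphic_higher_deriv_disc: "f holomorphic_on disc \<Longrightarrow> (deriv ^^ k) f holomorphic_on disc"
  by (rule holomorphic_higher_deriv[OF _ open_disc])

lemma higher_deriv_linear_disc:
  assumes "f holomorphic_on disc" "g holomorphic_on disc" "z \<in> disc"
  shows "(deriv ^^ k) (\<lambda>z. a * f z + b * g z) z = a * (deriv ^^ k) f z + b * (deriv ^^ k) g z"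
proof -
  have "(\<lambda>z. a * f z) holomorphic_on disc" "(\<lambda>z. b * g z) holomorphic_on disc"
    using assms by (auto intro!: holomorphic_intros)
  then show ?thesis
    using assms by (simp add: higher_deriv_add[OF _ _ open_disc] higher_deriv_cmult[OF _ _ open_disc])
qed

lemma wC_measurable:
  assumes "u holomorphic_on disc" "self_map \<tau>" "g holomorphic_on disc"
  shows "wC u \<tau> g \<in> borel_measurable (restrict_space borel disc)"
proof (rule holomorphic_on_disc_measurable)
  have "(\<lambda>z. g (\<tau> z)) holomorphic_on disc"
    using holomorphic_on_compose_gen[of \<tau> disc g disc] assms by (auto simp: self_map_def comp_def)
  then show "wC u \<tau> g holomorphic_on disc"
    unfolding wC_def by (intro holomorphic_intros assms)
qed

lemma trunc_wC_measurable:
  assumes "u holomorphic_on disc" and \<tau>: "self_map \<tau>" and "g holomorphic_on disc"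
  shows "trunc_wC R u \<tau> g \<in> borel_measurable borel"
proof -
  have [measurable]: "\<tau> \<in> borel_measurable (restrict_space borel disc)"
    using \<tau> by (simp add: self_map_def holomorphic_on_disc_measurable)
  have [measurable]: "wC u \<tau> g \<in> borel_measurable (restrict_space borel disc)"
    by (rule wC_measurable[OF assms])
  have "(\<lambda>z. if norm (\<tau> z) \<le> R then wC u \<tau> g z else 0) \<in> borel_measurable (restrict_space borel disc)"
    by measurable
  then have "(\<lambda>z. indicator disc z *\<^sub>R (if norm (\<tau> z) \<le> R then wC u \<tau> g z else 0)) \<in> borel_measurable borel"
    by (subst (asm) borel_measurable_restrict_space_iff) auto
  moreover have "(\<lambda>z. indicator disc z *\<^sub>R (if norm (\<tau> z) \<le> R then wC u \<tau> g z else 0)) = trunc_wC R u \<tau> g"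
    by (auto simp: trunc_wC_def fun_eq_iff)
  ultimately show ?thesis by simp
qed

lemma trunc_wC_diff: "trunc_wC R u \<tau> g z - trunc_wC R u \<tau> h z = trunc_wC R u \<tau> (\<lambda>w. g w - h w) z"
  by (simp add: trunc_wC_def wC_def algebra_simps)

lemma trunc_wC_higher_deriv_linear:
  assumes "self_map \<tau>" "f holomorphic_on disc" "g holomorphic_on disc"
  shows "trunc_wC R u \<tau> ((deriv ^^ k) (\<lambda>z. a * f z + b * g z))
    = (\<lambda>z. a * trunc_wC R u \<tau> ((deriv ^^ k) f) z + b * trunc_wC R u \<tau> ((deriv ^^ k) g) z)"
proof
  fix z
  have "\<tau> z \<in> disc" if "z \<in> disc"
    using assms(1) that by (auto simp: self_map_def)
  then show "trunc_wC R u \<tau> ((deriv ^^ k) (\<lambda>z. a * f z + b * g z)) z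
      = a * trunc_wC R u \<tau> ((deriv ^^ k) f) z + b * trunc_wC R u \<tau> ((deriv ^^ k) g) z"
    by (simp add: trunc_wC_def wC_def higher_deriv_linear_disc[OF assms(2,3)] algebra_simps)
qed

lemma (in bergman_regular) higher_deriv_convergent_subseq:
  assumes F: "\<And>n. F n holomorphic_on disc" "\<And>n. Ap_int \<omega> p (F n) \<le> 1"
  obtains g r where "g holomorphic_on disc" "strict_mono (r::nat \<Rightarrow> nat)"
    "\<And>R. R < 1 \<Longrightarrow> uniform_limit (cball 0 R) (\<lambda>n. (deriv ^^ k) (F (r n))) g sequentially"
proof -
  define H where "H = {(deriv ^^ k) f |f. f holomorphic_on disc \<and> Ap_int \<omega> p f \<le> 1}"
  obtain g r where g: "g holomorphic_on disc" and r: "strict_mono (r::nat \<Rightarrow> nat)"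
    and lim: "\<And>K. compact K \<Longrightarrow> K \<subseteq> disc \<Longrightarrow> uniform_limit K ((\<lambda>n. (deriv ^^ k) (F n)) \<circ> r) g sequentially"
  proof (rule Montel[OF open_disc, of H "\<lambda>n. (deriv ^^ k) (F n)"])
    show "h holomorphic_on disc" if "h \<in> H" for h
      using that by (auto simp: H_def intro: holomorphic_higher_deriv_disc)
    show "\<exists>B. \<forall>h\<in>H. \<forall>z\<in>K. norm (h z) \<le> B" if K: "compact K" "K \<subseteq> disc" for K
    proof (cases "K = {}")
      case False
      obtain w where w: "w \<in> K" "\<And>z. z \<in> K \<Longrightarrow> norm z \<le> norm w"
        using continuous_attains_sup[OF K(1) False continuous_on_norm_id] by blast
      then have "norm w < 1" using K(2) by (auto simp: mem_disc_iff)
      from Ap_ball_locally_bounded[OF this, of k] obtain B where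
        "\<And>f z. f holomorphic_on disc \<Longrightarrow> Ap_int \<omega> p f \<le> 1 \<Longrightarrow> norm z \<le> norm w \<Longrightarrow> norm ((deriv ^^ k) f z) \<le> B"
        by blast
      then show ?thesis using w unfolding H_def by blast
    qed simp
    show "range (\<lambda>n. (deriv ^^ k) (F n)) \<subseteq> H" using F by (auto simp: H_def)
  qed blast
  have "uniform_limit (cball 0 R) (\<lambda>n. (deriv ^^ k) (F (r n))) g sequentially" if "R < 1" for R
    using lim[of "cball 0 R"] that by (simp add: comp_def subset_eq mem_disc_iff)
  then show thesis using that[OF g r] by blast
qed

locale bergman_regular_Lq = bergman_regular + bergman_Lq +
  assumes p_le_q: "p \<le> q"
begin

lemma Lq_norm_trunc_wC_le:
  assumes u: "u holomorphic_on disc" and g: "\<And>w. norm w \<le> R \<Longrightarrow> norm (g w) \<le> d" and d: "0 \<le> d"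
  shows "Lq_norm \<upsilon> q (trunc_wC R u \<tau> g) \<le> ennreal d * Lq_norm \<upsilon> q u"
proof -
  have "Lq_norm \<upsilon> q (trunc_wC R u \<tau> g) \<le> Lq_norm \<upsilon> q (\<lambda>z. of_real d * u z)"
  proof (intro Lq_norm_mono q_pos)
    fix z
    show "norm (trunc_wC R u \<tau> g z) \<le> norm (of_real d * u z)"
      using mult_left_mono[OF g[of "\<tau> z"], of "norm (u z)"] d
      by (auto simp: trunc_wC_def wC_def norm_mult mult.commute)
  qed
  then show ?thesis
    using d by (simp add: Lq_norm_cmult q_pos holomorphic_on_disc_measurable[OF u])
qed

lemma trunc_wC_in_Lq:
  assumes u: "u holomorphic_on disc" "Lq_norm \<upsilon> q u < \<infinity>" and "self_map \<tau>" and g: "g holomorphic_on disc"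
    and R: "R < 1"
  shows "trunc_wC R u \<tau> g \<in> Lq_space \<upsilon> q"
proof -
  have "cball 0 R \<subseteq> disc" using R by (auto simp: mem_disc_iff)
  then have "bounded (g ` cball 0 R)"
    by (intro compact_imp_bounded compact_continuous_image compact_cball
        continuous_on_subset[OF holomorphic_on_imp_continuous_on[OF g]])
  then obtain B where B: "0 < B" "\<And>w. norm w \<le> R \<Longrightarrow> norm (g w) \<le> B"
    unfolding bounded_pos by auto
  have "Lq_norm \<upsilon> q (trunc_wC R u \<tau> g) \<le> ennreal B * Lq_norm \<upsilon> q u"
    using B by (intro Lq_norm_trunc_wC_le u) auto
  also have "\<dots> < \<infinity>" using u(2) by (simp add: ennreal_mult_less_top)
  finally show ?thesis using trunc_wC_measurable[OF u(1) assms(3) g] by (simp add: Lq_space_iff)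
qed

lemma Lq_norm_trunc_wC_tendsto_0:
  assumes u: "u holomorphic_on disc" "Lq_norm \<upsilon> q u < \<infinity>"
    and lim: "uniform_limit (cball 0 R) G g sequentially"
  shows "(\<lambda>n. Lq_norm \<upsilon> q (\<lambda>z. trunc_wC R u \<tau> (G n) z - trunc_wC R u \<tau> g z)) \<longlonglongrightarrow> 0"
proof (rule order_tendstoI)
  fix e :: ennreal assume "0 < e"
  obtain b where b: "Lq_norm \<upsilon> q u = ennreal b" "0 \<le> b"
    using u(2) by (cases "Lq_norm \<upsilon> q u") auto
  obtain x where x: "0 < x" "x < e" using dense[OF \<open>0 < e\<close>] by blast
  then obtain c where c: "0 < c" "ennreal c < e" by (cases x) auto
  define d where "d = c / (b + 1)"
  have d: "0 < d" using b c by (simp add: d_def)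
  have "\<forall>\<^sub>F n in sequentially. \<forall>w\<in>cball 0 R. dist (G n w) (g w) < d"
    by (rule uniform_limitD[OF lim d])
  then show "\<forall>\<^sub>F n in sequentially. Lq_norm \<upsilon> q (\<lambda>z. trunc_wC R u \<tau> (G n) z - trunc_wC R u \<tau> g z) < e"
  proof eventually_elim
    case (elim n)
    have "Lq_norm \<upsilon> q (\<lambda>z. trunc_wC R u \<tau> (G n) z - trunc_wC R u \<tau> g z) \<le> ennreal d * Lq_norm \<upsilon> q u"
      unfolding trunc_wC_diff using elim d
      by (intro Lq_norm_trunc_wC_le[OF u(1), where g = "\<lambda>w. G n w - g w"])
        (auto simp: dist_norm less_imp_le)
    also have "\<dots> = ennreal (d * b)" using b d by (simp add: ennreal_mult)
    also have "\<dots> \<le> ennreal c" using b c by (intro ennreal_leI) (simp add: d_def field_simps)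
    finally show ?case using c(2) by (rule le_less_trans)
  qed
qed simp

lemma compact_op_trunc_wC:
  assumes u: "u holomorphic_on disc" "Lq_norm \<upsilon> q u < \<infinity>" and \<tau>: "self_map \<tau>" and R: "R < 1"
  shows "compact_op \<omega> p \<upsilon> q (\<lambda>f. trunc_wC R u \<tau> ((deriv ^^ k) f))"
  unfolding compact_op_def
proof (intro conjI ballI allI impI)
  fix f assume "f \<in> Ap_space \<omega> p"
  then show "trunc_wC R u \<tau> ((deriv ^^ k) f) \<in> Lq_space \<upsilon> q"
    by (intro trunc_wC_in_Lq u \<tau> R holomorphic_higher_deriv_disc) (simp add: Ap_space_def)
next
  fix f g a b assume "f \<in> Ap_space \<omega> p" "g \<in> Ap_space \<omega> p"
  then show "trunc_wC R u \<tau> ((deriv ^^ k) (\<lambda>z. a * f z + b * g z))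
      = (\<lambda>z. a * trunc_wC R u \<tau> ((deriv ^^ k) f) z + b * trunc_wC R u \<tau> ((deriv ^^ k) g) z)"
    by (intro trunc_wC_higher_deriv_linear \<tau>) (simp_all add: Ap_space_def)
next
  fix F assume "\<forall>n::nat. F n \<in> Ap_space \<omega> p \<and> Ap_norm \<omega> p (F n) \<le> 1"
  then have F: "F n holomorphic_on disc" "Ap_int \<omega> p (F n) \<le> 1" for n
    using Ap_norm_le_1_iff[OF p_pos] by (auto simp: Ap_space_def)
  obtain g r where g: "g holomorphic_on disc" and r: "strict_mono (r::nat \<Rightarrow> nat)"
    and lim: "\<And>R. R < 1 \<Longrightarrow> uniform_limit (cball 0 R) (\<lambda>n. (deriv ^^ k) (F (r n))) g sequentially"
    using higher_deriv_convergent_subseq[where k = k and F = F, OF F] by blast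
  show "\<exists>r h. strict_mono r \<and> h \<in> Lq_space \<upsilon> q
      \<and> (\<lambda>n. Lq_norm \<upsilon> q (\<lambda>z. trunc_wC R u \<tau> ((deriv ^^ k) (F (r n))) z - h z)) \<longlonglongrightarrow> 0"
    using r trunc_wC_in_Lq[OF u \<tau> g R] Lq_norm_trunc_wC_tendsto_0[OF u lim[OF R]] by blast
qed

end

section \<open>Separating the summands\<close>

lemma sum_lessThan_2: "(\<Sum>i<2. f i) = f 0 + f (1::nat)"
  by (simp add: numeral_2_eq_2)

lemma separation_identity:
  fixes X Y s t :: "'a::comm_ring_1" and m :: nat
  defines "V \<equiv> \<lambda>j. X * s ^ j + of_nat (m + j) * Y * t ^ j"
  shows "X * s\<^sup>2 = of_nat ((m + 2) * (m + 1)) * (s * t) * V 0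
      - of_nat (m + 2) * (of_nat (m + 1) * t + of_nat m * s) * V 1 + of_nat ((m + 1)\<^sup>2) * V 2"
    and "Y * t\<^sup>2 = (of_nat (m + 1) * t + of_nat m * s) * V 1 - of_nat (m + 1) * (s * t) * V 0 - of_nat m
        * V 2"
  by (simp_all add: V_def power2_eq_square algebra_simps)

lemma norm_combination3_le:
  fixes a b c x y z :: "'a::real_normed_algebra"
  assumes "norm a \<le> B" "norm b \<le> B" "norm c \<le> B"
  shows "norm (a * x + b * y + c * z) \<le> B * (norm x + norm y + norm z)"
proof -
  have "norm (a * x + b * y + c * z) \<le> norm a * norm x + norm b * norm y + norm c * norm z"
    by (intro norm_triangle_mono norm_mult_ineq)
  also have "\<dots> \<le> B * norm x + B * norm y + B * norm z"
    using assms by (intro add_mono mult_right_mono) auto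
  finally show ?thesis by (simp add: distrib_left)
qed

text \<open>The vectors \<open>(1, s, s\<^sup>2)\<close> and \<open>(m, (m+1) t, (m+2) t\<^sup>2)\<close> are never parallel, because
  \<open>(m+1)\<^sup>2 \<noteq> m (m+2)\<close>; hence three exponents suffice to separate the two summands of the operator.\<close>

lemma separation_bound:
  fixes X Y s t :: complex and m :: nat
  assumes s: "norm s \<le> 2" and t: "norm t \<le> 2"
  defines "S \<equiv> \<Sum>j<3. norm (X * s ^ j + of_nat (m + j) * Y * t ^ j)"
  shows "norm X * (norm s)\<^sup>2 \<le> 4 * (real m + 2)\<^sup>2 * S" and "norm Y * (norm t)\<^sup>2 \<le> 4 * (real m + 2)\<^sup>2 * S"
proof -
  define V where "V j = X * s ^ j + of_nat (m + j) * Y * t ^ j" for j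
  define B where "B = 4 * (real m + 2)\<^sup>2"
  define P where "P = s * t"
  define L where "L = of_nat (m + 1) * t + of_nat m * s"
  have S: "S = norm (V 0) + norm (V 1) + norm (V 2)"
    unfolding S_def V_def[symmetric] by (simp add: numeral_3_eq_3 numeral_2_eq_2)
  have "norm P \<le> 2 * 2"
    unfolding P_def norm_mult using s t by (intro mult_mono) auto
  moreover have "norm L \<le> real (m + 1) * 2 + real m * 2"
    unfolding L_def using s t
    by (intro norm_triangle_mono) (simp_all only: norm_mult norm_of_nat mult_left_mono of_nat_0_le_iff)
  ultimately have "norm (of_nat ((m + 2) * (m + 1)) * P) \<le> real ((m + 2) * (m + 1)) * 4"
    "norm (of_nat (m + 1) * P) \<le> real (m + 1) * 4"
    "norm L \<le> 4 * real m + 2" "norm (of_nat (m + 2) * L) \<le> real (m + 2) * (4 * real m + 2)"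
    unfolding norm_mult norm_of_nat by (simp_all only: mult_left_mono of_nat_0_le_iff) simp_all
  moreover have "real ((m + 2) * (m + 1)) * 4 \<le> B" "real (m + 1) * 4 \<le> B" "4 * real m + 2 \<le> B"
    "real (m + 2) * (4 * real m + 2) \<le> B" "real ((m + 1)\<^sup>2) \<le> B" "real m \<le> B"
    by (simp_all add: B_def power2_eq_square algebra_simps)
  ultimately have bounds: "norm (of_nat ((m + 2) * (m + 1)) * P) \<le> B" "norm (- (of_nat (m + 2) * L)) \<le> B"
    "norm (of_nat ((m + 1)\<^sup>2) :: complex) \<le> B" "norm (- (of_nat (m + 1) * P)) \<le> B" "norm L \<le> B"
    "norm (- of_nat m :: complex) \<le> B"
    unfolding norm_minus_cancel norm_of_nat by linarith+
  have "X * s\<^sup>2 = of_nat ((m + 2) * (m + 1)) * P * V 0 + - (of_nat (m + 2) * L) * V 1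
      + of_nat ((m + 1)\<^sup>2) * V 2"
    using separation_identity(1)[where X=X and Y=Y and s=s and t=t and m=m]
    by (simp only: V_def P_def L_def) (simp add: algebra_simps)
  then have "norm (X * s\<^sup>2) \<le> B * S"
    using norm_combination3_le[OF bounds(1-3), of "V 0" "V 1" "V 2"] by (simp only: S)
  then show "norm X * (norm s)\<^sup>2 \<le> 4 * (real m + 2)\<^sup>2 * S"
    by (simp only: norm_mult norm_power B_def)
  have "Y * t\<^sup>2 = - (of_nat (m + 1) * P) * V 0 + L * V 1 + - of_nat m * V 2"
    using separation_identity(2)[where X=X and Y=Y and s=s and t=t and m=m]
    by (simp only: V_def P_def L_def) (simp add: algebra_simps)
  then have "norm (Y * t\<^sup>2) \<le> B * S"
    using norm_combination3_le[OF bounds(4-6), of "V 0" "V 1" "V 2"] by (simp only: S)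
  then show "norm Y * (norm t)\<^sup>2 \<le> 4 * (real m + 2)\<^sup>2 * S"
    by (simp only: norm_mult norm_power B_def)
qed

definition separation_const :: "nat \<Rightarrow> real" where
  "separation_const m = 16 * (real m + 2)\<^sup>2 * (3/2) ^ (m + 3)"

lemma separation_const_pos: "0 < separation_const m"
  by (simp add: separation_const_def)

lemma le_if_mult_power_le:
  fixes r y B :: real
  assumes "2/3 \<le> r" "0 \<le> y" "y * r ^ n \<le> B"
  shows "y \<le> (3/2) ^ n * B"
proof -
  have "1 \<le> (3/2 * r) ^ n" using assms by (intro one_le_power) simp
  then have "y * 1 \<le> y * (3/2 * r) ^ n" using assms by (intro mult_left_mono)
  also have "\<dots> = (3/2) ^ n * (y * r ^ n)" by (simp only: power_mult_distrib mult_ac)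
  also have "\<dots> \<le> (3/2) ^ n * B" using assms by (intro mult_left_mono) auto
  finally show ?thesis by simp
qed

lemma div_one_minus_square_ge:
  fixes r :: real
  assumes "1/2 \<le> r" "r < 1"
  shows "1 / (4 * (1 - r)) \<le> r / (1 - r\<^sup>2)"
proof -
  have "1 - r\<^sup>2 = (1 + r) * (1 - r)" by (simp add: power2_eq_square algebra_simps)
  moreover have "\<dots> \<le> 2 * (1 - r)" using assms by (intro mult_right_mono) auto
  ultimately have "(1/2) / (2 * (1 - r)) \<le> r / (1 - r\<^sup>2)"
    using assms by (intro frac_le) (auto intro: mult_pos_pos)
  then show ?thesis by simp
qed

lemma peak_fun_power_combination:
  fixes b z :: "nat \<Rightarrow> complex" and m j :: nat
  assumes "norm a < 1" "norm (z 1) < 1"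
  shows "(\<Sum>i<2. b i * (deriv ^^ i) (\<lambda>z. peak_fun a z ^ (m + j)) (z i))
    = (b 0 * peak_fun a (z 0) ^ m) * peak_fun a (z 0) ^ j
      + of_nat (m + j) * (b 1 * (cnj a / of_real (1 - (norm a)\<^sup>2)) * peak_fun a (z 1) ^ Suc m)
          * peak_fun a (z 1) ^ j"
proof -
  define t where "t = peak_fun a (z 1)"
  define D where "D = 1 - (norm a)\<^sup>2"
  note deriv = deriv_peak_fun_power[OF assms, folded t_def D_def]
  show ?thesis
    unfolding sum_lessThan_2 t_def[symmetric] D_def[symmetric]
    by (simp add: deriv[simplified]) (simp add: power_add)
qed

lemma weights_le_peak_fun_powers:
  fixes b z :: "nat \<Rightarrow> complex" and m :: nat
  assumes a: "1/2 \<le> norm a" "norm a < 1" and z: "\<And>i. i < 2 \<Longrightarrow> norm (z i) < 1"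
    and k: "k < 2" "dist a (z k) < (1 - norm a) / 2"
  defines "S \<equiv> \<Sum>j<3. norm (\<Sum>i<2. b i * (deriv ^^ i) (\<lambda>z. peak_fun a z ^ (m + j)) (z i))"
  shows "norm (b k) \<le> separation_const m * (1 - norm a) ^ k * S"
proof -
  define s where "s = peak_fun a (z 0)"
  define t where "t = peak_fun a (z 1)"
  define D where "D = 1 - (norm a)\<^sup>2"
  define X where "X = b 0 * s ^ m"
  define Y where "Y = b 1 * (cnj a / of_real D) * t ^ Suc m"
  define B where "B = 4 * (real m + 2)\<^sup>2 * S"
  have S: "S = (\<Sum>j<3. norm (X * s ^ j + of_nat (m + j) * Y * t ^ j))"
    using z by (simp only: S_def peak_fun_power_combination[OF a(2)] X_def Y_def s_def t_def D_def)
  then have "0 \<le> S" by (simp add: sum_nonneg)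
  note bound = separation_bound[where X=X and Y=Y and s=s and t=t and m=m, folded S B_def]
  have st: "norm s \<le> 2" "norm t \<le> 2"
    by (simp_all add: s_def t_def norm_peak_fun_le(2) a z)
  consider "k = 0" | "k = 1" using k(1) by linarith
  then show ?thesis
  proof cases
    case 1
    have "norm (b 0) * norm s ^ (m + 2) \<le> B"
      using bound(1)[OF st] by (simp add: X_def norm_mult norm_power power_add power2_eq_square mult_ac)
    moreover have "2/3 \<le> norm s"
      using norm_peak_fun_ge[OF a(2)] k 1 by (simp add: s_def)
    ultimately have "norm (b 0) \<le> (3/2) ^ (m + 2) * B"
      by (intro le_if_mult_power_le norm_ge_zero)
    also have "\<dots> \<le> separation_const m * S"
      using \<open>0 \<le> S\<close> by (simp add: separation_const_def B_def power_add power3_eq_cube power2_eq_square)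
    finally show ?thesis using 1 by simp
  next
    case 2
    have D: "0 < D" using a by (simp add: D_def power_less_one_iff)
    have "norm (b 1) * (norm a / D) * norm t ^ (m + 3) \<le> B"
      using bound(2)[OF st] D
      by (simp add: Y_def norm_mult norm_divide norm_power power_add power2_eq_square power3_eq_cube
        mult_ac)
    moreover have "2/3 \<le> norm t"
      using norm_peak_fun_ge[OF a(2)] k 2 by (simp add: t_def)
    ultimately have "norm (b 1) * (norm a / D) \<le> (3/2) ^ (m + 3) * B"
      using D by (intro le_if_mult_power_le[of "norm t"]) auto
    moreover have "norm (b 1) * (1 / (4 * (1 - norm a))) \<le> norm (b 1) * (norm a / D)"
      unfolding D_def by (intro mult_left_mono div_one_minus_square_ge a) simp
    ultimately have "norm (b 1) * (1 / (4 * (1 - norm a))) \<le> (3/2) ^ (m + 3) * B"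
      by linarith
    then show ?thesis
      using 2 a by (simp add: separation_const_def B_def field_simps)
  qed
qed

section \<open>Weighted push-forward measures\<close>

context disc_measure
begin

definition push_measure :: "real \<Rightarrow> (complex \<Rightarrow> complex) \<Rightarrow> (complex \<Rightarrow> complex) \<Rightarrow> complex measure" where
  "push_measure q u \<tau> = distr (density (restrict_space \<upsilon> disc) (\<lambda>z. ennreal (norm (u z) powr q)))
     (restrict_space borel disc) \<tau>"

lemma sets_push_measure: "sets (push_measure q u \<tau>) = sets (restrict_space borel disc)"
  by (simp add: push_measure_def)

lemma nn_integral_push_measure:
  assumes u: "u holomorphic_on disc" and \<tau>: "self_map \<tau>"
    and F: "F \<in> borel_measurable (restrict_space borel disc)"
  shows "(\<integral>\<^sup>+w. F w \<partial>push_measure q u \<tau>) = (\<integral>\<^sup>+z\<in>disc. ennreal (norm (u z) powr q) * F (\<tau> z) \<partial>\<upsilon>)"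
proof -
  have \<tau>': "\<tau> \<in> restrict_space borel disc \<rightarrow>\<^sub>M restrict_space borel disc"
    using \<tau> by (intro measurable_restrict_space2 holomorphic_on_disc_measurable) (auto simp: self_map_def)
  have u': "(\<lambda>z. ennreal (norm (u z) powr q)) \<in> borel_measurable (restrict_space \<upsilon> disc)"
    using borel_measurable_norm_powr[OF holomorphic_on_disc_measurable[OF u]]
    by (simp add: measurable_restrict_measure)
  have "\<tau> \<in> density (restrict_space \<upsilon> disc) (\<lambda>z. ennreal (norm (u z) powr q)) \<rightarrow>\<^sub>M restrict_space borel disc"
    using \<tau>' by (simp add: measurable_cong_sets[OF sets_restrict_measure refl])
  moreover have "(\<lambda>z. F (\<tau> z)) \<in> borel_measurable (restrict_space \<upsilon> disc)"
    using measurable_compose[OF \<tau>' F] by (simp add: measurable_restrict_measure)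
  ultimately show ?thesis
    using F u' unfolding push_measure_def
    by (simp add: nn_integral_distr nn_integral_density nn_integral_restrict_space[OF disc_in_measure])
qed

lemma finite_measure_push_measure:
  assumes "u holomorphic_on disc" "self_map \<tau>" "Lq_norm \<upsilon> q u < \<infinity>"
  shows "finite_measure (push_measure q u \<tau>)"
proof (rule finite_measureI)
  have "emeasure (push_measure q u \<tau>) (space (push_measure q u \<tau>)) = Lq_int \<upsilon> q u"
    using nn_integral_push_measure[OF assms(1,2), of "\<lambda>_. 1" q] by (simp add: Lq_int_def)
  then show "emeasure (push_measure q u \<tau>) (space (push_measure q u \<tau>)) \<noteq> \<infinity>"
    using assms(3) by (simp add: Lq_norm_def root_enn_less_top_iff[unfolded infinity_ennreal_def])
qed

lemma emeasure_push_measure_le: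
  assumes u: "u holomorphic_on disc" and \<tau>: "self_map \<tau>" and E: "E \<in> sets (restrict_space borel disc)"
    and q: "0 < q" and c: "0 \<le> c" "Lq_norm \<upsilon> q (\<lambda>z. indicator E (\<tau> z) * u z) \<le> ennreal c"
  shows "emeasure (push_measure q u \<tau>) E \<le> ennreal (c powr q)"
proof -
  have "emeasure (push_measure q u \<tau>) E = (\<integral>\<^sup>+w. indicator E w \<partial>push_measure q u \<tau>)"
    using E by (simp add: sets_push_measure)
  also have "\<dots> = Lq_int \<upsilon> q (\<lambda>z. indicator E (\<tau> z) * u z)"
    unfolding Lq_int_def using E
    by (subst nn_integral_push_measure[OF u \<tau>]) (auto intro!: nn_integral_cong simp: indicator_def)
  also have "\<dots> \<le> ennreal (c powr q)"
    using c q by (simp add: Lq_norm_def root_enn_le_iff)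
  finally show ?thesis .
qed

lemma Lq_norm_wC_diff_trunc_wC:
  assumes u: "u holomorphic_on disc" and \<tau>: "self_map \<tau>" and g: "g holomorphic_on disc"
  shows "Lq_norm \<upsilon> q (\<lambda>z. wC u \<tau> g z - trunc_wC R u \<tau> g z)
    = root_enn (\<integral>\<^sup>+w\<in>{w. R < norm w}. ennreal (norm (g w) powr q) \<partial>push_measure q u \<tau>) q"
proof -
  have "{w. R < norm w} \<in> sets (borel :: complex measure)"
    by (intro borel_open open_Collect_less continuous_intros)
  then have "(\<lambda>w. ennreal (norm (g w) powr q) * indicator {w. R < norm w} w)
      \<in> borel_measurable (restrict_space borel disc)"
    by (intro borel_measurable_times_ennreal borel_measurable_norm_powr holomorphic_on_disc_measurable g
        measurable_restrict_space1[OF borel_measurable_indicator])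
  then have "(\<integral>\<^sup>+w\<in>{w. R < norm w}. ennreal (norm (g w) powr q) \<partial>push_measure q u \<tau>)
      = (\<integral>\<^sup>+z\<in>disc. ennreal (norm (u z) powr q)
          * (ennreal (norm (g (\<tau> z)) powr q) * indicator {w. R < norm w} (\<tau> z)) \<partial>\<upsilon>)"
    by (rule nn_integral_push_measure[OF u \<tau>])
  also have "\<dots> = Lq_int \<upsilon> q (\<lambda>z. wC u \<tau> g z - trunc_wC R u \<tau> g z)"
    unfolding Lq_int_def
    by (intro nn_integral_cong)
      (auto simp: trunc_wC_def wC_def norm_mult powr_mult ennreal_mult indicator_def)
  finally show ?thesis by (simp add: Lq_norm_def)
qed

end

section \<open>Essential norms\<close>

definition sum_op :: "(nat \<Rightarrow> complex \<Rightarrow> complex) \<Rightarrow> (nat \<Rightarrow> complex \<Rightarrow> complex) \<Rightarrow> opr" where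
  "sum_op u \<tau> f z = (\<Sum>k<2. wC (u k) (\<tau> k) ((deriv ^^ k) f) z)"

lemma (in bergman_doubling) Ap_space_if_bounded_by_1:
  assumes f: "f holomorphic_on disc" "\<And>z. z \<in> disc \<Longrightarrow> norm (f z) \<le> 1"
  shows "f \<in> Ap_space \<omega> p"
proof -
  have "Ap_int \<omega> p f = (\<integral>\<^sup>+z. ennreal (norm (f z) powr p) \<partial>bergman_measure \<omega>)"
    by (rule Ap_int_eq_nn_integral[OF omega_measurable_Ico holomorphic_on_disc_measurable[OF f(1)]])
  also have "\<dots> \<le> (\<integral>\<^sup>+z. 1 \<partial>bergman_measure \<omega>)"
    using f(2) p_pos by (intro nn_integral_mono) (auto intro: powr_le1)
  also have "\<dots> < \<infinity>"
    using emeasure_bergman_measure_finite by simp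
  finally show ?thesis using f by (simp add: Ap_space_def)
qed

context bergman_regular
begin

definition weight_const :: real where
  "weight_const = separation_const test_exponent * test_const powr (1 / p)"

definition ess_const :: "real \<Rightarrow> nat \<Rightarrow> real" where
  "ess_const q k = carleson_const q k powr (1 / q) * (3 * weight_const)"

lemma weight_const_pos: "0 < weight_const"
  using separation_const_pos test_const_pos by (simp add: weight_const_def)

lemma ess_const_pos: "0 < ess_const q k"
  using carleson_const_pos[of q k] weight_const_pos by (simp add: ess_const_def)

end

lemma le_cmult_INF_ennreal:
  fixes c :: ennreal
  assumes c: "0 < c" "c < top" and bound: "\<And>x. x \<in> X \<Longrightarrow> a \<le> c * f x"
  shows "a \<le> c * (INF x\<in>X. f x)"
proof -
  have "a / c \<le> f x" if "x \<in> X" for x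
    using divide_le_posI_ennreal[OF c(1)] bound[OF that] by (simp add: mult.commute)
  then have "a / c * c \<le> (INF x\<in>X. f x) * c"
    by (intro mult_right_mono INF_greatest) auto
  moreover have "a / c * c = a"
    using c ennreal_mult_divide_eq[of c a] by (auto simp: ennreal_times_divide mult.commute)
  ultimately show ?thesis by (simp add: mult.commute)
qed

lemma INF_add_const_ennreal:
  fixes f :: "'i \<Rightarrow> ennreal"
  assumes "X \<noteq> {}"
  shows "(INF x\<in>X. f x + c) = (INF x\<in>X. f x) + c"
  using assms continuous_at_Inf_mono[of "\<lambda>x. x + c" "f ` X"]
    continuous_add[of "at_right (Inf (f ` X))", of "\<lambda>x. x" "\<lambda>x. c"]
  by (auto simp: mono_def image_comp)

lemma le_INF_add_INF_ennreal:
  fixes e :: ennreal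
  assumes bound: "\<And>x y. x \<in> X \<Longrightarrow> y \<in> Y \<Longrightarrow> e \<le> f x + g y"
  shows "e \<le> (INF x\<in>X. f x) + (INF y\<in>Y. g y)"
proof (cases "X = {} \<or> Y = {}")
  case False
  have "e \<le> (INF x\<in>X. f x) + g y" if "y \<in> Y" for y
    using INF_greatest[of X e "\<lambda>x. f x + g y"] bound[OF _ that] False by (simp add: INF_add_const_ennreal)
  then have "e \<le> (INF y\<in>Y. g y + (INF x\<in>X. f x))"
    by (intro INF_greatest) (simp add: add.commute)
  then show ?thesis
    using False by (simp add: INF_add_const_ennreal add.commute)
qed auto

lemma (in bergman_Lq) ess_norm_add_le:
  assumes S: "\<And>f. f \<in> Ap_space \<omega> p \<Longrightarrow> S f \<in> borel_measurable (restrict_space borel disc)"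
    and T: "\<And>f. f \<in> Ap_space \<omega> p \<Longrightarrow> T f \<in> borel_measurable (restrict_space borel disc)"
  shows "ess_norm \<omega> p \<upsilon> q (\<lambda>f z. S f z + T f z) \<le> ess_norm \<omega> p \<upsilon> q S + ess_norm \<omega> p \<upsilon> q T"
  unfolding ess_norm_def[of _ _ _ _ S] ess_norm_def[of _ _ _ _ T]
proof (rule le_INF_add_INF_ennreal)
  fix K L assume "K \<in> {K. compact_op \<omega> p \<upsilon> q K}" "L \<in> {K. compact_op \<omega> p \<upsilon> q K}"
  then have K: "compact_op \<omega> p \<upsilon> q K" and L: "compact_op \<omega> p \<upsilon> q L" by auto
  have "ess_norm \<omega> p \<upsilon> q (\<lambda>f z. S f z + T f z) \<le> op_norm \<omega> p \<upsilon> q (\<lambda>f z. S f z + T f z - (K f z + L f z))"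
    unfolding ess_norm_def by (intro INF_lower CollectI compact_op_add K L)
  also have "\<dots> \<le> op_norm \<omega> p \<upsilon> q (\<lambda>f z. S f z - K f z) + op_norm \<omega> p \<upsilon> q (\<lambda>f z. T f z - L f z)"
  proof (rule op_norm_le[OF p_pos])
    fix f assume f: "f holomorphic_on disc" "Ap_int \<omega> p f \<le> 1"
    have mem: "f \<in> Ap_space \<omega> p"
      using f by (intro Ap_space_if_Ap_int_le[where c = 1]) auto
    have "Lq_norm \<upsilon> q (\<lambda>z. S f z + T f z - (K f z + L f z))
        = Lq_norm \<upsilon> q (\<lambda>z. (S f z - K f z) + (T f z - L f z))"
      by (simp add: algebra_simps)
    also have "\<dots> \<le> Lq_norm \<upsilon> q (\<lambda>z. S f z - K f z) + Lq_norm \<upsilon> q (\<lambda>z. T f z - L f z)"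
      by (intro Lq_norm_add_le q_ge_1 borel_measurable_diff S T compact_op_measurable[OF K]
        compact_op_measurable[OF L] mem)
    also have "\<dots> \<le> op_norm \<omega> p \<upsilon> q (\<lambda>f z. S f z - K f z) + op_norm \<omega> p \<upsilon> q (\<lambda>f z. T f z - L f z)"
      using Lq_norm_le_op_norm[OF p_pos mem f(2), of \<upsilon> q "\<lambda>f z. S f z - K f z"]
        Lq_norm_le_op_norm[OF p_pos mem f(2), of \<upsilon> q "\<lambda>f z. T f z - L f z"] by (rule add_mono)
    finally show "Lq_norm \<upsilon> q (\<lambda>z. S f z + T f z - (K f z + L f z)) \<le> \<dots>" .
  qed
  finally show "ess_norm \<omega> p \<upsilon> q (\<lambda>f z. S f z + T f z)
      \<le> op_norm \<omega> p \<upsilon> q (\<lambda>f z. S f z - K f z) + op_norm \<omega> p \<upsilon> q (\<lambda>f z. T f z - L f z)" .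
qed

locale bounded_sum_op = bergman_regular_Lq +
  fixes u \<tau> :: "nat \<Rightarrow> complex \<Rightarrow> complex"
  assumes u_holomorphic: "k < 2 \<Longrightarrow> u k holomorphic_on disc"
    and self_map: "k < 2 \<Longrightarrow> self_map (\<tau> k)"
    and bounded: "bounded_op \<omega> p \<upsilon> q (sum_op u \<tau>)"
begin

lemma tau_in_disc: "k < 2 \<Longrightarrow> z \<in> disc \<Longrightarrow> \<tau> k z \<in> disc"
  using self_map[of k] by (auto simp: self_map_def)

lemma sum_op_measurable:
  assumes "f holomorphic_on disc"
  shows "sum_op u \<tau> f \<in> borel_measurable (restrict_space borel disc)"
  unfolding sum_op_def[abs_def] using assms
  by (intro borel_measurable_sum wC_measurable u_holomorphic self_map holomorphic_higher_deriv_disc) auto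

lemma Lq_norm_sum_op_finite:
  assumes f: "f \<in> Ap_space \<omega> p"
  shows "Lq_norm \<upsilon> q (sum_op u \<tau> f) < \<infinity>"
proof -
  obtain M where "Lq_norm \<upsilon> q (sum_op u \<tau> f) \<le> ennreal M * Ap_norm \<omega> p f"
    using bounded f unfolding bounded_op_def by blast
  also have "\<dots> < \<infinity>"
    using f
    by (simp add: Ap_norm_def Ap_space_def ennreal_mult_less_top
      root_enn_less_top_iff[unfolded infinity_ennreal_def])
  finally show ?thesis .
qed

lemma Lq_norm_u_finite:
  assumes k: "k < 2"
  shows "Lq_norm \<upsilon> q (u k) < \<infinity>"
proof -
  have measurable: "u i \<in> borel_measurable (restrict_space borel disc)" if "i < 2" for i
    by (rule holomorphic_on_disc_measurable[OF u_holomorphic[OF that]])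
  have "sum_op u \<tau> (\<lambda>_. 1) = u 0"
    by (simp add: sum_op_def fun_eq_iff wC_def sum_lessThan_2)
  then have u0: "Lq_norm \<upsilon> q (u 0) < \<infinity>"
    using Lq_norm_sum_op_finite[OF Ap_space_if_bounded_by_1, of "\<lambda>_. 1"] by simp
  have id_op: "sum_op u \<tau> (\<lambda>w. w) = (\<lambda>z. u 1 z - - wC (u 0) (\<tau> 0) (\<lambda>w. w) z)"
    by (simp add: sum_op_def fun_eq_iff wC_def sum_lessThan_2)
  have "Lq_norm \<upsilon> q (u 1) \<le> Lq_norm \<upsilon> q (sum_op u \<tau> (\<lambda>w. w)) + Lq_norm \<upsilon> q (\<lambda>z. - wC (u 0) (\<tau> 0) (\<lambda>w. w) z)"
    unfolding id_op
    by (intro Lq_norm_triangle q_ge_1 measurable borel_measurable_uminus wC_measurable u_holomorphic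
      self_map holomorphic_on_ident) auto
  also have "\<dots> \<le> Lq_norm \<upsilon> q (sum_op u \<tau> (\<lambda>w. w)) + Lq_norm \<upsilon> q (u 0)"
    using tau_in_disc[of 0]
    by (intro add_left_mono Lq_norm_mono q_pos)
      (auto simp: wC_def norm_mult mem_disc_iff mult_left_le less_imp_le)
  also have "\<dots> < \<infinity>"
    using u0 Lq_norm_sum_op_finite[OF Ap_space_if_bounded_by_1, of "\<lambda>w. w"]
    by (simp add: mem_disc_iff less_imp_le holomorphic_on_ident)
  finally have "Lq_norm \<upsilon> q (u 1) < \<infinity>" .
  with u0 show ?thesis using k by (auto simp: less_2_cases_iff)
qed

lemma norm_u_le_test_funs:
  assumes a: "1/2 \<le> norm a" "norm a < 1" and z: "z \<in> disc" and k: "k < 2"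
      "dist a (\<tau> k z) < (1 - norm a) / 2"
  shows "norm (u k z) \<le> weight_const * eval_gauge k (norm a) powr (1 / p)
      * (\<Sum>j<3. norm (sum_op u \<tau> (test_fun j a) z))"
proof -
  define W where "W = omega_hat \<omega> (norm a) * (1 - norm a)"
  define c where "c = (test_const * W) powr (- 1 / p)"
  define S where "S = (\<Sum>j<3. norm (\<Sum>i<2. u i z
      * (deriv ^^ i) (\<lambda>z. peak_fun a z ^ (test_exponent + j)) (\<tau> i z)))"
  have W: "0 < W" using a by (simp add: W_def omega_hat_pos)
  have "sum_op u \<tau> (test_fun j a) z
      = of_real c * (\<Sum>i<2. u i z * (deriv ^^ i) (\<lambda>z. peak_fun a z ^ (test_exponent + j)) (\<tau> i z))" for j
    unfolding sum_op_def wC_def test_fun_def[abs_def] c_def W_def[symmetric] sum_distrib_left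
    using tau_in_disc[OF _ z]
    by (intro sum.cong refl)
      (simp add: higher_deriv_cmult[OF peak_fun_power_holomorphic[OF a(2)] _ open_disc])
  then have "norm (sum_op u \<tau> (test_fun j a) z)
      = c * norm (\<Sum>i<2. u i z * (deriv ^^ i) (\<lambda>z. peak_fun a z ^ (test_exponent + j)) (\<tau> i z))" for j
    by (simp only: norm_mult norm_of_real) (simp add: c_def)
  then have sum: "(\<Sum>j<3. norm (sum_op u \<tau> (test_fun j a) z)) = c * S"
    by (simp only: S_def sum_distrib_left)
  have "eval_gauge k (norm a) powr (1 / p) = (1 - norm a) ^ k * W powr (1 / p)"
    using a W p_pos by (simp add: eval_gauge_def W_def powr_mult powr_powr powr_realpow)
  moreover have "test_const powr (1 / p) * W powr (1 / p) * c = 1"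
    using W test_const_pos by (simp add: c_def powr_mult powr_minus_divide)
  ultimately have "weight_const * eval_gauge k (norm a) powr (1 / p) * (c * S)
      = separation_const test_exponent * (1 - norm a) ^ k * S"
    by (simp add: weight_const_def mult_ac)
  moreover have "norm (u k z) \<le> separation_const test_exponent * (1 - norm a) ^ k * S"
    unfolding S_def using tau_in_disc[OF _ z]
    by (intro weights_le_peak_fun_powers[OF a, where b = "\<lambda>i. u i z" and z = "\<lambda>i. \<tau> i z"] k)
      (simp add: mem_disc_iff)
  ultimately show ?thesis by (simp only: sum)
qed

lemma Lq_norm_u_near_le:
  assumes a: "1/2 \<le> norm a" "norm a < 1" and k: "k < 2" and A: "0 \<le> A"
    and test: "\<And>j. j < 3 \<Longrightarrow> Lq_norm \<upsilon> q (sum_op u \<tau> (test_fun j a)) \<le> ennreal A"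
  shows "Lq_norm \<upsilon> q (\<lambda>z. indicator (ball a ((1 - norm a) / 2)) (\<tau> k z) * u k z)
    \<le> ennreal (3 * weight_const * A * eval_gauge k (norm a) powr (1 / p))"
proof -
  define c where "c = weight_const * eval_gauge k (norm a) powr (1 / p)"
  have c: "0 \<le> c" using weight_const_pos by (simp add: c_def)
  have measurable: "(\<lambda>z. of_real (norm (sum_op u \<tau> (test_fun j a) z)) :: complex)
      \<in> borel_measurable (restrict_space borel disc)" for j
    using sum_op_measurable[OF test_fun_holomorphic[OF a(2)]] by measurable
  have "Lq_norm \<upsilon> q (\<lambda>z. indicator (ball a ((1 - norm a) / 2)) (\<tau> k z) * u k z)
      \<le> Lq_norm \<upsilon> q (\<lambda>z. of_real c * (\<Sum>j<3. of_real (norm (sum_op u \<tau> (test_fun j a) z))))"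
  proof (intro Lq_norm_mono q_pos)
    fix z assume z: "z \<in> disc"
    have "norm (of_real c * (\<Sum>j<3. of_real (norm (sum_op u \<tau> (test_fun j a) z))) :: complex)
        = c * (\<Sum>j<3. norm (sum_op u \<tau> (test_fun j a) z))"
      using c by (simp add: norm_mult sum_nonneg flip: of_real_sum)
    then show "norm (indicator (ball a ((1 - norm a) / 2)) (\<tau> k z) * u k z)
        \<le> norm (of_real c * (\<Sum>j<3. of_real (norm (sum_op u \<tau> (test_fun j a) z))) :: complex)"
      using norm_u_le_test_funs[OF a z k] c by (auto simp: c_def indicator_def sum_nonneg)
  qed
  also have "\<dots> = ennreal c * Lq_norm \<upsilon> q (\<lambda>z. \<Sum>j<3. of_real (norm (sum_op u \<tau> (test_fun j a) z)))"
    using c measurable by (simp add: Lq_norm_cmult q_pos)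
  also have "\<dots> \<le> ennreal c * (\<Sum>j<3. Lq_norm \<upsilon> q (\<lambda>z. of_real (norm (sum_op u \<tau> (test_fun j a) z))))"
    unfolding Lq_norm_eq_Lp_seminorm using measurable
    by (intro mult_left_mono Lp_seminorm_sum_le q_ge_1) (simp_all add: measurable_restrict_measure)
  also have "\<dots> = ennreal c * (\<Sum>j<3. Lq_norm \<upsilon> q (sum_op u \<tau> (test_fun j a)))"
    by (simp add: Lq_norm_def Lq_int_def)
  also have "\<dots> \<le> ennreal c * (\<Sum>j<(3::nat). ennreal A)"
    using test by (intro mult_left_mono sum_mono) auto
  also have "\<dots> = ennreal (c * (3 * A))"
    using A c by (simp add: ennreal_mult)
  finally show ?thesis by (simp add: c_def mult_ac)
qed

lemma ess_norm_summand_le: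
  assumes k: "k < 2" and R: "1/2 \<le> R" "R < 1" and A: "0 \<le> A"
    and test: "\<And>j a. j < 3 \<Longrightarrow> R \<le> norm a \<Longrightarrow> norm a < 1 \<Longrightarrow> Lq_norm \<upsilon> q (sum_op u \<tau> (test_fun j a)) \<le> ennreal A"
  shows "ess_norm \<omega> p \<upsilon> q (\<lambda>f. wC (u k) (\<tau> k) ((deriv ^^ k) f)) \<le> ennreal (ess_const q k * A)"
proof -
  define M where "M = (3 * weight_const * A) powr q"
  define R' where "R' = 1 - 4/5 * (1 - R)"
  define \<nu> where "\<nu> = push_measure q (u k) (\<tau> k)"
  have R': "R' < 1" using R by (simp add: R'_def)
  note hyps = u_holomorphic[OF k] self_map[OF k]
  have carleson: "emeasure \<nu> (ball a ((1 - norm a) / 2)) \<le> ennreal (M * eval_gauge k (norm a) powr (q / p))"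
    if a: "R \<le> norm a" "norm a < 1" for a
  proof -
    have "emeasure \<nu> (ball a ((1 - norm a) / 2))
        \<le> ennreal ((3 * weight_const * A * eval_gauge k (norm a) powr (1 / p)) powr q)"
      unfolding \<nu>_def using a R k A weight_const_pos ball_subset_disc[of "(1 - norm a) / 2" a]
      by (intro emeasure_push_measure_le hyps q_pos Lq_norm_u_near_le test)
        (auto simp: sets_restrict_space_iff)
    also have "(3 * weight_const * A * eval_gauge k (norm a) powr (1 / p)) powr q
        = M * eval_gauge k (norm a) powr (q / p)"
      unfolding M_def powr_mult[of _ "eval_gauge k (norm a) powr (1 / p)"] powr_powr by simp
    finally show ?thesis .
  qed
  have root: "(ess_const q k * A) powr q = carleson_const q k * M"
    unfolding ess_const_def M_def mult.assoc powr_mult[of "carleson_const q k powr (1 / q)"] powr_powr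
    using q_pos carleson_const_pos[of q k] by simp
  have "ess_norm \<omega> p \<upsilon> q (\<lambda>f. wC (u k) (\<tau> k) ((deriv ^^ k) f))
      \<le> op_norm \<omega> p \<upsilon> q (\<lambda>f z. wC (u k) (\<tau> k) ((deriv ^^ k) f) z
        - trunc_wC R' (u k) (\<tau> k) ((deriv ^^ k) f) z)"
    unfolding ess_norm_def
    by (intro INF_lower CollectI compact_op_trunc_wC hyps Lq_norm_u_finite[OF k] R')
  also have "\<dots> \<le> ennreal (ess_const q k * A)"
  proof (rule op_norm_le[OF p_pos])
    fix f assume f: "f holomorphic_on disc" "Ap_int \<omega> p f \<le> 1"
    have "(\<integral>\<^sup>+w\<in>{w. R' < norm w}. ennreal (norm ((deriv ^^ k) f w) powr q) \<partial>\<nu>)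
        \<le> ennreal (carleson_const q k * M)"
      unfolding R'_def \<nu>_def
      by (rule carleson_embedding[OF p_le_q sets_push_measure
        finite_measure_push_measure[OF hyps Lq_norm_u_finite[OF k]]
            _ carleson[unfolded \<nu>_def] f])
        (simp_all add: M_def)
    then show "Lq_norm \<upsilon> q (\<lambda>z. wC (u k) (\<tau> k) ((deriv ^^ k) f) z
        - trunc_wC R' (u k) (\<tau> k) ((deriv ^^ k) f) z)
        \<le> ennreal (ess_const q k * A)"
      using A ess_const_pos[of q k]
      by (simp add: Lq_norm_wC_diff_trunc_wC hyps holomorphic_higher_deriv_disc f root_enn_le_iff q_pos
        root \<nu>_def)
  qed
  finally show ?thesis .
qed

lemma Lq_norm_sum_op_test_fun_le:
  assumes K: "compact_op \<omega> p \<upsilon> q K" and e: "0 < e"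
  obtains R where "1/2 \<le> R" "R < 1"
    "\<And>j a. j < 3 \<Longrightarrow> R \<le> norm a \<Longrightarrow> norm a < 1 \<Longrightarrow>
       Lq_norm \<upsilon> q (sum_op u \<tau> (test_fun j a)) \<le> op_norm \<omega> p \<upsilon> q (\<lambda>f z. sum_op u \<tau> f z - K f z) + e"
proof -
  have "\<forall>\<^sub>F r in at_left 1. \<forall>j\<in>{..<3}. \<forall>a. norm a = r \<longrightarrow> Lq_norm \<upsilon> q (K (test_fun j a)) \<le> e"
    using compact_op_test_fun_small[OF K _ e] by (intro eventually_ball_finite) auto
  then obtain r where r: "r < 1" and small: "\<And>j a. j < 3 \<Longrightarrow> r < norm a \<Longrightarrow> norm a < 1 \<Longrightarrow>
      Lq_norm \<upsilon> q (K (test_fun j a)) \<le> e"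
    unfolding eventually_at_left_field by auto
  define R where "R = max (1/2) ((r + 1) / 2)"
  have R: "1/2 \<le> R" "R < 1" "r < R" using r by (simp_all add: R_def less_max_iff_disj field_simps)
  have "Lq_norm \<upsilon> q (sum_op u \<tau> (test_fun j a)) \<le> op_norm \<omega> p \<upsilon> q (\<lambda>f z. sum_op u \<tau> f z - K f z) + e"
    if j: "j < 3" and a: "R \<le> norm a" "norm a < 1" for j a
  proof -
    have f: "test_fun j a holomorphic_on disc" "Ap_int \<omega> p (test_fun j a) \<le> ennreal 1"
      using j a by (simp_all add: test_fun_holomorphic Ap_int_test_fun_le)
    note mem = Ap_space_if_Ap_int_le[OF f]
    have "Lq_norm \<upsilon> q (sum_op u \<tau> (test_fun j a))
        \<le> Lq_norm \<upsilon> q (\<lambda>z. sum_op u \<tau> (test_fun j a) z - K (test_fun j a) z)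
          + Lq_norm \<upsilon> q (K (test_fun j a))"
      by (intro Lq_norm_triangle q_ge_1 sum_op_measurable compact_op_measurable[OF K] mem f)
    also have "\<dots> \<le> op_norm \<omega> p \<upsilon> q (\<lambda>f z. sum_op u \<tau> f z - K f z) + e"
      using f R j a
      by (intro add_mono small Lq_norm_le_op_norm[where T = "\<lambda>f z. sum_op u \<tau> f z - K f z"] mem p_pos) auto
    finally show ?thesis .
  qed
  then show thesis using that R by blast
qed

lemma ess_norm_summand_le_op_norm:
  assumes k: "k < 2" and K: "compact_op \<omega> p \<upsilon> q K"
  shows "ess_norm \<omega> p \<upsilon> q (\<lambda>f. wC (u k) (\<tau> k) ((deriv ^^ k) f))
    \<le> ennreal (ess_const q k) * op_norm \<omega> p \<upsilon> q (\<lambda>f z. sum_op u \<tau> f z - K f z)"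
proof (rule ennreal_le_epsilon)
  fix e :: real
  assume e: "0 < e" and "ennreal (ess_const q k) * op_norm \<omega> p \<upsilon> q (\<lambda>f z. sum_op u \<tau> f z - K f z) < top"
  then obtain A where A: "op_norm \<omega> p \<upsilon> q (\<lambda>f z. sum_op u \<tau> f z - K f z) = ennreal A" "0 \<le> A"
    using ess_const_pos[of q k]
    by (cases "op_norm \<omega> p \<upsilon> q (\<lambda>f z. sum_op u \<tau> f z - K f z)") (auto simp: ennreal_mult_top)
  define d where "d = e / ess_const q k"
  have d: "0 < d" using e ess_const_pos[of q k] by (simp add: d_def)
  obtain R where R: "1/2 \<le> R" "R < 1"
    and test: "\<And>j a. j < 3 \<Longrightarrow> R \<le> norm a \<Longrightarrow> norm a < 1 \<Longrightarrow>
        Lq_norm \<upsilon> q (sum_op u \<tau> (test_fun j a)) \<le> ennreal A + ennreal d"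
    using Lq_norm_sum_op_test_fun_le[OF K, of "ennreal d"] d unfolding A by auto
  have "ess_norm \<omega> p \<upsilon> q (\<lambda>f. wC (u k) (\<tau> k) ((deriv ^^ k) f)) \<le> ennreal (ess_const q k * (A + d))"
    using test A d by (intro ess_norm_summand_le[OF k R]) (auto simp flip: ennreal_plus)
  also have "ess_const q k * (A + d) = ess_const q k * A + e"
    using ess_const_pos[of q k] by (simp add: d_def distrib_left)
  also have "ennreal \<dots> = ennreal (ess_const q k) * ennreal A + ennreal e"
    using A e ess_const_pos[of q k] by (simp add: ennreal_mult)
  finally show "ess_norm \<omega> p \<upsilon> q (\<lambda>f. wC (u k) (\<tau> k) ((deriv ^^ k) f))
      \<le> ennreal (ess_const q k) * op_norm \<omega> p \<upsilon> q (\<lambda>f z. sum_op u \<tau> f z - K f z) + ennreal e"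
    by (simp only: A)
qed

lemma ess_norm_summand_le_ess_norm:
  assumes "k < 2"
  shows "ess_norm \<omega> p \<upsilon> q (\<lambda>f. wC (u k) (\<tau> k) ((deriv ^^ k) f))
      \<le> ennreal (ess_const q k) * ess_norm \<omega> p \<upsilon> q (sum_op u \<tau>)"
  unfolding ess_norm_def[of \<omega> p \<upsilon> q "sum_op u \<tau>"]
  using ess_norm_summand_le_op_norm[OF assms] ess_const_pos by (intro le_cmult_INF_ennreal) auto

lemma ess_norm_sum_op_le:
  "ess_norm \<omega> p \<upsilon> q (sum_op u \<tau>) \<le> (\<Sum>k<2. ess_norm \<omega> p \<upsilon> q (\<lambda>f. wC (u k) (\<tau> k) ((deriv ^^ k) f)))"
proof -
  let ?T = "\<lambda>k f. wC (u k) (\<tau> k) ((deriv ^^ k) f)"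
  have measurable: "?T k f \<in> borel_measurable (restrict_space borel disc)" if "k < 2" "f \<in> Ap_space \<omega> p"
    for k f
    using that
    by (intro wC_measurable u_holomorphic self_map holomorphic_higher_deriv_disc)
      (simp_all add: Ap_space_def)
  have "ess_norm \<omega> p \<upsilon> q (\<lambda>f z. ?T 0 f z + ?T 1 f z) \<le> ess_norm \<omega> p \<upsilon> q (?T 0) + ess_norm \<omega> p \<upsilon> q (?T 1)"
    by (intro ess_norm_add_le measurable) auto
  then show ?thesis
    by (simp add: sum_op_def[abs_def] sum_lessThan_2)
qed

lemma ess_norm_sum_op_approx:
  defines "E \<equiv> \<Sum>k<2. ess_norm \<omega> p \<upsilon> q (\<lambda>f. wC (u k) (\<tau> k) ((deriv ^^ k) f))"
  assumes C: "1 + (\<Sum>k<2. ess_const q k) \<le> C"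
  shows "ess_norm \<omega> p \<upsilon> q (sum_op u \<tau>) \<le> ennreal C * E" and "E \<le> ennreal C * ess_norm \<omega> p \<upsilon> q (sum_op u \<tau>)"
proof -
  have pos: "0 \<le> (\<Sum>k<2. ess_const q k)"
    using ess_const_pos by (intro sum_nonneg less_imp_le)
  have "ess_norm \<omega> p \<upsilon> q (sum_op u \<tau>) \<le> ennreal 1 * E"
    using ess_norm_sum_op_le by (simp add: E_def)
  also have "\<dots> \<le> ennreal C * E"
    using C pos by (intro mult_right_mono ennreal_leI) auto
  finally show "ess_norm \<omega> p \<upsilon> q (sum_op u \<tau>) \<le> ennreal C * E" .
  have "E \<le> (\<Sum>k<2. ennreal (ess_const q k) * ess_norm \<omega> p \<upsilon> q (sum_op u \<tau>))"
    unfolding E_def by (intro sum_mono ess_norm_summand_le_ess_norm) simp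
  also have "\<dots> = ennreal (\<Sum>k<2. ess_const q k) * ess_norm \<omega> p \<upsilon> q (sum_op u \<tau>)"
    using ess_const_pos[of q] by (simp add: sum_distrib_right less_imp_le flip: sum_ennreal)
  also have "\<dots> \<le> ennreal C * ess_norm \<omega> p \<upsilon> q (sum_op u \<tau>)"
    using C by (intro mult_right_mono ennreal_leI) auto
  finally show "E \<le> ennreal C * ess_norm \<omega> p \<upsilon> q (sum_op u \<tau>)" .
qed

end

theorem theorem3p1:
  fixes p q :: real and \<omega> :: "real \<Rightarrow> real"
  assumes "1 < p" and "p \<le> q" and "weight_D \<omega>"
  shows "\<exists>C>0. \<forall>(\<upsilon>::complex measure) \<phi> \<psi> u0 u1.
     sets \<upsilon> = sets borel \<and> self_map \<phi> \<and> self_map \<psi> \<and>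
     u0 holomorphic_on disc \<and> u1 holomorphic_on disc \<and>
     bounded_op \<omega> p \<upsilon> q (\<lambda>f z. wC u0 \<phi> f z + wD u1 \<psi> f z) \<longrightarrow>
       ess_norm \<omega> p \<upsilon> q (\<lambda>f z. wC u0 \<phi> f z + wD u1 \<psi> f z)
         \<le> ennreal C * (ess_norm \<omega> p \<upsilon> q (wC u0 \<phi>) + ess_norm \<omega> p \<upsilon> q (wD u1 \<psi>)) \<and>
       ess_norm \<omega> p \<upsilon> q (wC u0 \<phi>) + ess_norm \<omega> p \<upsilon> q (wD u1 \<psi>)
         \<le> ennreal C * ess_norm \<omega> p \<upsilon> q (\<lambda>f z. wC u0 \<phi> f z + wD u1 \<psi> f z)"
proof -
  obtain \<kappa> \<sigma> \<Lambda> where "regular_weight \<omega> \<kappa> \<sigma> \<Lambda>"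
    by (rule weight_D_imp_regular_weight[OF assms(3)])
  then interpret regular_weight \<omega> \<kappa> \<sigma> \<Lambda> .
  interpret bergman_regular \<omega> \<kappa> \<sigma> \<Lambda> p
    by unfold_locales (rule assms(1))
  define C where "C = 1 + (\<Sum>k<2. ess_const q k)"
  have C: "0 < C"
    using ess_const_pos[of q] by (simp add: C_def add_pos_nonneg sum_nonneg less_imp_le)
  show ?thesis
  proof (intro exI[of _ C] conjI[OF C] allI impI; elim conjE)
    fix \<upsilon> :: "complex measure" and \<phi> \<psi> u0 u1 :: "complex \<Rightarrow> complex"
    let ?T = "\<lambda>f z. wC u0 \<phi> f z + wD u1 \<psi> f z"
    define u where "u k = (if k = 0 then u0 else u1)" for k :: nat
    define \<tau> where "\<tau> k = (if k = 0 then \<phi> else \<psi>)" for k :: nat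
    have T: "sum_op u \<tau> = ?T" and summands: "wC (u 0) (\<tau> 0) = wC u0 \<phi>"
      "(\<lambda>f. wC (u 1) (\<tau> 1) (deriv f)) = wD u1 \<psi>"
      by (simp_all add: fun_eq_iff sum_op_def sum_lessThan_2 u_def \<tau>_def wC_def wD_def)
    assume "sets \<upsilon> = sets borel" "self_map \<phi>" "self_map \<psi>" "u0 holomorphic_on disc" "u1 holomorphic_on disc"
      "bounded_op \<omega> p \<upsilon> q ?T"
    then interpret bounded_sum_op \<omega> \<kappa> \<sigma> \<Lambda> p \<upsilon> q u \<tau>
      using assms by unfold_locales (auto simp: T, auto simp: u_def \<tau>_def)
    show "ess_norm \<omega> p \<upsilon> q ?T \<le> ennreal C * (ess_norm \<omega> p \<upsilon> q (wC u0 \<phi>) + ess_norm \<omega> p \<upsilon> q (wD u1 \<psi>))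
      \<and> ess_norm \<omega> p \<upsilon> q (wC u0 \<phi>) + ess_norm \<omega> p \<upsilon> q (wD u1 \<psi>) \<le> ennreal C * ess_norm \<omega> p \<upsilon> q ?T"
      using ess_norm_sum_op_approx[of C] by (simp add: C_def sum_lessThan_2 T summands[simplified])
  qed
qed

end
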